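(* Let $\alpha\in(0,1)$. Suppose that $U(\xi)$ is a $(1-\alpha)$-homogeneous steady solution to the two-dimensional incompressible Euler equations. Suppose in addition that the corresponding pseudo-velocity $$\tilde U(\xi):=U(\xi)-\frac{\xi}{\alpha}$$ has a stagnation point in addition to the one at the origin $\xi=0$. Then the vorticity $\mathrm{curl}\,U$ is discontinuous on a ray from the origin.
   Context: Let $\lambda=2-\alpha\in(1,2)$, let $(r,\theta)$ be polar coordinates of $\xi\in\mathbb{R}^2$, and $\nabla^\perp f=(-\partial_yf,\partial_xf)$. A $(1-\alpha)$-homogeneous steady solution is a vector field of the form $U=\nabla^\perp(r^\lambda\psi(\theta))=r^{\lambda-1}(-\psi'\mathbf{e}_r+\lambda\psi\,\mathbf{e}_\theta)$, with $\psi$ $2\pi$-periodic, $\psi\in H^1(\mathbb{T})$, satisfying (weakly) $U\cdot\nabla U+\nabla p=0$, $\mathrm{div}\,U=0$ with pressure $p=r^{2\lambda-2}P(\theta)$. Equivalently, $P$ is a constant and $\psi$ solves $$-\lambda\psi\psi''+(\lambda-1)(\psi')^2-\lambda^2\psi^2+2(\lambda-1)P=0 .$$ A stagnation point of $\tilde U$ is a point where $\tilde U=0$. *)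

theory Defs
  imports "HOL-Analysis.Analysis"
begin

section \<open>Test functions\<close>

definition partial_deriv :: "'a::euclidean_space \<Rightarrow> ('a \<Rightarrow> real) \<Rightarrow> 'a \<Rightarrow> real" where
  "partial_deriv b f x = frechet_derivative f (at x) b"

primrec Ck :: "nat \<Rightarrow> ('a::euclidean_space \<Rightarrow> real) \<Rightarrow> bool" where
  "Ck 0 f \<longleftrightarrow> continuous_on UNIV f"
| "Ck (Suc k) f \<longleftrightarrow> (\<forall>x. f differentiable (at x)) \<and> (\<forall>b\<in>Basis. Ck k (partial_deriv b f))"

definition smooth :: "('a::euclidean_space \<Rightarrow> real) \<Rightarrow> bool" where
  "smooth f \<longleftrightarrow> (\<forall>k. Ck k f)"

definition test_function :: "'a::euclidean_space set \<Rightarrow> ('a \<Rightarrow> real) \<Rightarrow> bool" where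
  "test_function V \<phi> \<longleftrightarrow> smooth \<phi> \<and> compact (closure {x. \<phi> x \<noteq> 0}) \<and> closure {x. \<phi> x \<noteq> 0} \<subseteq> V"

definition locally_integrable_on :: "'a::euclidean_space set \<Rightarrow> ('a \<Rightarrow> real) \<Rightarrow> bool" where
  "locally_integrable_on V f \<longleftrightarrow> (\<forall>K. compact K \<and> K \<subseteq> V \<longrightarrow> f absolutely_integrable_on K)"

section \<open>Weak steady Euler flows and their vorticity in the plane\<close>

abbreviation pd :: "2 \<Rightarrow> (real^2 \<Rightarrow> real) \<Rightarrow> real^2 \<Rightarrow> real" where
  "pd i f \<equiv> partial_deriv (axis i 1) f"

text \<open>
  In the weak momentum equation the convective term is written in divergence form,
  \<open>U \<cdot> \<nabla>U = div (U \<otimes> U)\<close>, which is legitimate since \<open>div U = 0\<close>.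
\<close>

definition weak_steady_euler :: "(real^2 \<Rightarrow> real^2) \<Rightarrow> (real^2 \<Rightarrow> real) \<Rightarrow> bool" where
  "weak_steady_euler U p \<longleftrightarrow>
     U \<in> borel_measurable lebesgue \<and>
     locally_integrable_on UNIV (\<lambda>x. (norm (U x))\<^sup>2) \<and>
     locally_integrable_on UNIV p \<and>
     (\<forall>\<phi>. (\<forall>i. test_function UNIV (\<lambda>x. \<phi> x $ i)) \<longrightarrow>
        (LINT x|lebesgue.
           (\<Sum>i\<in>UNIV. \<Sum>j\<in>UNIV. U x $ i * U x $ j * pd j (\<lambda>y. \<phi> y $ i) x)
           + p x * (\<Sum>i\<in>UNIV. pd i (\<lambda>y. \<phi> y $ i) x)) = 0) \<and>
     (\<forall>\<phi>. test_function UNIV \<phi> \<longrightarrow>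
        (LINT x|lebesgue. (\<Sum>i\<in>UNIV. U x $ i * pd i \<phi> x)) = 0)"

text \<open>
  The vorticity \<open>curl U = \<partial>\<^sub>1U\<^sub>2 - \<partial>\<^sub>2U\<^sub>1\<close> of a merely locally square integrable field is a
  distribution.
\<close>

definition has_weak_curl_on :: "(real^2 \<Rightarrow> real^2) \<Rightarrow> (real^2 \<Rightarrow> real) \<Rightarrow> (real^2) set \<Rightarrow> bool" where
  "has_weak_curl_on U \<omega> V \<longleftrightarrow>
     locally_integrable_on V \<omega> \<and>
     (\<forall>\<phi>. test_function V \<phi> \<longrightarrow>
        - (LINT x|lebesgue. U x $ 2 * pd 1 \<phi> x - U x $ 1 * pd 2 \<phi> x)
        = (LINT x|lebesgue. \<omega> x * \<phi> x))"

text \<open>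
  As \<open>curl U\<close> is only determined almost everywhere, it counts as continuous at a point if, near
  that point, it is represented by some locally integrable function that is continuous there.
  In particular it is not continuous where it has a singular part, such as a vortex sheet.
\<close>

definition curl_continuous_at :: "(real^2 \<Rightarrow> real^2) \<Rightarrow> real^2 \<Rightarrow> bool" where
  "curl_continuous_at U \<xi> \<longleftrightarrow>
     (\<exists>V \<omega>. open V \<and> \<xi> \<in> V \<and> has_weak_curl_on U \<omega> V \<and> isCont \<omega> \<xi>)"

section \<open>Homogeneous steady solutions\<close>

definition e_r :: "real \<Rightarrow> real^2" where
  "e_r \<theta> = vector [cos \<theta>, sin \<theta>]"

definition e_theta :: "real \<Rightarrow> real^2" where
  "e_theta \<theta> = vector [- sin \<theta>, cos \<theta>]"

text \<open>
  \<open>H1_circle \<psi> \<psi>'\<close>: \<open>\<psi>\<close> is an element of \<open>H\<^sup>1\<close> of the circle, given by its continuous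
  representative, and \<open>\<psi>'\<close> is its square integrable weak derivative. Since velocities are
  evaluated at single points (stagnation points), the last conjunct fixes the value of \<open>\<psi>'\<close>
  wherever \<open>\<psi>\<close> is classically differentiable, which is the case almost everywhere.
\<close>

definition H1_circle :: "(real \<Rightarrow> real) \<Rightarrow> (real \<Rightarrow> real) \<Rightarrow> bool" where
  "H1_circle \<psi> \<psi>' \<longleftrightarrow>
     continuous_on UNIV \<psi> \<and>
     (\<forall>\<theta>. \<psi> (\<theta> + 2 * pi) = \<psi> \<theta>) \<and> (\<forall>\<theta>. \<psi>' (\<theta> + 2 * pi) = \<psi>' \<theta>) \<and>
     \<psi>' \<in> borel_measurable lebesgue \<and>
     (\<lambda>\<theta>. (\<psi>' \<theta>)\<^sup>2) absolutely_integrable_on {0..2 * pi} \<and>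
     (\<forall>\<phi>. smooth \<phi> \<and> (\<forall>\<theta>. \<phi> (\<theta> + 2 * pi) = \<phi> \<theta>) \<longrightarrow>
        (LINT \<theta>:{0..2 * pi}|lebesgue. \<psi> \<theta> * deriv \<phi> \<theta>)
        = - (LINT \<theta>:{0..2 * pi}|lebesgue. \<psi>' \<theta> * \<phi> \<theta>)) \<and>
     (\<forall>\<theta> D. (\<psi> has_real_derivative D) (at \<theta>) \<longrightarrow> \<psi>' \<theta> = D)"

text \<open>
  With \<open>\<lambda> = 2 - \<alpha>\<close> the velocity is
  \<open>\<nabla>\<^sup>\<bottom>(r\<^sup>\<lambda> \<psi>(\<theta>)) = r\<^bsup>\<lambda>-1\<^esup> (-\<psi>'(\<theta>) e\<^sub>r + \<lambda> \<psi>(\<theta>) e\<^sub>\<theta>)\<close> and the pressure \<open>r\<^bsup>2\<lambda>-2\<^esup> P(\<theta>)\<close>.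
\<close>

definition homogeneous_steady_solution :: "real \<Rightarrow> (real^2 \<Rightarrow> real^2) \<Rightarrow> bool" where
  "homogeneous_steady_solution \<alpha> U \<longleftrightarrow>
     (\<exists>\<psi> \<psi>' P p. let l = 2 - \<alpha> in
        H1_circle \<psi> \<psi>' \<and>
        U 0 = 0 \<and>
        (\<forall>r>0. \<forall>\<theta>. U (r *\<^sub>R e_r \<theta>) =
            r powr (l - 1) *\<^sub>R (- \<psi>' \<theta> *\<^sub>R e_r \<theta> + (l * \<psi> \<theta>) *\<^sub>R e_theta \<theta>)) \<and>
        (\<forall>r>0. \<forall>\<theta>. p (r *\<^sub>R e_r \<theta>) = r powr (2 * l - 2) * P \<theta>) \<and>
        weak_steady_euler U p)"

definition pseudo_velocity :: "real \<Rightarrow> (real^2 \<Rightarrow> real^2) \<Rightarrow> real^2 \<Rightarrow> real^2" where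
  "pseudo_velocity \<alpha> U \<xi> = U \<xi> - (1 / \<alpha>) *\<^sub>R \<xi>"

definition stagnation_point :: "(real^2 \<Rightarrow> real^2) \<Rightarrow> real^2 \<Rightarrow> bool" where
  "stagnation_point W \<xi> \<longleftrightarrow> W \<xi> = 0"

end

theory Submission
  imports Defs
begin

text \<open>
  Write \<open>l = 2 - \<alpha> \<in> (1, 2)\<close> and let \<open>\<psi>\<close> be the angular profile of the stream function
  \<open>r\<^sup>l \<psi>(\<theta>)\<close>. The formal reason for the theorem is the following. The Euler equations give the
  profile equation \<open>l \<psi> (\<psi>'' + l\<^sup>2 \<psi>) = (l - 1) H\<close> with \<open>H = \<psi>'\<^sup>2 + l\<^sup>2 \<psi>\<^sup>2 + const\<close>, so on
  each nodal interval of \<open>\<psi>\<close> the quantity \<open>H |\<psi>|\<^bsup>-2(l-1)/l\<^esup>\<close> is constant, and the angular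
  vorticity \<open>\<psi>'' + l\<^sup>2 \<psi>\<close> is a multiple of \<open>|\<psi>|\<^bsup>1-2/l\<^esup>\<close>, which blows up at the nodes unless \<open>H\<close>
  vanishes. A stagnation point of the pseudo-velocity off the origin is a simple zero of \<open>\<psi>\<close>. If the
  vorticity stays bounded there, \<open>H\<close> vanishes on the adjacent nodal intervals, hence \<open>\<psi>\<close> solves
  \<open>\<psi>'' = - l\<^sup>2 \<psi>\<close> through the next zero, which is again simple, and so on around the circle. But
  \<open>sin (l (\<theta> - \<theta>\<^sub>0))\<close> is not \<open>2\<pi>\<close>-periodic for \<open>1 < l < 2\<close>.

  To make this rigorous for a weak solution, suppose that every ray contains a point at which the
  curl is continuous.

  \<^item> Continuity of the curl at one point of a ray bounds it near that point. Testing against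
    functions \<open>g(r) h(\<theta>)\<close> (\<open>polar_product\<close>), whose integrals separate in polar coordinates
    (\<open>polar_integral_separable\<close>), turns this into a bound of the weak second derivative of \<open>\<psi>\<close>
    near that angle (\<open>weak_curl_bound\<close>). A continuous function with bounded weak second
    derivative has a Lipschitz derivative (\<open>weak_second_derivative_bound_imp_C11\<close>). So \<open>\<psi>\<close> is
    continuously differentiable, and \<open>\<psi>'\<close> is locally Lipschitz; in particular the pointwise values
    of \<open>\<psi>'\<close> are the classical ones, also at the stagnation point.

  \<^item> Testing the momentum equation with a divergence free field removes the pressure and leaves
    a weak second order equation for \<open>\<psi>\<psi>'\<close> (\<open>weak_momentum\<close>). By the same regularity result,
    applied with bound \<open>0\<close>, it integrates to a classical first order equation for \<open>\<psi>\<psi>'\<close>, whose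
    constant of integration plays the role of the constant pressure (\<open>first_integral\<close>).

  \<^item> That equation carries the argument above: its value at a zero of \<open>\<psi>\<close> shows that all zeros are
    simple with the same slope up to sign, the Lipschitz bound on \<open>\<psi>'\<close> forces \<open>H = 0\<close> on every
    nodal interval (\<open>nodal_integral_vanishes\<close>), and periodicity fails (\<open>no_C11_profile\<close>).
\<close>

section \<open>Smooth functions on open sets\<close>

text \<open>
  The test functions below are built from \<open>arctan\<close>, \<open>sqrt\<close> and quotients, which are smooth only on
  part of their domain; hence the relative version of \<^const>\<open>Ck\<close>.
\<close>

primrec Ck_on :: "nat \<Rightarrow> 'a::euclidean_space set \<Rightarrow> ('a \<Rightarrow> real) \<Rightarrow> bool" where
  "Ck_on 0 S f \<longleftrightarrow> continuous_on S f"
| "Ck_on (Suc k) S f \<longleftrightarrow> (\<forall>x\<in>S. f differentiable (at x)) \<and> (\<forall>b\<in>Basis. Ck_on k S (partial_deriv b f))"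

definition smooth_on :: "'a::euclidean_space set \<Rightarrow> ('a \<Rightarrow> real) \<Rightarrow> bool" where
  "smooth_on S f \<longleftrightarrow> (\<forall>k. Ck_on k S f)"

lemma Ck_on_UNIV: "Ck_on k UNIV f \<longleftrightarrow> Ck k f"
  by (induction k arbitrary: f) auto

lemma partial_deriv_eq: "(f has_derivative f') (at x) \<Longrightarrow> partial_deriv b f x = f' b"
  unfolding partial_deriv_def by (metis frechet_derivative_at)

lemma partial_deriv_real: "(f has_real_derivative d) (at x) \<Longrightarrow> partial_deriv 1 f x = d"
  by (simp add: has_field_derivative_def partial_deriv_eq)

lemma partial_deriv_cong:
  assumes "open S" "x \<in> S" "\<And>y. y \<in> S \<Longrightarrow> f y = g y"
  shows "partial_deriv b f x = partial_deriv b g x"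
proof -
  have "(f has_derivative D) (at x) \<longleftrightarrow> (g has_derivative D) (at x)" for D
    using has_derivative_transform_within_open[of f D x UNIV S g]
      has_derivative_transform_within_open[of g D x UNIV S f] assms by auto
  then show ?thesis
    unfolding partial_deriv_def frechet_derivative_def by simp
qed

lemma Ck_on_cong:
  assumes "open S" "\<And>y. y \<in> S \<Longrightarrow> f y = g y" "Ck_on k S f"
  shows "Ck_on k S g"
  using assms(2,3)
proof (induction k arbitrary: f g)
  case 0
  then show ?case by (simp cong: continuous_on_cong)
next
  case (Suc k)
  have "g differentiable (at x)" if x: "x \<in> S" for x
  proof -
    from Suc.prems(2) x obtain D where "(f has_derivative D) (at x)"
      by (auto simp: differentiable_def)
    from has_derivative_transform_within_open[OF this assms(1) x Suc.prems(1)]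
    show ?thesis by (auto simp: differentiable_def)
  qed
  moreover have "Ck_on k S (partial_deriv b g)" if "b \<in> Basis" for b
    by (rule Suc.IH[of "partial_deriv b f"])
      (use Suc.prems that partial_deriv_cong[OF assms(1), of _ f g b] in auto)
  ultimately show ?case by simp
qed

lemma Ck_on_SucD: "Ck_on (Suc k) S f \<Longrightarrow> Ck_on k S f"
proof (induction k arbitrary: f)
  case 0
  then show ?case
    by (auto intro!: continuous_at_imp_continuous_on differentiable_imp_continuous_within)
qed auto

lemma Ck_on_const: "Ck_on k S (\<lambda>_. c)"
proof (induction k arbitrary: c)
  case (Suc k)
  have "partial_deriv b (\<lambda>_. c) = (\<lambda>_::'a. 0)" for b
    by (rule ext, subst partial_deriv_eq) auto
  then show ?case using Suc by auto
qed simp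

lemma Ck_on_inner: "Ck_on k S (\<lambda>x. x \<bullet> a)"
proof (cases k)
  case (Suc n)
  have d: "((\<lambda>x. x \<bullet> a) has_derivative (\<lambda>h. h \<bullet> a)) (at x)" for x
    by (auto intro!: derivative_eq_intros)
  have "partial_deriv b (\<lambda>x. x \<bullet> a) = (\<lambda>_. b \<bullet> a)" for b
    by (rule ext, subst partial_deriv_eq[OF d]) simp
  then show ?thesis using Suc d by (auto simp: Ck_on_const differentiable_def)
qed (auto intro!: continuous_intros)

lemma Ck_on_add:
  assumes "open S" "Ck_on k S f" "Ck_on k S g"
  shows "Ck_on k S (\<lambda>x. f x + g x)"
  using assms(2,3)
proof (induction k arbitrary: f g)
  case (Suc k)
  have d: "((\<lambda>x. f x + g x) has_derivative
      (\<lambda>h. frechet_derivative f (at x) h + frechet_derivative g (at x) h)) (at x)" if "x \<in> S" for x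
    using Suc.prems that by (auto intro!: derivative_eq_intros simp: frechet_derivative_works[symmetric])
  have eq: "partial_deriv b f x + partial_deriv b g x = partial_deriv b (\<lambda>x. f x + g x) x" if "x \<in> S" for b x
    using partial_deriv_eq[OF d[OF that], of b] by (simp add: partial_deriv_def)
  have "Ck_on k S (partial_deriv b (\<lambda>x. f x + g x))" if "b \<in> Basis" for b
    by (rule Ck_on_cong[OF assms(1) eq Suc.IH]) (use Suc.prems that in auto)
  with d show ?case by (auto simp: differentiable_def)
qed (auto intro!: continuous_intros)

lemma Ck_on_mult:
  assumes "open S" "Ck_on k S f" "Ck_on k S g"
  shows "Ck_on k S (\<lambda>x. f x * g x)"
  using assms(2,3)
proof (induction k arbitrary: f g)
  case (Suc k)
  have d: "((\<lambda>x. f x * g x) has_derivative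
      (\<lambda>h. f x * frechet_derivative g (at x) h + frechet_derivative f (at x) h * g x)) (at x)" if "x \<in> S" for x
    using Suc.prems that by (auto intro!: derivative_eq_intros simp: frechet_derivative_works[symmetric])
  have eq: "f x * partial_deriv b g x + partial_deriv b f x * g x = partial_deriv b (\<lambda>x. f x * g x) x"
    if "x \<in> S" for b x
    using partial_deriv_eq[OF d[OF that], of b] by (simp add: partial_deriv_def)
  have "Ck_on k S (partial_deriv b (\<lambda>x. f x * g x))" if "b \<in> Basis" for b
    by (rule Ck_on_cong[OF assms(1) eq Ck_on_add[OF assms(1) Suc.IH Suc.IH]])
      (use Suc.prems[THEN Ck_on_SucD] Suc.prems that in auto)
  with d show ?case by (auto simp: differentiable_def)
qed (auto intro!: continuous_intros)

lemma Ck_on_compose: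
  fixes g :: "real \<Rightarrow> real"
  assumes "open S" "open T" "Ck_on k T g" "Ck_on k S f" "f ` S \<subseteq> T"
  shows "Ck_on k S (\<lambda>x. g (f x))"
  using assms(3,4)
proof (induction k arbitrary: g)
  case 0
  then show ?case using assms(5) by (auto intro: continuous_on_compose2)
next
  case (Suc k)
  have d: "((\<lambda>x. g (f x)) has_derivative
      (\<lambda>h. frechet_derivative g (at (f x)) (frechet_derivative f (at x) h))) (at x)" if "x \<in> S" for x
    using Suc.prems that assms(5)
    by (intro has_derivative_compose[of f _ x UNIV g]) (auto simp: frechet_derivative_works[symmetric])
  have lin: "frechet_derivative g (at (f x)) u = partial_deriv 1 g (f x) * u" if "x \<in> S" for x u
  proof -
    have "linear (frechet_derivative g (at (f x)))"
      using Suc.prems that assms(5) by (intro linear_frechet_derivative) auto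
    from linear_scale[OF this, of u 1] show ?thesis
      by (simp add: partial_deriv_def)
  qed
  have eq: "partial_deriv 1 g (f x) * partial_deriv b f x = partial_deriv b (\<lambda>x. g (f x)) x"
    if "x \<in> S" for b x
    using partial_deriv_eq[OF d[OF that], of b] lin[OF that, of "frechet_derivative f (at x) b"] by (simp add: partial_deriv_def)
  have "Ck_on k S (partial_deriv b (\<lambda>x. g (f x)))" if "b \<in> Basis" for b
    by (rule Ck_on_cong[OF assms(1) eq Ck_on_mult[OF assms(1) Suc.IH[of "partial_deriv 1 g"]]])
      (use Suc.prems(2)[THEN Ck_on_SucD] Suc.prems that in auto)
  with d show ?case by (auto simp: differentiable_def)
qed

lemma Ck_on_real_SucI:
  assumes "open S" "\<And>x. x \<in> S \<Longrightarrow> (f has_real_derivative f' x) (at x)" "Ck_on k S f'"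
  shows "Ck_on (Suc k) S f"
proof -
  have "Ck_on k S (partial_deriv 1 f)"
    by (rule Ck_on_cong[OF assms(1) _ assms(3)]) (simp add: partial_deriv_real[OF assms(2)])
  with assms(2) show ?thesis
    by (auto simp: differentiable_def has_field_derivative_def)
qed

lemma Ck_on_real_inverse: "Ck_on k {x::real. x \<noteq> 0} inverse"
proof (induction k)
  case (Suc k)
  have op: "open {x::real. x \<noteq> 0}" by (simp add: open_Collect_neq continuous_intros)
  have "Ck_on k {x::real. x \<noteq> 0} (\<lambda>x. (-1) * (inverse x * inverse x))"
    by (intro Ck_on_mult op Ck_on_const Suc)
  then show ?case
    by (rule Ck_on_real_SucI[OF op, rotated]) (auto intro!: derivative_eq_intros)
qed (auto intro!: continuous_intros)

lemma Ck_on_inverse: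
  assumes "open S" "Ck_on k S f" "\<And>x. x \<in> S \<Longrightarrow> f x \<noteq> 0"
  shows "Ck_on k S (\<lambda>x. inverse (f x))"
  by (rule Ck_on_compose[OF assms(1) _ Ck_on_real_inverse assms(2)])
    (use assms(3) in \<open>auto simp: open_Collect_neq continuous_intros\<close>)

lemma Ck_on_real_sqrt: "Ck_on k {0<..} sqrt"
proof (induction k)
  case (Suc k)
  have "Ck_on k {0<..} (\<lambda>x. (1/2) * inverse (sqrt x))"
    by (intro Ck_on_mult Ck_on_const Ck_on_inverse Suc) auto
  then show ?case
    by (rule Ck_on_real_SucI[rotated 2]) (auto intro!: derivative_eq_intros simp: field_simps)
qed (auto intro!: continuous_intros)

lemma Ck_on_arctan: "Ck_on k UNIV arctan"
proof (cases k)
  case (Suc n)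
  have "Ck_on n UNIV (\<lambda>x::real. inverse (1 + x \<bullet> 1 * (x \<bullet> 1)))"
    by (intro Ck_on_inverse Ck_on_add Ck_on_mult Ck_on_inner Ck_on_const)
       (auto simp: add_nonneg_eq_0_iff)
  then show ?thesis unfolding Suc
    by (rule Ck_on_real_SucI[rotated 2]) (auto intro!: derivative_eq_intros simp: power2_eq_square)
qed (auto intro!: continuous_intros)

lemma smooth_real_id: "smooth (\<lambda>x::real. x)"
  using Ck_on_inner[of _ UNIV "1::real"] by (simp add: smooth_def Ck_on_UNIV)

lemma smooth_const: "smooth (\<lambda>_. c)"
  using Ck_on_const[of _ UNIV c] by (auto simp: smooth_def Ck_on_UNIV)

lemma smooth_add: "smooth f \<Longrightarrow> smooth g \<Longrightarrow> smooth (\<lambda>x. f x + g x)"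
  using Ck_on_add[of UNIV _ f g] by (auto simp: smooth_def Ck_on_UNIV)

lemma smooth_mult: "smooth f \<Longrightarrow> smooth g \<Longrightarrow> smooth (\<lambda>x. f x * g x)"
  using Ck_on_mult[of UNIV _ f g] by (auto simp: smooth_def Ck_on_UNIV)

lemma smooth_diff: "smooth f \<Longrightarrow> smooth g \<Longrightarrow> smooth (\<lambda>x. f x - g x)"
  using smooth_add[of f "\<lambda>x. (-1) * g x"] smooth_mult[OF smooth_const[of "-1"], of g] by simp

lemma smooth_compose: "smooth (g :: real \<Rightarrow> real) \<Longrightarrow> smooth f \<Longrightarrow> smooth (\<lambda>x. g (f x))"
  using Ck_on_compose[of UNIV UNIV _ g f] by (auto simp: smooth_def Ck_on_UNIV)

lemma smooth_inverse: "smooth f \<Longrightarrow> (\<And>x. f x \<noteq> 0) \<Longrightarrow> smooth (\<lambda>x. inverse (f x))"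
  using Ck_on_inverse[of UNIV _ f] by (auto simp: smooth_def Ck_on_UNIV)

lemma smooth_inner: "smooth (\<lambda>x. x \<bullet> a)"
  using Ck_on_inner[of _ UNIV a] by (auto simp: smooth_def Ck_on_UNIV)

lemma smooth_differentiable: "smooth f \<Longrightarrow> f differentiable (at x)"
  unfolding smooth_def by (metis Ck.simps(2) UNIV_I)

lemma smooth_real_deriv:
  fixes f :: "real \<Rightarrow> real"
  assumes "smooth f"
  shows "(f has_real_derivative deriv f x) (at x)" "smooth (deriv f)"
proof -
  show *: "(f has_real_derivative deriv f x) (at x)" for x
    using smooth_differentiable[OF assms, of x] by (simp add: DERIV_deriv_iff_real_differentiable)
  have "partial_deriv 1 f = deriv f"
    using * by (auto simp: partial_deriv_real)
  with assms show "smooth (deriv f)"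
    by (metis Basis_real_def Ck.simps(2) insertI1 smooth_def)
qed

lemma smooth_continuous_on: "smooth f \<Longrightarrow> continuous_on A f"
  unfolding smooth_def by (metis Ck.simps(1) continuous_on_subset subset_UNIV)

lemma smooth_real_scale: "smooth (f::real \<Rightarrow> real) \<Longrightarrow> smooth (\<lambda>x. f (c * x + d))"
  by (rule smooth_compose[of f "\<lambda>x. c * x + d"], assumption)
    (intro smooth_add smooth_mult smooth_const smooth_real_id)

text \<open>
  This lets a test function be given by a formula valid only on an open set around its
  support.
\<close>

lemma smooth_extend_by_zero:
  assumes "open S" "closed K" "K \<subseteq> S" "smooth_on S p"
    and "\<And>x. x \<in> S \<Longrightarrow> f x = p x" "\<And>x. x \<notin> K \<Longrightarrow> f x = 0"
  shows "smooth f"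
proof -
  have "Ck k f" if "Ck_on k S f" "\<And>x. x \<notin> K \<Longrightarrow> f x = 0" for k f
    using that
  proof (induction k arbitrary: f)
    case 0
    have "continuous_on (- K) f"
      using 0 by (subst continuous_on_cong[OF refl, of _ f "\<lambda>_. 0"]) auto
    with 0 have "continuous_on (S \<union> - K) f"
      using assms by (intro continuous_on_open_Un) auto
    moreover have "S \<union> - K = UNIV" using assms by auto
    ultimately show ?case by simp
  next
    case (Suc k)
    have d0: "(f has_derivative (\<lambda>_. 0)) (at x)" if "x \<notin> K" for x
      using has_derivative_transform_within_open[of "\<lambda>_. 0" "\<lambda>_. 0" x UNIV "-K" f] assms(2) Suc.prems(2) that
      by (auto simp: open_Compl)
    have "f differentiable (at x)" for x
      using Suc.prems(1) d0[of x] assms(3) by (cases "x \<in> K") (auto simp: differentiable_def)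
    moreover have "Ck k (partial_deriv b f)" if "b \<in> Basis" for b
      using Suc.prems that by (intro Suc.IH) (auto simp: partial_deriv_eq[OF d0])
    ultimately show ?case by simp
  qed
  moreover have "Ck_on k S f" for k
    using Ck_on_cong[OF assms(1), of p f k] assms(4,5) by (auto simp: smooth_on_def)
  ultimately show ?thesis using assms(6) by (auto simp: smooth_def)
qed

text \<open>
  The standard smooth functions that are flat at \<open>0\<close>. The whole family is needed, since
  differentiation maps each member to a combination of two others.
\<close>

definition flat_exp :: "nat \<Rightarrow> real \<Rightarrow> real" where
  "flat_exp n x = (if x > 0 then exp (- inverse x) * inverse x ^ n else 0)"

lemma flat_exp_tendsto_0: "(flat_exp n \<longlongrightarrow> 0) (at 0)"
proof -
  have "((\<lambda>x. x ^ n / exp x) \<longlongrightarrow> (0::real)) at_top"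
    by (rule tendsto_power_div_exp_0)
  then have "((\<lambda>x. inverse x ^ n / exp (inverse x)) \<longlongrightarrow> (0::real)) (at_right 0)"
    by (rule filterlim_compose[OF _ filterlim_inverse_at_top_right])
  then have "(flat_exp n \<longlongrightarrow> 0) (at_right 0)"
    by (rule Lim_transform_eventually)
      (auto simp: flat_exp_def eventually_at_right_field exp_minus field_simps intro!: exI[of _ 1])
  moreover have "(flat_exp n \<longlongrightarrow> 0) (at_left 0)"
    by (rule Lim_transform_eventually[OF tendsto_const])
      (auto simp: flat_exp_def eventually_at_left_field intro!: exI[of _ "-1"])
  ultimately show ?thesis by (simp add: filterlim_split_at)
qed

lemma flat_exp_deriv:
  "(flat_exp n has_real_derivative flat_exp (n + 2) x - real n * flat_exp (n + 1) x) (at x)"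
proof -
  consider "x > 0" | "x < 0" | "x = 0" by linarith
  then show ?thesis
  proof cases
    case 1
    have pe: "inverse x * inverse x ^ (m - Suc 0) = inverse x ^ m \<or> m = 0" for m
      by (cases m) auto
    have "((\<lambda>x. exp (- inverse x) * inverse x ^ n) has_real_derivative
        exp (- inverse x) * inverse x ^ (n+2) - real n * (exp (- inverse x) * inverse x ^ (n + 1))) (at x)"
      using 1 pe[of "n - 1"] by (cases n) (auto intro!: derivative_eq_intros simp: algebra_simps power2_eq_square)
    then have "(flat_exp n has_real_derivative
        exp (- inverse x) * inverse x ^ (n+2) - real n * (exp (- inverse x) * inverse x ^ (n + 1))) (at x)"
      by (rule has_field_derivative_transform_within_open[where S="{0<..}"]) (use 1 in \<open>auto simp: flat_exp_def\<close>)
    then show ?thesis using 1 by (simp add: flat_exp_def)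
  next
    case 2
    have "((\<lambda>x. 0) has_real_derivative 0) (at x)" by simp
    then have "(flat_exp n has_real_derivative 0) (at x)"
      by (rule has_field_derivative_transform_within_open[where S="{..<0}"]) (use 2 in \<open>auto simp: flat_exp_def\<close>)
    then show ?thesis using 2 by (simp add: flat_exp_def)
  next
    case 3
    have "((\<lambda>x. (flat_exp n x - flat_exp n 0) / (x - 0)) \<longlongrightarrow> 0) (at 0)"
      by (rule Lim_transform_eventually[OF flat_exp_tendsto_0[of "n+1"]])
        (auto simp: flat_exp_def divide_inverse intro!: always_eventually)
    then have "(flat_exp n has_real_derivative 0) (at 0)"
      by (simp add: has_field_derivative_iff)
    then show ?thesis using 3 by (simp add: flat_exp_def)
  qed
qed

lemma smooth_flat_exp: "smooth (flat_exp n)"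
proof -
  have "Ck_on k UNIV (flat_exp n)" for k
  proof (induction k arbitrary: n)
    case 0
    then show ?case
      by (auto intro!: continuous_at_imp_continuous_on DERIV_isCont flat_exp_deriv)
  next
    case (Suc k)
    have "Ck_on k UNIV (\<lambda>x. flat_exp (n + 2) x + (- real n) * flat_exp (n + 1) x)"
      by (intro Ck_on_add Ck_on_mult Suc Ck_on_const) auto
    then show ?case
      by (rule Ck_on_real_SucI[rotated 2]) (use flat_exp_deriv[of n] in auto)
  qed
  then show ?thesis by (simp add: smooth_def Ck_on_UNIV)
qed

lemma smooth_bump_exists:
  fixes a b :: real
  assumes "a < b"
  obtains g where "smooth g" "\<And>x. x \<notin> {a..b} \<Longrightarrow> g x = 0" "\<And>x. g x \<ge> 0" "\<And>x. x \<in> {a<..<b} \<Longrightarrow> g x > 0"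
proof
  let ?g = "\<lambda>x. flat_exp 0 (1 * x + (- a)) * flat_exp 0 ((-1) * x + b)"
  show "smooth ?g" by (intro smooth_mult smooth_real_scale smooth_flat_exp)
qed (use assms in \<open>auto simp: flat_exp_def\<close>)

lemma smooth_step_exists:
  obtains s :: "real \<Rightarrow> real" where "smooth s" "\<And>x. x \<le> -1 \<Longrightarrow> s x = 0" "\<And>x. x \<ge> 1 \<Longrightarrow> s x = 1"
proof
  let ?d = "\<lambda>x. flat_exp 0 (1 * x + 1) + flat_exp 0 ((-1) * x + 1)"
  let ?s = "\<lambda>x. flat_exp 0 (1 * x + 1) * inverse (?d x)"
  have "?d x \<noteq> 0" for x
    by (auto simp: flat_exp_def add_pos_pos less_imp_neq[symmetric])
  then show "smooth ?s"
    by (intro smooth_mult smooth_inverse smooth_add smooth_real_scale smooth_flat_exp) auto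
qed (auto simp: flat_exp_def)

section \<open>Integration in polar coordinates\<close>

definition plane_of_pair :: "real \<times> real \<Rightarrow> real^2" where
  "plane_of_pair p = fst p *\<^sub>R axis 1 1 + snd p *\<^sub>R axis 2 1"

lemma plane_of_pair_nth [simp]: "plane_of_pair p $ 1 = fst p" "plane_of_pair p $ 2 = snd p"
  by (simp_all add: plane_of_pair_def axis_def)

lemma plane_of_pair_measurable [measurable]: "plane_of_pair \<in> borel_measurable borel"
  unfolding plane_of_pair_def by (intro borel_measurable_continuous_onI continuous_intros)

lemma Basis_plane: "(Basis :: (real^2) set) = {axis 1 1, axis 2 1}"
  by (auto simp: Basis_vec_def UNIV_2)

lemma lborel_plane: "distr lborel borel plane_of_pair = (lborel :: (real^2) measure)"
proof (rule lborel_eqI[symmetric])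
  fix l u :: "real^2"
  assume le: "\<And>b. b \<in> Basis \<Longrightarrow> l \<bullet> b \<le> u \<bullet> b"
  have le': "l $ 1 \<le> u $ 1" "l $ 2 \<le> u $ 2"
    using le[of "axis 1 1"] le[of "axis 2 1"] by (auto simp: Basis_plane inner_axis)
  have "plane_of_pair -` box l u = {l$1<..<u$1} \<times> {l$2<..<u$2}"
    by (auto simp: mem_box_cart forall_2)
  then have "emeasure (distr lborel borel plane_of_pair) (box l u)
      = emeasure (lborel \<Otimes>\<^sub>M lborel) ({l$1<..<u$1} \<times> {l$2<..<u$2})"
    by (subst emeasure_distr) (auto simp: lborel_prod)
  also have "\<dots> = ennreal ((u$1 - l$1) * (u$2 - l$2))"
    by (subst lborel.emeasure_pair_measure_Times) (use le' in \<open>auto simp: ennreal_mult\<close>)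
  also have "(u$1 - l$1) * (u$2 - l$2) = (\<Prod>b\<in>Basis. (u - l) \<bullet> b)"
    by (simp add: Basis_plane inner_axis axis_eq_axis)
  finally show "emeasure (distr lborel borel plane_of_pair) (box l u) = ennreal (\<Prod>b\<in>Basis. (u - l) \<bullet> b)" .
qed simp

text \<open>
  Angular factors such as \<open>\<psi>'\<close> are only Lebesgue measurable; replacing a factor by a Borel function
  changes the product on a cylinder over a null set.
\<close>

lemma negligible_plane_cylinder:
  fixes N :: "real set" and i :: 2
  assumes "N \<in> null_sets lborel"
  shows "negligible {x::real^2. x $ i \<in> N}"
proof -
  have N [measurable]: "N \<in> sets borel" using assms by auto
  have i: "i = 1 \<or> i = 2" using exhaust_2 by blast
  have set: "{x::real^2. x $ i \<in> N} \<in> sets borel"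
  proof -
    have "(\<lambda>x::real^2. x $ i) \<in> borel_measurable borel" 
      by (intro borel_measurable_continuous_onI continuous_intros)
    from measurable_sets[OF this N] show ?thesis by (simp add: vimage_def)
  qed
  have "emeasure (lborel \<Otimes>\<^sub>M lborel) (N \<times> UNIV) = 0" "emeasure (lborel \<Otimes>\<^sub>M lborel) (UNIV \<times> N) = 0"
    using assms by (auto simp: lborel.emeasure_pair_measure_Times)
  moreover have "plane_of_pair -` {x::real^2. x $ i \<in> N} = (if i = 1 then N \<times> UNIV else UNIV \<times> N)"
    using i by auto
  ultimately have "emeasure (distr lborel borel plane_of_pair) {x::real^2. x $ i \<in> N} = 0"
    by (subst emeasure_distr) (use set in \<open>auto simp: lborel_prod\<close>)
  with set show ?thesis
    by (auto simp: negligible_iff_null_sets null_sets_completionI null_sets_def lborel_plane)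
qed

lemma integral_product_plane:
  fixes a b :: "real \<Rightarrow> real"
  assumes "integrable lebesgue a" "integrable lebesgue b"
  shows "integrable lebesgue (\<lambda>x::real^2. a (x$1) * b (x$2))"
    and "(LINT x::real^2|lebesgue. a (x$1) * b (x$2)) = (LINT s|lebesgue. a s) * (LINT t|lebesgue. b t)"
proof -
  have borel_version: "\<exists>f0 N. f0 \<in> borel_measurable lborel \<and> N \<in> null_sets lborel \<and> (\<forall>x. x \<notin> N \<longrightarrow> f x = f0 x)
      \<and> integrable lborel f0 \<and> (LINT s|lborel. f0 s) = (LINT s|lebesgue. f s)"
    if "integrable lebesgue f" for f :: "real \<Rightarrow> real"
  proof -
    from completion_ex_borel_measurable_real[OF borel_measurable_integrable[OF that]]
    obtain f0 where f0: "f0 \<in> borel_measurable lborel" "AE x in lborel. f x = f0 x" by auto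
    from f0(2) obtain N where N: "\<And>x. x \<notin> N \<Longrightarrow> f x = f0 x" "N \<in> null_sets lborel"
      by (elim AE_E3) auto
    have ae: "AE x in lebesgue. f x = f0 x" using f0(2) by (rule AE_completion)
    have m: "f0 \<in> borel_measurable lebesgue" using f0(1) by (rule measurable_completion)
    have "integrable lebesgue f0"
      using integrable_cong_AE[OF borel_measurable_integrable[OF that] m ae] that by simp
    moreover have "(LINT s|lebesgue. f s) = (LINT s|lebesgue. f0 s)"
      by (rule integral_cong_AE[OF borel_measurable_integrable[OF that] m ae])
    ultimately show ?thesis
      using f0(1) N by (intro exI[of _ f0] exI[of _ N]) (auto simp: integrable_completion integral_completion)
  qed
  obtain a0 Na where a0: "a0 \<in> borel_measurable lborel" "Na \<in> null_sets lborel" "\<And>x. x \<notin> Na \<Longrightarrow> a x = a0 x"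
      "integrable lborel a0" "(LINT s|lborel. a0 s) = (LINT s|lebesgue. a s)"
    using borel_version[OF assms(1)] by blast
  obtain b0 Nb where b0: "b0 \<in> borel_measurable lborel" "Nb \<in> null_sets lborel" "\<And>x. x \<notin> Nb \<Longrightarrow> b x = b0 x"
      "integrable lborel b0" "(LINT s|lborel. b0 s) = (LINT s|lebesgue. b s)"
    using borel_version[OF assms(2)] by blast
  note [measurable] = a0(1) b0(1)
  let ?f = "\<lambda>x::real^2. a0 (x$1) * b0 (x$2)"
  have nth [measurable]: "(\<lambda>x::real^2. x $ i) \<in> borel_measurable borel" for i
    by (intro borel_measurable_continuous_onI continuous_intros)
  have fm [measurable]: "?f \<in> borel_measurable borel" by measurable
  have pair: "integrable (lborel \<Otimes>\<^sub>M lborel) (\<lambda>p. a0 (fst p) * b0 (snd p))"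
  proof (rule lborel_pair.Fubini_integrable)
    show "integrable lborel (\<lambda>x. LINT y|lborel. norm (a0 (fst (x, y)) * b0 (snd (x, y))))"
      using a0(4) by (auto simp: abs_mult)
  qed (use b0(4) in auto)
  have int: "integrable lborel ?f"
    using pair by (subst lborel_plane[symmetric]) (simp add: integrable_distr_eq lborel_prod)
  have val: "integral\<^sup>L lborel ?f = (LINT s|lebesgue. a s) * (LINT t|lebesgue. b t)"
  proof -
    have "integral\<^sup>L lborel ?f = integral\<^sup>L (lborel \<Otimes>\<^sub>M lborel) (\<lambda>p. a0 (fst p) * b0 (snd p))"
      by (subst lborel_plane[symmetric]) (simp add: integral_distr lborel_prod)
    also have "\<dots> = (LINT s|lborel. LINT t|lborel. a0 s * b0 t)"
      using lborel_pair.integral_fst'[OF pair] by simp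
    also have "\<dots> = (LINT s|lborel. a0 s) * (LINT t|lborel. b0 t)" by simp
    finally show ?thesis by (simp add: a0(5) b0(5))
  qed
  let ?N = "{x::real^2. x $ 1 \<in> Na} \<union> {x. x $ 2 \<in> Nb}"
  have neg: "negligible ?N"
    by (intro negligible_Un negligible_plane_cylinder a0(2) b0(2))
  have eq: "a (x$1) * b (x$2) = ?f x" if "x \<in> UNIV - ?N" for x
    using that a0(3) b0(3) by auto
  have int': "integrable lebesgue ?f"
    using int by (subst integrable_completion) (auto simp: measurable_lborel1)
  then have abs: "?f absolutely_integrable_on UNIV"
    by (simp add: set_integrable_def)
  have abs2: "(\<lambda>x::real^2. a (x$1) * b (x$2)) absolutely_integrable_on UNIV"
    by (rule absolutely_integrable_spike[OF abs neg eq])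
  then show int2: "integrable lebesgue (\<lambda>x::real^2. a (x$1) * b (x$2))"
    by (simp add: set_integrable_def)
  have "(LINT x::real^2|lebesgue. a (x$1) * b (x$2)) = integral UNIV (\<lambda>x::real^2. a (x$1) * b (x$2))"
    using set_lebesgue_integral_eq_integral(2)[OF abs2] by (simp add: set_lebesgue_integral_def)
  also have "\<dots> = integral UNIV ?f"
    by (rule integral_spike[OF neg]) (use eq in auto)
  also have "\<dots> = integral\<^sup>L lebesgue ?f"
    using set_lebesgue_integral_eq_integral(2)[OF abs] by (simp add: set_lebesgue_integral_def)
  also have "\<dots> = integral\<^sup>L lborel ?f"
    by (subst integral_completion) (auto simp: measurable_lborel1)
  finally show "(LINT x::real^2|lebesgue. a (x$1) * b (x$2)) = (LINT s|lebesgue. a s) * (LINT t|lebesgue. b t)"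
    using val by simp
qed

lemma e_r_nth [simp]: "e_r t $ 1 = cos t" "e_r t $ 2 = sin t"
  by (simp_all add: e_r_def)

lemma e_theta_nth [simp]: "e_theta t $ 1 = - sin t" "e_theta t $ 2 = cos t"
  by (simp_all add: e_theta_def)

lemma inner_plane: "(x::real^2) \<bullet> y = x$1 * y$1 + x$2 * y$2"
  by (simp add: inner_vec_def sum_2)

lemma e_r_add: "e_r (s + t) = cos t *\<^sub>R e_r s + sin t *\<^sub>R e_theta s"
  by (simp add: vec_eq_iff forall_2 cos_add sin_add algebra_simps)

lemma norm_e_r [simp]: "norm (e_r t) = 1"
  by (simp add: norm_eq_1 inner_plane power2_eq_square[symmetric])

lemma e_r_has_derivative: "(e_r has_vector_derivative e_theta t) (at t within S)"
proof -
  have "e_r = (\<lambda>t. cos t *\<^sub>R axis 1 1 + sin t *\<^sub>R axis 2 1)"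
    by (auto simp: fun_eq_iff vec_eq_iff forall_2 axis_def)
  moreover have "e_theta t = (- sin t) *\<^sub>R axis 1 1 + cos t *\<^sub>R axis 2 1"
    by (auto simp: vec_eq_iff forall_2 axis_def)
  moreover have "((\<lambda>t. cos t *\<^sub>R axis 1 1 + sin t *\<^sub>R axis 2 1 :: real^2) has_vector_derivative
      (- sin t) *\<^sub>R axis 1 1 + cos t *\<^sub>R axis 2 1) (at t within S)"
    unfolding has_vector_derivative_def
    by (auto intro!: derivative_eq_intros simp: algebra_simps)
  ultimately show ?thesis by (simp only:)
qed

lemma continuous_on_e_r: "continuous_on S e_r"
  by (rule continuous_on_vector_derivative[OF e_r_has_derivative])

lemma polar_coordinates:
  fixes x :: "real^2"
  obtains r t where "r \<ge> 0" "\<bar>t - t1\<bar> \<le> pi" "x = r *\<^sub>R e_r t"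
proof -
  have "\<exists>t r. r \<ge> 0 \<and> x = r *\<^sub>R e_r t"
  proof (cases "x = 0")
    case False
    have "(x$1)\<^sup>2 + (x$2)\<^sup>2 = (norm x)\<^sup>2"
      unfolding power2_norm_eq_inner by (simp add: inner_plane power2_eq_square)
    then have "(x$1 / norm x)\<^sup>2 + (x$2 / norm x)\<^sup>2 = 1"
      using False by (simp add: power_divide add_divide_distrib[symmetric])
    then obtain t where t: "x$1 / norm x = cos t" "x$2 / norm x = sin t"
      by (rule sincos_total_2pi)
    have "norm x * cos t = x$1" "norm x * sin t = x$2"
      using False by (simp_all add: t[symmetric])
    then have "x = norm x *\<^sub>R e_r t"
      by (simp add: vec_eq_iff forall_2)
    then show ?thesis using norm_ge_zero by blast
  next
    case True
    then show ?thesis by (intro exI[of _ 0]) simp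
  qed
  then obtain t r where t: "r \<ge> 0" "x = r *\<^sub>R e_r t" by blast
  obtain y where y: "- pi < y" "y \<le> pi" "sin y = sin (t - t1)" "cos y = cos (t - t1)"
    using sincos_principal_value by blast
  have "e_r (t1 + y) = e_r (t1 + (t - t1))"
    unfolding e_r_add by (simp add: y)
  then have "e_r (t1 + y) = e_r t" by simp
  with t y show ?thesis
    by (intro that[of r "t1 + y"]) auto
qed

definition polar_map :: "real^2 \<Rightarrow> real^2" where
  "polar_map x = (x$1) *\<^sub>R e_r (x$2)"

definition polar_window :: "real \<Rightarrow> (real^2) set" where
  "polar_window t1 = {x. 0 < x$1 \<and> \<bar>x$2 - t1\<bar> < pi}"

lemma polar_map_has_derivative:
  "(polar_map has_derivative (\<lambda>h. (h$1) *\<^sub>R e_r (x$2) + (x$1 * h$2) *\<^sub>R e_theta (x$2))) (at x within S)"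
proof -
  have "((\<lambda>x. e_r (x$2)) has_derivative (\<lambda>h. (h$2) *\<^sub>R e_theta (x$2))) (at x within S)"
    using has_derivative_in_compose[of "\<lambda>x. x$2" "\<lambda>h. h$2" x S e_r "\<lambda>h. h *\<^sub>R e_theta (x$2)"]
      e_r_has_derivative[of "x$2"] bounded_linear_imp_has_derivative[OF bounded_linear_vec_nth]
    by (auto simp: has_vector_derivative_def)
  then show ?thesis
    unfolding polar_map_def
    by (auto intro!: derivative_eq_intros bounded_linear_imp_has_derivative[OF bounded_linear_vec_nth])
qed

lemma inj_on_polar_map: "inj_on polar_map (polar_window t1)"
proof (rule inj_onI)
  fix x y assume xy: "x \<in> polar_window t1" "y \<in> polar_window t1" "polar_map x = polar_map y"
  then have "norm (polar_map x) = norm (polar_map y)" by simp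
  with xy(1,2) have r: "x$1 = y$1" by (simp add: polar_map_def polar_window_def)
  with xy have "e_r (x$2) = e_r (y$2)"
    by (simp add: polar_map_def polar_window_def)
  then have "sin (x$2) = sin (y$2) \<and> cos (x$2) = cos (y$2)"
    by (metis e_r_nth)
  then obtain n :: int where n: "x$2 = y$2 + 2 * pi * n"
    using sin_cos_eq_iff by blast
  have "\<bar>2 * pi * n\<bar> < 2 * pi"
    using xy(1,2) n by (auto simp: polar_window_def)
  then have "\<bar>of_int n :: real\<bar> < 1" by (simp add: abs_mult)
  then have "n = 0" by linarith
  with n r show "x = y" by (simp add: vec_eq_iff forall_2)
qed

lemma negligible_outside_polar_window: "negligible (UNIV - polar_map ` polar_window t1)"
proof (rule negligible_subset)
  show "negligible {x. e_theta t1 \<bullet> x = 0}"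
    by (rule negligible_hyperplane) (metis e_theta_nth sin_zero_abs_cos_one abs_0 minus_zero zero_index zero_neq_one neg_equal_0_iff_equal)
  show "UNIV - polar_map ` polar_window t1 \<subseteq> {x. e_theta t1 \<bullet> x = 0}"
  proof (clarify, rule ccontr)
    fix x assume x: "x \<notin> polar_map ` polar_window t1" "e_theta t1 \<bullet> x \<noteq> 0"
    obtain r t where rt: "r \<ge> 0" "\<bar>t - t1\<bar> \<le> pi" "x = r *\<^sub>R e_r t"
      by (rule polar_coordinates)
    have *: "e_theta t1 \<bullet> x = r * sin (t - t1)"
      by (simp add: rt(3) inner_plane sin_diff algebra_simps)
    have "\<bar>t - t1\<bar> \<noteq> pi"
      using x(2) unfolding * by (auto simp: abs_if split: if_splits) (metis minus_diff_eq neg_0_equal_iff_equal sin_minus sin_pi)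
    moreover have "r \<noteq> 0" using x(2) * by auto
    ultimately have "plane_of_pair (r, t) \<in> polar_window t1" "x = polar_map (plane_of_pair (r, t))"
      using rt by (auto simp: polar_window_def polar_map_def)
    with x(1) show False by blast
  qed
qed

text \<open>
  The window is centred at the angle of interest \<open>t1\<close>, so that functions supported near that
  angle never meet the cut.
\<close>

lemma polar_integral:
  fixes F :: "real^2 \<Rightarrow> real"
  assumes G: "integrable lebesgue G"
    and supp: "\<And>x. x \<notin> polar_window t1 \<Longrightarrow> G x = 0"
    and eq: "\<And>x. x \<in> polar_window t1 \<Longrightarrow> x$1 * F (polar_map x) = G x"
  shows "integrable lebesgue F" "integral\<^sup>L lebesgue F = integral\<^sup>L lebesgue G"
proof -
  let ?S = "polar_window t1"
  let ?D = "\<lambda>x h::real^2. (h$1) *\<^sub>R e_r (x$2) + (x$1 * h$2) *\<^sub>R e_theta (x$2)"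
  let ?F = "\<lambda>x. vec (F x) :: real^1"
  have "open ?S"
    unfolding polar_window_def
    by (intro open_Collect_conj open_Collect_less continuous_intros)
  then have S: "?S \<in> sets lebesgue" by auto
  have det: "\<bar>det (matrix (?D x))\<bar> = x$1" if "x \<in> ?S" for x
  proof -
    have "det (matrix (?D x)) = x$1 * cos (x$2) * cos (x$2) + x$1 * sin (x$2) * sin (x$2)"
      by (simp add: det_2 matrix_def axis_def)
    also have "\<dots> = x$1 * ((sin (x$2))\<^sup>2 + (cos (x$2))\<^sup>2)"
      by (simp only: power2_eq_square algebra_simps)
    finally show ?thesis using that by (simp add: polar_window_def)
  qed
  have GS: "G absolutely_integrable_on ?S"
  proof -
    have "(\<lambda>x. indicator ?S x *\<^sub>R G x) = G"
      using supp by (auto simp: indicator_def fun_eq_iff)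
    then show ?thesis using G by (simp add: set_integrable_def)
  qed
  have Geq: "integral ?S G = integral\<^sup>L lebesgue G"
  proof -
    have "(\<lambda>x. indicator ?S x *\<^sub>R G x) = G"
      using supp by (auto simp: indicator_def fun_eq_iff)
    then show ?thesis
      using set_lebesgue_integral_eq_integral(2)[OF GS] by (simp add: set_lebesgue_integral_def)
  qed
  have vec_eq: "\<bar>det (matrix (?D x))\<bar> *\<^sub>R ?F (polar_map x) = vec (G x)" if "x \<in> ?S" for x
    using that eq[OF that] by (simp add: det vec_eq_iff)
  have bl: "bounded_linear (vec :: real \<Rightarrow> real^1)"
    by (rule linear_conv_bounded_linear[THEN iffD1], unfold_locales) (auto simp: vec_eq_iff)
  have vG: "(\<lambda>x. vec (G x) :: real^1) absolutely_integrable_on ?S"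
    using absolutely_integrable_linear[OF GS bl] by (simp add: o_def)
  have vGi: "integral ?S (\<lambda>x. vec (G x) :: real^1) = vec (integral ?S G)"
    using integral_linear[OF _ bl, of G ?S] set_lebesgue_integral_eq_integral(1)[OF GS] by (simp add: o_def)
  have "(\<lambda>x. \<bar>det (matrix (?D x))\<bar> *\<^sub>R ?F (polar_map x)) absolutely_integrable_on ?S \<and>
        integral ?S (\<lambda>x. \<bar>det (matrix (?D x))\<bar> *\<^sub>R ?F (polar_map x)) = vec (integral ?S G)"
  proof
    show "(\<lambda>x. \<bar>det (matrix (?D x))\<bar> *\<^sub>R ?F (polar_map x)) absolutely_integrable_on ?S"
      using vG by (rule absolutely_integrable_spike[OF _ negligible_empty]) (use vec_eq in auto)
    show "integral ?S (\<lambda>x. \<bar>det (matrix (?D x))\<bar> *\<^sub>R ?F (polar_map x)) = vec (integral ?S G)"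
      unfolding vGi[symmetric] by (rule integral_cong) (use vec_eq in auto)
  qed
  then have F: "?F absolutely_integrable_on (polar_map ` ?S)" "integral (polar_map ` ?S) ?F = vec (integral ?S G)"
    using has_absolute_integral_change_of_variables[OF S polar_map_has_derivative inj_on_polar_map, of ?F "vec (integral ?S G)"]
    by auto
  have bl1: "bounded_linear (\<lambda>y::real^1. y $ 1)" by (rule bounded_linear_vec_nth)
  have F1: "F absolutely_integrable_on (polar_map ` ?S)"
    using absolutely_integrable_linear[OF F(1) bl1] by (simp add: o_def)
  have F2: "integral (polar_map ` ?S) F = integral ?S G"
    using integral_linear[OF set_lebesgue_integral_eq_integral(1)[OF F(1)] bl1] F(2) by (simp add: o_def)
  have neg: "negligible {x \<in> UNIV - polar_map ` ?S. F x \<noteq> 0}" "negligible {x \<in> polar_map ` ?S - UNIV. F x \<noteq> 0}"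
    by (rule negligible_subset[OF negligible_outside_polar_window[of t1]], auto)
  have abs: "F absolutely_integrable_on UNIV"
    using absolutely_integrable_spike_set[OF F1 neg(2,1)] .
  then show "integrable lebesgue F" by (simp add: set_integrable_def)
  have "integral UNIV F = integral (polar_map ` ?S) F"
    by (rule integral_spike_set) (use neg in auto)
  then show "integral\<^sup>L lebesgue F = integral\<^sup>L lebesgue G"
    using set_lebesgue_integral_eq_integral(2)[OF abs] F2 Geq by (simp add: set_lebesgue_integral_def)
qed

lemma polar_integral_separable:
  fixes F :: "real^2 \<Rightarrow> real"
  assumes int: "\<And>a b. (a, b) \<in> set ps \<Longrightarrow> integrable lebesgue a \<and> integrable lebesgue b"
    and supp: "\<And>a b r. (a, b) \<in> set ps \<Longrightarrow> r \<le> 0 \<Longrightarrow> a r = 0"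
      "\<And>a b t. (a, b) \<in> set ps \<Longrightarrow> pi \<le> \<bar>t - t1\<bar> \<Longrightarrow> b t = 0"
    and eq: "\<And>r t. 0 < r \<Longrightarrow> \<bar>t - t1\<bar> < pi \<Longrightarrow> r * F (r *\<^sub>R e_r t) = (\<Sum>(a, b)\<leftarrow>ps. a r * b t)"
  shows "integrable lebesgue F"
    and "integral\<^sup>L lebesgue F = (\<Sum>(a, b)\<leftarrow>ps. (LINT r|lebesgue. a r) * (LINT t|lebesgue. b t))"
proof -
  define G where "G ps x = (\<Sum>(a, b)\<leftarrow>ps. a (x$1) * b (x$2))"
    for ps :: "((real \<Rightarrow> real) \<times> (real \<Rightarrow> real)) list" and x :: "real^2"
  have *: "integrable lebesgue (G ps) \<and>
      integral\<^sup>L lebesgue (G ps) = (\<Sum>(a, b)\<leftarrow>ps. (LINT r|lebesgue. a r) * (LINT t|lebesgue. b t))"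
    if "\<And>a b. (a, b) \<in> set ps \<Longrightarrow> integrable lebesgue a \<and> integrable lebesgue b" for ps
    using that
  proof (induction ps)
    case Nil
    then show ?case by (simp add: G_def)
  next
    case (Cons p ps)
    obtain a b where p: "p = (a, b)" by fastforce
    have ab: "integrable lebesgue a" "integrable lebesgue b" using Cons.prems[of a b] p by auto
    have "G (p # ps) = (\<lambda>x. a (x$1) * b (x$2) + G ps x)"
      by (simp add: G_def p fun_eq_iff)
    moreover have "integrable lebesgue (G ps) \<and>
      integral\<^sup>L lebesgue (G ps) = (\<Sum>(a, b)\<leftarrow>ps. (LINT r|lebesgue. a r) * (LINT t|lebesgue. b t))"
      using Cons.prems by (intro Cons.IH) auto
    ultimately show ?case using integral_product_plane[OF ab]
      by (simp add: p)
  qed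
  have "G ps x = 0" if "x \<notin> polar_window t1" for x
  proof -
    have "\<forall>p\<in>set ps. (case p of (a, b) \<Rightarrow> a (x$1) * b (x$2)) = 0"
    proof (clarify)
      fix a b assume ab: "(a, b) \<in> set ps"
      show "a (x$1) * b (x$2) = 0"
        using supp(1)[OF ab, of "x$1"] supp(2)[OF ab, of "x$2"] that
        by (cases "x$1 \<le> 0") (auto simp: polar_window_def)
    qed
    then show ?thesis unfolding G_def by (induction ps) auto
  qed
  moreover have "x$1 * F (polar_map x) = G ps x" if "x \<in> polar_window t1" for x
    using eq[of "x$1" "x$2"] that by (simp add: polar_map_def polar_window_def G_def)
  ultimately show "integrable lebesgue F"
    "integral\<^sup>L lebesgue F = (\<Sum>(a, b)\<leftarrow>ps. (LINT r|lebesgue. a r) * (LINT t|lebesgue. b t))"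
    using polar_integral[of "G ps" t1 F] *[OF int] by auto
qed

section \<open>Continuous functions with bounded weak second derivative\<close>

lemma integrable_continuous_compact_support:
  fixes f :: "real \<Rightarrow> real"
  assumes "continuous_on UNIV f" "\<And>t. t \<notin> {a..b} \<Longrightarrow> f t = 0"
  shows "integrable lborel f" "integrable lebesgue f" "(LINT t|lebesgue. f t) = (LINT t|lborel. f t)"
proof -
  have m: "f \<in> borel_measurable lborel"
    using borel_measurable_continuous_onI[OF assms(1)] by simp
  have "integrable lborel (\<lambda>x. indicator {a..b} x *\<^sub>R f x)"
    by (rule borel_integrable_compact) (auto intro: continuous_on_subset[OF assms(1)])
  moreover have "(\<lambda>x. indicator {a..b} x *\<^sub>R f x) = f"
    using assms(2) by (auto simp: indicator_def fun_eq_iff)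
  ultimately show "integrable lborel f" by simp
  then show "integrable lebesgue f" using m by (simp add: integrable_completion)
  show "(LINT t|lebesgue. f t) = (LINT t|lborel. f t)" using m by (simp add: integral_completion)
qed

lemma integral_derivative:
  fixes u :: "real \<Rightarrow> real"
  assumes "a \<le> b" "\<And>t. (u has_real_derivative u' t) (at t)" "continuous_on UNIV u'" 
    "\<And>t. t \<notin> {a..b} \<Longrightarrow> u' t = 0"
  shows "(LINT t|lebesgue. u' t) = u b - u a"
proof -
  note int = integrable_continuous_compact_support[OF assms(3,4)]
  have "(u' has_integral (u b - u a)) {a..b}"
    using assms(1) by (rule fundamental_theorem_of_calculus)
      (auto intro!: has_field_derivative_at_within[OF assms(2)]
        simp: has_real_derivative_iff_has_vector_derivative[symmetric])
  then have "(u' has_integral (u b - u a)) UNIV"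
    by (rule has_integral_on_superset) (use assms(4) in auto)
  with has_integral_integral_lborel[OF int(1)] int(3) show ?thesis
    by (metis has_integral_unique)
qed

text \<open>
  The source of the integrations by parts below, where \<open>u\<close> is a product with a compactly supported
  factor.
\<close>

lemma integral_derivative_compact_support:
  fixes u :: "real \<Rightarrow> real"
  assumes der: "\<And>t. (u has_real_derivative u' t) (at t)" and cont: "continuous_on UNIV u'"
    and supp: "\<And>t. t \<notin> {a..b} \<Longrightarrow> u t = 0"
  shows "\<And>t. t \<notin> {a..b} \<Longrightarrow> u' t = 0" "(LINT t|lebesgue. u' t) = 0"
proof -
  show *: "u' t = 0" if "t \<notin> {a..b}" for t
  proof -
    have "((\<lambda>_. 0) has_real_derivative 0) (at t)" by simp
    then have "(u has_real_derivative 0) (at t)"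
      by (rule has_field_derivative_transform_within_open[where S="- {a..b}"]) (use that supp in auto)
    with der show ?thesis by (metis DERIV_unique)
  qed
  have "(LINT t|lebesgue. u' t) = u (max a b + 1) - u (min a b - 1)"
    by (rule integral_derivative[OF _ der cont]) (auto intro!: *)
  also have "\<dots> = 0"
    using supp[of "max a b + 1"] supp[of "min a b - 1"] by (auto simp: max_def min_def)
  finally show "(LINT t|lebesgue. u' t) = 0" .
qed

lemma smooth_deriv_zero_outside:
  fixes h :: "real \<Rightarrow> real"
  assumes "smooth h" "\<And>t. t \<notin> {a..b} \<Longrightarrow> h t = 0" "t \<notin> {a..b}"
  shows "deriv h t = 0"
  by (rule integral_derivative_compact_support(1)[of h, OF _ _ assms(2,3)])
    (use smooth_real_deriv[OF assms(1)] smooth_continuous_on in auto)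

text \<open>
  No sign condition is imposed on the kernel, because it will be the second derivative of an
  explicit smooth function, which changes sign. Rescaling moves the small parameter into the
  argument of \<open>f\<close>, where dominated convergence applies.
\<close>

lemma approximate_identity:
  fixes f B :: "real \<Rightarrow> real"
  assumes f: "continuous_on UNIV f" and B: "continuous_on UNIV B" "\<And>t. t \<notin> {-1..1} \<Longrightarrow> B t = 0"
    and B1: "(LINT t|lebesgue. B t) = 1"
    and e: "e \<longlonglongrightarrow> 0" "\<And>n. 0 < e n" "\<And>n. e n \<le> 1"
  shows "(\<lambda>n. LINT t|lebesgue. f t * (B ((t - p) / e n) / e n)) \<longlonglongrightarrow> f p"
proof -
  have cf: "continuous_on S (\<lambda>x. f (g x))" if "continuous_on S g" for S g
    using continuous_on_compose2[OF f that] by auto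
  have cB: "continuous_on S (\<lambda>x. B (g x))" if "continuous_on S g" for S g
    using continuous_on_compose2[OF B(1) that] by auto
  have eq: "(LINT t|lebesgue. f t * (B ((t - p) / e n) / e n)) = (LINT s|lborel. f (p + e n * s) * B s)" for n
  proof -
    let ?g = "\<lambda>t. f t * (B ((t - p) / e n) / e n)"
    have en: "e n > 0" by (rule e)
    have "continuous_on UNIV ?g"
      using e(2)[of n] by (intro continuous_intros cf cB) auto
    moreover have "?g t = 0" if "t \<notin> {p - e n..p + e n}" for t
      using that en B(2)[of "(t - p) / e n"] by (auto simp: field_simps)
    ultimately have "(LINT t|lebesgue. ?g t) = (LINT t|lborel. ?g t)"
      by (rule integrable_continuous_compact_support(3))
    also have "\<dots> = \<bar>e n\<bar> *\<^sub>R (LINT s|lborel. ?g (p + e n * s))"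
      using en by (intro lborel_integral_real_affine) auto
    also have "\<dots> = (LINT s|lborel. e n * ?g (p + e n * s))"
      using en by simp
    also have "\<dots> = (LINT s|lborel. f (p + e n * s) * B s)"
      using en by (intro Bochner_Integration.integral_cong) auto
    finally show ?thesis .
  qed
  have "compact (f ` {p - 1..p + 1})"
    by (intro compact_continuous_image continuous_on_subset[OF f]) auto
  then obtain M where M: "\<And>t. t \<in> {p - 1..p + 1} \<Longrightarrow> \<bar>f t\<bar> \<le> M"
    using compact_imp_bounded[THEN bounded_iff[THEN iffD1]] by (metis image_eqI real_norm_def)
  have "(\<lambda>n. LINT s|lborel. f (p + e n * s) * B s) \<longlonglongrightarrow> (LINT s|lborel. f p * B s)"
  proof (rule integral_dominated_convergence[where w="\<lambda>s. M * \<bar>B s\<bar>"])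
    have "B \<in> borel_measurable borel" by (rule borel_measurable_continuous_onI[OF B(1)])
    then show "(\<lambda>s. f p * B s) \<in> borel_measurable lborel" by simp
    show "(\<lambda>s. f (p + e n * s) * B s) \<in> borel_measurable lborel" for n
      by (simp, intro borel_measurable_continuous_onI continuous_intros cf cB)
    show "integrable lborel (\<lambda>s. M * \<bar>B s\<bar>)"
      by (intro integrable_mult_right integrable_abs integrable_continuous_compact_support(1)[OF B])
    show "AE s in lborel. (\<lambda>n. f (p + e n * s) * B s) \<longlonglongrightarrow> f p * B s"
    proof (rule AE_I2)
      fix s
      have "(\<lambda>n. p + e n * s) \<longlonglongrightarrow> p + 0 * s" by (intro tendsto_intros e(1))
      then have "(\<lambda>n. f (p + e n * s)) \<longlonglongrightarrow> f p"
        using f by (intro isCont_tendsto_compose[of p f]) (auto simp: continuous_on_eq_continuous_at)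
      then show "(\<lambda>n. f (p + e n * s) * B s) \<longlonglongrightarrow> f p * B s" by (intro tendsto_intros)
    qed
    show "AE s in lborel. norm (f (p + e n * s) * B s) \<le> M * \<bar>B s\<bar>" for n
    proof (rule AE_I2)
      fix s
      show "norm (f (p + e n * s) * B s) \<le> M * \<bar>B s\<bar>"
      proof (cases "s \<in> {-1..1}")
        case True
        then have "\<bar>e n * s\<bar> \<le> 1 * 1"
          unfolding abs_mult using e(2,3)[of n] by (intro mult_mono) auto
        then have "p + e n * s \<in> {p - 1..p + 1}" by auto
        then show ?thesis using M by (auto simp: abs_mult intro!: mult_right_mono)
      qed (use B(2) in auto)
    qed
  qed
  moreover have "(LINT s|lborel. f p * B s) = f p"
    using B1 integrable_continuous_compact_support(3)[OF B] by simp
  ultimately show ?thesis unfolding eq by (simp only:)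
qed

text \<open>
  A smooth replacement for the positive part \<open>max 0 t\<close>, obtained as \<open>t\<close> times a smooth step. Its
  second derivative integrates to \<open>1\<close> and vanishes outside \<open>[-1, 1]\<close>.
\<close>

lemma smooth_corner_exists:
  obtains \<Phi> L where "smooth \<Phi>" "\<And>t::real. t \<le> -1 \<Longrightarrow> \<Phi> t = 0" "\<And>t. t \<ge> 1 \<Longrightarrow> \<Phi> t = t"
    "0 \<le> L" "\<And>s t. \<bar>\<Phi> s - \<Phi> t\<bar> \<le> L * \<bar>s - t\<bar>"
proof -
  obtain s :: "real \<Rightarrow> real" where s: "smooth s" "\<And>x. x \<le> -1 \<Longrightarrow> s x = 0" "\<And>x. x \<ge> 1 \<Longrightarrow> s x = 1"
    using smooth_step_exists by blast
  define \<Phi> where "\<Phi> t = t * s t" for t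
  have sm: "smooth \<Phi>" unfolding \<Phi>_def by (intro smooth_mult smooth_real_id s)
  have "compact (deriv \<Phi> ` {-1..1})"
    using sm by (intro compact_continuous_image smooth_continuous_on smooth_real_deriv) auto
  then obtain L where L: "\<And>t. t \<in> {-1..1} \<Longrightarrow> \<bar>deriv \<Phi> t\<bar> \<le> L"
    using compact_imp_bounded[THEN bounded_iff[THEN iffD1]] by (metis image_eqI real_norm_def)
  have "\<bar>deriv \<Phi> t\<bar> \<le> max 1 L" for t
  proof -
    consider "t \<in> {-1..1}" | "t < -1" | "t > 1" by force
    then show ?thesis
    proof cases
      case 1
      then show ?thesis using L[of t] by auto
    next
      case 2
      have "((\<lambda>_. 0) has_real_derivative 0) (at t)" by simp
      then have "(\<Phi> has_real_derivative 0) (at t)"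
        by (rule has_field_derivative_transform_within_open[where S="{..<-1}"]) (use 2 s in \<open>auto simp: \<Phi>_def\<close>)
      then show ?thesis by (simp add: DERIV_imp_deriv)
    next
      case 3
      have "((\<lambda>t. t) has_real_derivative 1) (at t)" by simp
      then have "(\<Phi> has_real_derivative 1) (at t)"
        by (rule has_field_derivative_transform_within_open[where S="{1<..}"]) (use 3 s in \<open>auto simp: \<Phi>_def\<close>)
      then show ?thesis by (simp add: DERIV_imp_deriv)
    qed
  qed
  then have "norm (\<Phi> x - \<Phi> y) \<le> max 1 L * norm (x - y)" for x y
    by (intro field_differentiable_bound[of UNIV \<Phi> "deriv \<Phi>"])
      (auto intro: smooth_real_deriv[OF sm])
  then show ?thesis
    by (intro that[OF sm, of "max 1 L"]) (use s in \<open>auto simp: \<Phi>_def\<close>)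
qed

text \<open>
  If \<open>\<Phi>\<close> were the positive part, then \<open>\<Phi>'' = \<delta>\<close>, and
  \<open>h = (z - y) \<Phi>(t - x) - (z - x) \<Phi>(t - y) + (y - x) \<Phi>(t - z)\<close> would be a tent function on
  \<open>[x, z]\<close> for which \<open>\<integral> f h''\<close> is exactly the second difference of \<open>f\<close>. The proof uses rescaled
  smooth corners for \<open>\<Phi>\<close> and passes to the limit. The coefficients of \<open>h\<close> are those for which the
  affine parts cancel to the right of \<open>z\<close>, and the Lipschitz bound of the corner controls \<open>\<integral> |h|\<close> by
  a multiple of the product of the three distances.
\<close>

lemma weak_second_derivative_bounds_second_difference:
  fixes f :: "real \<Rightarrow> real"
  assumes f: "continuous_on UNIV f" and C: "0 \<le> C"
    and weak: "\<And>h. smooth h \<Longrightarrow> (\<And>t. t \<notin> {a..b} \<Longrightarrow> h t = 0) \<Longrightarrow>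
        \<bar>LINT t|lebesgue. f t * deriv (deriv h) t\<bar> \<le> C * (LINT t|lebesgue. \<bar>h t\<bar>)"
  obtains K where "0 \<le> K"
    "\<And>x y z. a < x \<Longrightarrow> x < y \<Longrightarrow> y < z \<Longrightarrow> z < b \<Longrightarrow>
       \<bar>(z - y) * f x - (z - x) * f y + (y - x) * f z\<bar> \<le> K * C * ((z - y) * (y - x) * (z - x))"
proof -
  obtain \<Phi> L where \<Phi>: "smooth \<Phi>" "\<And>t::real. t \<le> -1 \<Longrightarrow> \<Phi> t = 0" "\<And>t. t \<ge> 1 \<Longrightarrow> \<Phi> t = t"
    and L: "0 \<le> L" "\<And>s t. \<bar>\<Phi> s - \<Phi> t\<bar> \<le> L * \<bar>s - t\<bar>"
    using smooth_corner_exists by blast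
  define B where "B = deriv (deriv \<Phi>)"
  note d1 = smooth_real_deriv[OF \<Phi>(1)]
  note d2 = smooth_real_deriv[OF d1(2), folded B_def]
  have \<Phi>0: "deriv \<Phi> t = 0" if "t < -1" for t
  proof -
    have "((\<lambda>_. 0) has_real_derivative 0) (at t)" by simp
    then have "(\<Phi> has_real_derivative 0) (at t)"
      by (rule has_field_derivative_transform_within_open[where S="{..<-1}"]) (use that \<Phi> in auto)
    then show ?thesis by (simp add: DERIV_imp_deriv)
  qed
  have \<Phi>1: "deriv \<Phi> t = 1" if "t > 1" for t
  proof -
    have "((\<lambda>t. t) has_real_derivative 1) (at t)" by simp
    then have "(\<Phi> has_real_derivative 1) (at t)"
      by (rule has_field_derivative_transform_within_open[where S="{1<..}"]) (use that \<Phi> in auto)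
    then show ?thesis by (simp add: DERIV_imp_deriv)
  qed
  have Bc: "continuous_on UNIV B" by (rule smooth_continuous_on[OF d2(2)])
  have Bs: "B t = 0" if "t \<notin> {-1..1}" for t
  proof (cases "t < -1")
    case True
    have "((\<lambda>_. 0) has_real_derivative 0) (at t)" by simp
    then have "(deriv \<Phi> has_real_derivative 0) (at t)"
      by (rule has_field_derivative_transform_within_open[where S="{..<-1}"]) (use True \<Phi>0 in auto)
    then show ?thesis by (simp add: DERIV_imp_deriv B_def)
  next
    case False
    have "((\<lambda>_. 1) has_real_derivative 0) (at t)" by simp
    then have "(deriv \<Phi> has_real_derivative 0) (at t)"
      by (rule has_field_derivative_transform_within_open[where S="{1<..}"]) (use False that \<Phi>1 in auto)
    then show ?thesis by (simp add: DERIV_imp_deriv B_def)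
  qed
  have B1: "(LINT t|lebesgue. B t) = 1"
  proof -
    have "(LINT t|lebesgue. B t) = deriv \<Phi> 2 - deriv \<Phi> (-2)"
      by (rule integral_derivative[OF _ d2(1) Bc]) (use Bs in auto)
    then show ?thesis by (simp add: \<Phi>0 \<Phi>1)
  qed
  have main: "\<bar>(z - y) * f x - (z - x) * f y + (y - x) * f z\<bar> \<le> 2 * L * C * ((z - y) * (y - x) * (z - x))"
    if xyz: "a < x" "x < y" "y < z" "z < b" for x y z
  proof -
    \<comment> \<open>corner widths \<open>e n \<le> e0\<close> keep the support \<open>[x - e n, z + e n]\<close> of the test function inside \<open>[a, b]\<close>\<close>
    define e0 where "e0 = min 1 (min (x - a) (b - z))"
    have e0: "0 < e0" "e0 \<le> 1" "e0 \<le> x - a" "e0 \<le> b - z" using xyz by (auto simp: e0_def)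
    define e where "e n = e0 / real (Suc n)" for n
    have e: "0 < e n" "e n \<le> e0" for n
      using e0 by (auto simp: e_def field_simps)
    have elim: "e \<longlonglongrightarrow> 0"
      unfolding e_def using tendsto_mult_right_zero[OF lim_inverse_n', of e0]
      by (intro LIMSEQ_Suc[of "\<lambda>n. e0 / real n"]) (simp add: divide_inverse)
    define I where "I n p = (LINT t|lebesgue. f t * (B ((t - p) / e n) / e n))" for n p
    have le: "\<bar>(z - y) * I n x - (z - x) * I n y + (y - x) * I n z\<bar>
        \<le> 2 * L * C * ((z - y) * (y - x) * (z - x + 2 * e n))" for n
    proof -
      define P where "P p t = e n * \<Phi> ((t - p) / e n)" for p t
      define P1 where "P1 p t = deriv \<Phi> ((t - p) / e n)" for p t
      define P2 where "P2 p t = B ((t - p) / e n) / e n" for p t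
      have en: "e n \<noteq> 0" using e[of n] by auto
      have dP: "(P p has_real_derivative P1 p t) (at t)" for p t
        unfolding P_def P1_def
        by (rule derivative_eq_intros DERIV_chain2[OF d1(1)] refl | simp add: en)+
      have dP1: "(P1 p has_real_derivative P2 p t) (at t)" for p t
      proof -
        have "((\<lambda>t. (t - p) / e n) has_real_derivative 1 / e n) (at t)"
          by (auto intro!: derivative_eq_intros simp: en)
        from DERIV_chain2[OF d2(1) this] show ?thesis by (simp add: P1_def[abs_def] P2_def)
      qed
      define h where "h t = (z - y) * P x t - (z - x) * P y t + (y - x) * P z t" for t
      have sP: "smooth (P p)" for p
      proof -
        have "smooth (\<lambda>t. e n * \<Phi> ((1 / e n) * t + (- p / e n)))"
          by (intro smooth_mult smooth_const smooth_real_scale \<Phi>)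
        moreover have "(1 / e n) * t + (- p / e n) = (t - p) / e n" for t
          by (simp add: diff_divide_distrib)
        ultimately show ?thesis by (simp add: P_def[abs_def])
      qed
      have sh: "smooth h"
        unfolding h_def by (intro smooth_add smooth_diff smooth_mult smooth_const sP)
      have "(h has_real_derivative (z - y) * P1 x t - (z - x) * P1 y t + (y - x) * P1 z t) (at t)" for t
        unfolding h_def by (auto intro!: derivative_eq_intros dP)
      then have h1: "deriv h = (\<lambda>t. (z - y) * P1 x t - (z - x) * P1 y t + (y - x) * P1 z t)"
        by (auto intro!: ext DERIV_imp_deriv)
      have "(deriv h has_real_derivative (z - y) * P2 x t - (z - x) * P2 y t + (y - x) * P2 z t) (at t)" for t
        unfolding h1 by (auto intro!: derivative_eq_intros dP1)
      then have h2: "deriv (deriv h) = (\<lambda>t. (z - y) * P2 x t - (z - x) * P2 y t + (y - x) * P2 z t)"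
        by (auto intro!: ext DERIV_imp_deriv)
      have P0: "P p t = 0" if "t - p \<le> - e n" for p t
        using that e(1)[of n] \<Phi>(2)[of "(t - p) / e n"] by (simp add: P_def field_simps)
      have Pid: "P p t = t - p" if "t - p \<ge> e n" for p t
        using that e(1)[of n] \<Phi>(3)[of "(t - p) / e n"] by (simp add: P_def field_simps)
      have supp: "h t = 0" if "t \<notin> {x - e n..z + e n}" for t
      proof (cases "t < x - e n")
        case True
        then show ?thesis using xyz by (simp add: h_def P0)
      next
        case False
        then have "t \<ge> z + e n" using that by auto
        then show ?thesis using xyz by (simp add: h_def Pid) (simp add: algebra_simps)
      qed
      have lip: "\<bar>P p t - P q t\<bar> \<le> L * \<bar>p - q\<bar>" for p q t
      proof -
        have "\<bar>P p t - P q t\<bar> = e n * \<bar>\<Phi> ((t - p) / e n) - \<Phi> ((t - q) / e n)\<bar>"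
          using e(1)[of n] by (simp add: P_def right_diff_distrib[symmetric] abs_mult)
        also have "\<dots> \<le> e n * (L * \<bar>(t - p) / e n - (t - q) / e n\<bar>)"
          using e(1)[of n] by (intro mult_left_mono L) auto
        also have "\<dots> = L * \<bar>p - q\<bar>"
          using e(1)[of n] by (simp add: diff_divide_distrib[symmetric] abs_divide abs_minus_commute)
        finally show ?thesis .
      qed
      have bound: "\<bar>h t\<bar> \<le> 2 * L * ((z - y) * (y - x)) * indicator {x - e n..z + e n} t" for t
      proof (cases "t \<in> {x - e n..z + e n}")
        case True
        have "h t = (z - y) * (P x t - P y t) + (y - x) * (P z t - P y t)"
          by (simp add: h_def algebra_simps)
        also have "\<bar>\<dots>\<bar> \<le> (z - y) * \<bar>P x t - P y t\<bar> + (y - x) * \<bar>P z t - P y t\<bar>"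
          using xyz by (intro order.trans[OF abs_triangle_ineq]) (simp add: abs_mult)
        also have "\<dots> \<le> (z - y) * (L * \<bar>x - y\<bar>) + (y - x) * (L * \<bar>z - y\<bar>)"
          using xyz by (intro add_mono mult_left_mono lip) auto
        also have "\<dots> = 2 * L * ((z - y) * (y - x))"
          using xyz by (simp add: algebra_simps)
        finally show ?thesis using True by simp
      qed (simp add: supp)
      have "integrable lebesgue (indicat_real {x - e n..z + e n})"
        by (rule integrable_real_indicator) (auto simp: emeasure_lborel_Icc_eq)
      then have "(LINT t|lebesgue. \<bar>h t\<bar>) \<le> (LINT t|lebesgue. 2 * L * ((z - y) * (y - x)) * indicator {x - e n..z + e n} t)"
      proof (intro integral_mono)
        show "integrable lebesgue (\<lambda>t. \<bar>h t\<bar>)"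
          using integrable_continuous_compact_support(2)[OF smooth_continuous_on[OF sh] supp] by (rule integrable_abs)
      qed (use bound in auto)
      also have "\<dots> = 2 * L * ((z - y) * (y - x)) * (z - x + 2 * e n)"
        using xyz e(1)[of n] by simp
      finally have I1: "(LINT t|lebesgue. \<bar>h t\<bar>) \<le> 2 * L * ((z - y) * (y - x)) * (z - x + 2 * e n)" .
      have intI: "integrable lebesgue (\<lambda>t. f t * P2 p t)" for p
      proof (rule integrable_continuous_compact_support(2))
        have "continuous_on UNIV (P2 p)"
          unfolding P2_def using en by (intro continuous_intros continuous_on_compose2[OF Bc]) auto
        then show "continuous_on UNIV (\<lambda>t. f t * P2 p t)" by (intro continuous_intros f)
        show "f t * P2 p t = 0" if "t \<notin> {p - e n..p + e n}" for t
          using that e(1)[of n] Bs[of "(t - p) / e n"] by (auto simp: field_simps P2_def)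
      qed
      have II: "I n p = (LINT t|lebesgue. f t * P2 p t)" for p
        by (simp only: I_def P2_def)
      have "(LINT t|lebesgue. f t * deriv (deriv h) t)
          = (LINT t|lebesgue. (z - y) * (f t * P2 x t) - (z - x) * (f t * P2 y t) + (y - x) * (f t * P2 z t))"
        unfolding h2 by (intro Bochner_Integration.integral_cong) (auto simp: algebra_simps)
      also have "\<dots> = (z - y) * I n x - (z - x) * I n y + (y - x) * I n z"
        using intI by (simp add: II)
      finally have "(z - y) * I n x - (z - x) * I n y + (y - x) * I n z = (LINT t|lebesgue. f t * deriv (deriv h) t)" ..
      then have "\<bar>(z - y) * I n x - (z - x) * I n y + (y - x) * I n z\<bar> \<le> C * (LINT t|lebesgue. \<bar>h t\<bar>)"
      proof -
        have "h t = 0" if "t \<notin> {a..b}" for t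
          by (rule supp) (use that e[of n] e0 in auto)
        from weak[OF sh this] \<open>(z - y) * I n x - (z - x) * I n y + (y - x) * I n z = _\<close>
        show ?thesis by simp
      qed
      also have "\<dots> \<le> C * (2 * L * ((z - y) * (y - x)) * (z - x + 2 * e n))"
        by (intro mult_left_mono I1 C)
      finally show ?thesis by (simp add: algebra_simps)
    qed
    have "(\<lambda>n. I n p) \<longlonglongrightarrow> f p" for p
      unfolding I_def using e e0
      by (intro approximate_identity[OF f Bc Bs B1 elim]) (auto intro: order.trans)
    then have lim1: "(\<lambda>n. \<bar>(z - y) * I n x - (z - x) * I n y + (y - x) * I n z\<bar>)
        \<longlonglongrightarrow> \<bar>(z - y) * f x - (z - x) * f y + (y - x) * f z\<bar>"
      by (intro tendsto_intros)
    have lim2: "(\<lambda>n. 2 * L * C * ((z - y) * (y - x) * (z - x + 2 * e n)))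
        \<longlonglongrightarrow> 2 * L * C * ((z - y) * (y - x) * (z - x + 2 * 0))"
      by (intro tendsto_intros elim)
    show ?thesis
      using LIMSEQ_le[OF lim1 lim2] le by simp
  qed
  show ?thesis
    by (rule that[of "2 * L"]) (use main L in auto)
qed

text \<open>
  Divided by \<open>(z - y)(y - x)(z - x)\<close>, the assumption bounds the second divided difference of \<open>f\<close>,
  which is symmetric in its three points. So for fixed \<open>x\<close> the difference quotient
  \<open>y \<mapsto> (f y - f x) / (y - x)\<close> is Lipschitz, and hence has a limit \<open>D x\<close> at \<open>x\<close> which it approximates
  up to \<open>M |y - x|\<close>. The Lipschitz bound for \<open>D\<close> follows since the quotient is symmetric in its two
  points.
\<close>

lemma bounded_second_difference_imp_C11:
  fixes f :: "real \<Rightarrow> real"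
  assumes M: "0 \<le> M" and diff2: "\<And>x y z. a < x \<Longrightarrow> x < y \<Longrightarrow> y < z \<Longrightarrow> z < b \<Longrightarrow>
       \<bar>(z - y) * f x - (z - x) * f y + (y - x) * f z\<bar> \<le> M * ((z - y) * (y - x) * (z - x))"
  obtains D where "\<And>x. x \<in> {a<..<b} \<Longrightarrow> (f has_real_derivative D x) (at x)"
    "\<And>x y. x \<in> {a<..<b} \<Longrightarrow> y \<in> {a<..<b} \<Longrightarrow> \<bar>D x - D y\<bar> \<le> 2 * M * \<bar>x - y\<bar>"
proof -
  define q where "q x y = (f y - f x) / (y - x)" for x y
  have sym: "\<bar>(z - y) * f x + (x - z) * f y + (y - x) * f z\<bar> \<le> M * (\<bar>z - y\<bar> * \<bar>y - x\<bar> * \<bar>z - x\<bar>)"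
    if xyz: "x \<in> {a<..<b}" "y \<in> {a<..<b}" "z \<in> {a<..<b}" "x \<noteq> y" "x \<noteq> z" "y \<noteq> z" for x y z
  proof -
    have "(x < y \<and> y < z) \<or> (x < z \<and> z < y) \<or> (y < x \<and> x < z) \<or> (y < z \<and> z < x) \<or> (z < x \<and> x < y) \<or> (z < y \<and> y < x)"
      using xyz by linarith
    then consider "x < y \<and> y < z" | "x < z \<and> z < y" | "y < x \<and> x < z" | "y < z \<and> z < x" | "z < x \<and> x < y" | "z < y \<and> y < x"
      by blast
    then show ?thesis
      by cases (use xyz diff2[of x y z] diff2[of x z y] diff2[of y x z] diff2[of y z x] diff2[of z x y] diff2[of z y x]
          in \<open>auto simp: algebra_simps abs_if split: if_splits\<close>)
  qed
  have qd: "\<bar>q x y - q x z\<bar> \<le> M * \<bar>y - z\<bar>"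
    if "x \<in> {a<..<b}" "y \<in> {a<..<b}" "z \<in> {a<..<b}" "x \<noteq> y" "x \<noteq> z" for x y z
  proof (cases "y = z")
    case False
    have nz: "y - x \<noteq> 0" "z - x \<noteq> 0" using that by auto
    have "q x y - q x z = - ((z - y) * f x + (x - z) * f y + (y - x) * f z) / ((y - x) * (z - x))"
      using nz by (simp add: q_def diff_frac_eq) (simp add: algebra_simps)
    then have "\<bar>q x y - q x z\<bar> = \<bar>(z - y) * f x + (x - z) * f y + (y - x) * f z\<bar> / (\<bar>y - x\<bar> * \<bar>z - x\<bar>)"
      by (simp only: abs_divide abs_minus_cancel abs_mult)
    also have "\<dots> \<le> M * (\<bar>z - y\<bar> * \<bar>y - x\<bar> * \<bar>z - x\<bar>) / (\<bar>y - x\<bar> * \<bar>z - x\<bar>)"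
      using that False by (intro divide_right_mono sym) auto
    also have "\<dots> = M * \<bar>y - z\<bar>" using nz by (simp add: abs_minus_commute)
    finally show ?thesis .
  qed (use M in auto)
  have "\<exists>D. \<forall>y\<in>{a<..<b} - {x}. \<bar>q x y - D\<bar> \<le> M * \<bar>y - x\<bar>" if x: "x \<in> {a<..<b}" for x
  proof -
    define y where "y n = x + (b - x) / real (Suc (Suc n))" for n
    have "(b - x) * 1 < (b - x) * real (Suc (Suc n))" for n
      using x by (intro mult_strict_left_mono) auto
    then have p: "(b - x) / real (Suc (Suc n)) > 0" "(b - x) / real (Suc (Suc n)) < b - x" for n
      using x by (simp_all add: divide_less_eq)
    then have y: "y n \<in> {a<..<b}" "y n \<noteq> x" for n
      using x p(1)[of n] p(2)[of n] unfolding y_def greaterThanLessThan_iff by linarith+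
    have ylim: "y \<longlonglongrightarrow> x"
    proof -
      have "(\<lambda>n. (b - x) / real n) \<longlonglongrightarrow> 0"
        using tendsto_mult_right_zero[OF lim_inverse_n', of "b - x"] by (simp add: divide_inverse)
      then have "(\<lambda>n. (b - x) / real (Suc (Suc n))) \<longlonglongrightarrow> 0"
        by (intro LIMSEQ_Suc[of "\<lambda>n. (b - x) / real (Suc n)"] LIMSEQ_Suc[of "\<lambda>n. (b - x) / real n"])
      then have "y \<longlonglongrightarrow> x + 0" unfolding y_def by (intro tendsto_intros)
      then show ?thesis by simp
    qed
    have "Cauchy (\<lambda>n. q x (y n))"
      unfolding Cauchy_altdef2
    proof (intro allI impI)
      fix d :: real assume "0 < d"
      then have "d / (M + 1) > 0" using M by simp
      with LIMSEQ_imp_Cauchy[OF ylim] obtain N where N: "\<And>n. n \<ge> N \<Longrightarrow> dist (y n) (y N) < d / (M + 1)"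
        unfolding Cauchy_altdef2 by blast
      have "dist (q x (y n)) (q x (y N)) < d" if "n \<ge> N" for n
      proof -
        have "dist (q x (y n)) (q x (y N)) \<le> M * \<bar>y n - y N\<bar>"
          unfolding dist_real_def by (rule qd) (use x y in auto)
        also have "\<dots> \<le> (M + 1) * \<bar>y n - y N\<bar>" by (intro mult_right_mono) auto
        also have "\<dots> < d" using N[OF that] M by (simp add: dist_real_def field_simps)
        finally show ?thesis .
      qed
      then show "\<exists>N. \<forall>n\<ge>N. dist (q x (y n)) (q x (y N)) < d" by blast
    qed
    then obtain D where D: "(\<lambda>n. q x (y n)) \<longlonglongrightarrow> D"
      using convergent_def real_Cauchy_convergent by blast
    have "\<bar>q x w - D\<bar> \<le> M * \<bar>w - x\<bar>" if w: "w \<in> {a<..<b} - {x}" for w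
    proof (rule LIMSEQ_le)
      show "(\<lambda>n. \<bar>q x w - q x (y n)\<bar>) \<longlonglongrightarrow> \<bar>q x w - D\<bar>" by (intro tendsto_intros D)
      show "(\<lambda>n. M * \<bar>w - y n\<bar>) \<longlonglongrightarrow> M * \<bar>w - x\<bar>" by (intro tendsto_intros ylim)
      show "\<exists>N. \<forall>n\<ge>N. \<bar>q x w - q x (y n)\<bar> \<le> M * \<bar>w - y n\<bar>"
        using w x y(1) y(2)[THEN not_sym] by (intro exI allI impI qd) auto
    qed
    then show ?thesis by blast
  qed
  then obtain D where D: "\<And>x y. x \<in> {a<..<b} \<Longrightarrow> y \<in> {a<..<b} - {x} \<Longrightarrow> \<bar>q x y - D x\<bar> \<le> M * \<bar>y - x\<bar>"
    by metis
  show ?thesis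
  proof
    fix x assume x: "x \<in> {a<..<b}"
    have "eventually (\<lambda>y. y \<in> {a<..<b} - {x}) (at x)"
      using eventually_at_in_open[of "{a<..<b}" x] x by auto
    then have ev: "eventually (\<lambda>y. norm (q x y - D x) \<le> M * \<bar>y - x\<bar>) (at x)"
      by eventually_elim (use D x in auto)
    have "((\<lambda>y. M * \<bar>y - x\<bar>) \<longlongrightarrow> M * \<bar>x - x\<bar>) (at x)" by (intro tendsto_intros)
    then have "((\<lambda>y. q x y - D x) \<longlongrightarrow> 0) (at x)"
      by (intro Lim_null_comparison[OF ev]) simp
    then have "(q x \<longlongrightarrow> D x) (at x)" by (simp add: LIM_zero_iff)
    then show "(f has_real_derivative D x) (at x)"
      by (simp add: has_field_derivative_iff q_def[abs_def])
  next
    fix x y assume xy: "x \<in> {a<..<b}" "y \<in> {a<..<b}"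
    show "\<bar>D x - D y\<bar> \<le> 2 * M * \<bar>x - y\<bar>"
    proof (cases "x = y")
      case False
      have "q x y = q y x" unfolding q_def by (metis minus_diff_eq minus_divide_divide)
      with D[of x y] D[of y x] xy False show ?thesis by (auto simp: abs_minus_commute)
    qed simp
  qed
qed

text \<open>
  The factor \<open>C\<close> in the Lipschitz constant matters: for \<open>C = 0\<close> it makes \<open>f\<close> affine on the interval.
\<close>

lemma weak_second_derivative_bound_imp_C11:
  fixes f :: "real \<Rightarrow> real"
  assumes "continuous_on UNIV f" "0 \<le> C"
    and "\<And>h. smooth h \<Longrightarrow> (\<And>t. t \<notin> {a..b} \<Longrightarrow> h t = 0) \<Longrightarrow>
        \<bar>LINT t|lebesgue. f t * deriv (deriv h) t\<bar> \<le> C * (LINT t|lebesgue. \<bar>h t\<bar>)"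
  obtains D K where "\<And>x. x \<in> {a<..<b} \<Longrightarrow> (f has_real_derivative D x) (at x)"
    "\<And>x y. x \<in> {a<..<b} \<Longrightarrow> y \<in> {a<..<b} \<Longrightarrow> \<bar>D x - D y\<bar> \<le> K * C * \<bar>x - y\<bar>"
proof -
  obtain K where K: "0 \<le> K"
    "\<And>x y z. a < x \<Longrightarrow> x < y \<Longrightarrow> y < z \<Longrightarrow> z < b \<Longrightarrow>
       \<bar>(z - y) * f x - (z - x) * f y + (y - x) * f z\<bar> \<le> K * C * ((z - y) * (y - x) * (z - x))"
    using weak_second_derivative_bounds_second_difference[OF assms] by blast
  have "0 \<le> K * C" using K assms(2) by simp
  from bounded_second_difference_imp_C11[OF this K(2)] obtain D where
    "\<And>x. x \<in> {a<..<b} \<Longrightarrow> (f has_real_derivative D x) (at x)"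
    "\<And>x y. x \<in> {a<..<b} \<Longrightarrow> y \<in> {a<..<b} \<Longrightarrow> \<bar>D x - D y\<bar> \<le> 2 * (K * C) * \<bar>x - y\<bar>" by blast
  then show ?thesis by (intro that[of D "2 * K"]) (auto simp: mult.assoc)
qed

section \<open>Test functions with separated polar variables\<close>

lemma inner_e_r: "e_r s \<bullet> e_r t = cos (s - t)" "e_r s \<bullet> e_theta t = sin (s - t)"
  by (simp_all add: inner_plane cos_diff sin_diff algebra_simps)

definition polar_rectangle :: "real \<Rightarrow> real \<Rightarrow> real \<Rightarrow> real \<Rightarrow> (real^2) set" where
  "polar_rectangle ra rb t1 d = (\<lambda>(r, t). r *\<^sub>R e_r t) ` ({ra..rb} \<times> {t1 - d..t1 + d})"

lemma compact_polar_rectangle: "compact (polar_rectangle ra rb t1 d)"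
  unfolding polar_rectangle_def case_prod_unfold
  by (intro compact_continuous_image compact_Times continuous_intros
      continuous_on_compose2[OF continuous_on_e_r[of UNIV]]) auto

text \<open>
  The function \<open>g(r) h(\<theta>)\<close> near the ray at angle \<open>t1\<close>. On the half plane around this ray the polar
  angle is \<open>t1\<close> plus an arc tangent; in all uses \<open>h\<close> is supported within less than a right angle of \<open>t1\<close>, so
  nothing is lost by cutting off outside the half plane.
\<close>

definition polar_product :: "(real \<Rightarrow> real) \<Rightarrow> (real \<Rightarrow> real) \<Rightarrow> real \<Rightarrow> real^2 \<Rightarrow> real" where
  "polar_product g h t1 x = (if x \<bullet> e_r t1 > 0
     then g (norm x) * h (t1 + arctan ((x \<bullet> e_theta t1) * inverse (x \<bullet> e_r t1))) else 0)"

lemma polar_product_polar: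
  assumes h: "\<And>t. t \<notin> {t1 - d..t1 + d} \<Longrightarrow> h t = 0" and d: "d < pi / 2"
    and "0 < r" "\<bar>t - t1\<bar> < pi"
  shows "polar_product g h t1 (r *\<^sub>R e_r t) = g r * h t"
proof (cases "cos (t - t1) > 0")
  case True
  have "\<bar>t - t1\<bar> < pi / 2"
  proof (rule ccontr)
    assume "\<not> ?thesis"
    then have "cos \<bar>t - t1\<bar> \<le> cos (pi / 2)"
      using assms(4) by (intro cos_monotone_0_pi_le) auto
    with True show False by simp
  qed
  then have "- (pi / 2) < t - t1" "t - t1 < pi / 2" by linarith+
  then have "arctan (tan (t - t1)) = t - t1" by (rule arctan_tan)
  moreover have "r * sin (t - t1) * inverse (r * cos (t - t1)) = tan (t - t1)"
    using True assms(3) by (simp add: tan_def field_simps)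
  ultimately show ?thesis
    using True assms(3) by (simp add: polar_product_def inner_e_r del: inverse_mult_distrib)
next
  case False
  have "\<bar>t - t1\<bar> \<ge> pi / 2"
  proof (rule ccontr)
    assume "\<not> ?thesis"
    then have "- (pi / 2) < t - t1" "t - t1 < pi / 2" by linarith+
    with cos_gt_zero_pi False show False by blast
  qed
  with d have "t \<notin> {t1 - d..t1 + d}" unfolding atLeastAtMost_iff by linarith
  then have "h t = 0" by (rule h)
  then show ?thesis
    using False assms(3) by (simp add: polar_product_def inner_e_r zero_less_mult_iff)
qed

lemma polar_product_zero_outside:
  assumes g: "\<And>r. r \<notin> {ra..rb} \<Longrightarrow> g r = 0"
    and h: "\<And>t. t \<notin> {t1 - d..t1 + d} \<Longrightarrow> h t = 0" and d: "d < pi / 2"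
    and x: "x \<notin> polar_rectangle ra rb t1 d"
  shows "polar_product g h t1 x = 0"
proof -
  obtain r t where rt: "r \<ge> 0" "\<bar>t - t1\<bar> \<le> pi" "x = r *\<^sub>R e_r t" by (rule polar_coordinates)
  show ?thesis
  proof (cases "r = 0 \<or> \<bar>t - t1\<bar> = pi")
    case True
    have "cos (t - t1) = -1" if "\<bar>t - t1\<bar> = pi"
      using cos_abs_real[of "t - t1"] that by simp
    with True have "r * cos (t - t1) \<le> 0" using rt(1) by auto
    then show ?thesis using rt(3) by (simp add: polar_product_def inner_e_r)
  next
    case False
    have "r \<notin> {ra..rb} \<or> t \<notin> {t1 - d..t1 + d}"
    proof (rule ccontr)
      assume "\<not> ?thesis"
      then have "x \<in> polar_rectangle ra rb t1 d"
        unfolding polar_rectangle_def using rt(3) by (intro image_eqI[of _ _ "(r, t)"]) auto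
      with x show False by simp
    qed
    then have "g r * h t = 0" using g h by auto
    then show ?thesis
      using polar_product_polar[OF h d, where g=g and r=r and t=t] rt False by simp
  qed
qed

lemma smooth_polar_product:
  assumes sm: "smooth g" "smooth h"
    and g: "\<And>r. r \<notin> {ra..rb} \<Longrightarrow> g r = 0" "0 < ra"
    and h: "\<And>t. t \<notin> {t1 - d..t1 + d} \<Longrightarrow> h t = 0" and d: "d < pi / 2"
  shows "smooth (polar_product g h t1)"
proof (rule smooth_extend_by_zero)
  let ?S = "{x::real^2. x \<bullet> e_r t1 > 0}"
  show op: "open ?S" by (intro open_Collect_less continuous_intros)
  show "closed (polar_rectangle ra rb t1 d)" by (intro compact_imp_closed compact_polar_rectangle)
  show "polar_rectangle ra rb t1 d \<subseteq> ?S"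
    using g(2) d by (auto simp: polar_rectangle_def inner_e_r intro!: mult_pos_pos cos_gt_zero_pi)
  show "polar_product g h t1 x = 0" if "x \<notin> polar_rectangle ra rb t1 d" for x
    using polar_product_zero_outside[OF g(1) h d that] .
  let ?p = "\<lambda>x::real^2. g (norm x) * h (t1 + arctan ((x \<bullet> e_theta t1) * inverse (x \<bullet> e_r t1)))"
  show "polar_product g h t1 x = ?p x" if "x \<in> ?S" for x
    using that by (simp add: polar_product_def)
  have "Ck_on k ?S ?p" for k
  proof -
    have gk: "Ck_on k UNIV g" "Ck_on k UNIV h"
      using sm by (auto simp: smooth_def Ck_on_UNIV)
    have norm: "norm x = sqrt ((x \<bullet> axis 1 1) * (x \<bullet> axis 1 1) + (x \<bullet> axis 2 1) * (x \<bullet> axis 2 1))" for x :: "real^2"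
      by (simp add: norm_eq_sqrt_inner inner_plane axis_def)
    have "Ck_on k ?S (\<lambda>x. sqrt ((x \<bullet> axis 1 1) * (x \<bullet> axis 1 1) + (x \<bullet> axis 2 1) * (x \<bullet> axis 2 1)))"
    proof (rule Ck_on_compose[OF op _ Ck_on_real_sqrt])
      show "Ck_on k ?S (\<lambda>x. (x \<bullet> axis 1 1) * (x \<bullet> axis 1 1) + (x \<bullet> axis 2 1) * (x \<bullet> axis 2 1))"
        by (intro Ck_on_add Ck_on_mult Ck_on_inner op)
      show "(\<lambda>x. (x \<bullet> axis 1 1) * (x \<bullet> axis 1 1) + (x \<bullet> axis 2 1) * (x \<bullet> axis 2 1)) ` ?S \<subseteq> {0<..}"
      proof clarsimp
        fix x :: "real^2" assume "0 < x \<bullet> e_r t1"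
        then have "0 < x \<bullet> x" by auto
        then show "0 < (x \<bullet> axis 1 1) * (x \<bullet> axis 1 1) + (x \<bullet> axis 2 1) * (x \<bullet> axis 2 1)"
          by (simp add: inner_plane axis_def)
      qed
    qed simp
    then have n: "Ck_on k ?S norm" by (simp only: norm[symmetric])
    have "Ck_on k ?S (\<lambda>x. g (norm x))"
      by (rule Ck_on_compose[OF op _ gk(1) n]) auto
    moreover have "Ck_on k ?S (\<lambda>x. (x \<bullet> e_theta t1) * inverse (x \<bullet> e_r t1))"
      by (intro Ck_on_mult op Ck_on_inner Ck_on_inverse) auto
    then have "Ck_on k ?S (\<lambda>x. arctan ((x \<bullet> e_theta t1) * inverse (x \<bullet> e_r t1)))"
      by (rule Ck_on_compose[OF op open_UNIV Ck_on_arctan]) auto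
    then have "Ck_on k ?S (\<lambda>x. t1 + arctan ((x \<bullet> e_theta t1) * inverse (x \<bullet> e_r t1)))"
      by (intro Ck_on_add op Ck_on_const)
    then have "Ck_on k ?S (\<lambda>x. h (t1 + arctan ((x \<bullet> e_theta t1) * inverse (x \<bullet> e_r t1))))"
      by (rule Ck_on_compose[OF op open_UNIV gk(2)]) auto
    ultimately show ?thesis by (intro Ck_on_mult op)
  qed
  then show "smooth_on ?S ?p" by (simp add: smooth_on_def)
qed

lemma test_functionI:
  assumes "smooth \<phi>" "\<And>x. x \<notin> K \<Longrightarrow> \<phi> x = 0" "compact K" "K \<subseteq> V"
  shows "test_function V \<phi>"
proof -
  have "closure {x. \<phi> x \<noteq> 0} \<subseteq> K"
    using assms(2,3) by (intro closure_minimal compact_imp_closed) auto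
  moreover from this have "compact (closure {x. \<phi> x \<noteq> 0})"
    using assms(3) by (metis closed_closure compact_Int_closed inf.absorb_iff2)
  ultimately show ?thesis using assms by (auto simp: test_function_def)
qed

lemma pd_polar:
  assumes q: "q differentiable (at (r *\<^sub>R e_r t))" and r: "0 < r"
    and A: "((\<lambda>s. q (s *\<^sub>R e_r t)) has_real_derivative A) (at r)"
    and B: "((\<lambda>s. q (r *\<^sub>R e_r s)) has_real_derivative B) (at t)"
  shows "pd 1 q (r *\<^sub>R e_r t) = A * cos t - B / r * sin t"
    "pd 2 q (r *\<^sub>R e_r t) = A * sin t + B / r * cos t"
proof -
  obtain D where D: "(q has_derivative D) (at (r *\<^sub>R e_r t))"
    using q by (auto simp: differentiable_def)
  then have lin: "linear D" by (rule has_derivative_linear)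
  have "((\<lambda>s. q (s *\<^sub>R e_r t)) has_derivative (\<lambda>u. D (u *\<^sub>R e_r t))) (at r)"
    by (rule has_derivative_compose[where f="\<lambda>s. s *\<^sub>R e_r t" and g=q, OF _ D]) (auto intro!: derivative_eq_intros)
  then have "(\<lambda>u. D (u *\<^sub>R e_r t)) = (*) A"
    using A has_derivative_unique by (auto simp: has_field_derivative_def)
  from fun_cong[OF this, of 1] have DA: "D (e_r t) = A" by simp
  have "((\<lambda>s. q (r *\<^sub>R e_r s)) has_derivative (\<lambda>u. D (r *\<^sub>R (u *\<^sub>R e_theta t)))) (at t)"
    by (rule has_derivative_compose[where f="\<lambda>s. r *\<^sub>R e_r s" and g=q, OF _ D])
       (use e_r_has_derivative[of t UNIV] in \<open>auto intro!: derivative_eq_intros simp: has_vector_derivative_def\<close>)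
  then have "(\<lambda>u. D (r *\<^sub>R (u *\<^sub>R e_theta t))) = (*) B"
    using B has_derivative_unique by (auto simp: has_field_derivative_def)
  from fun_cong[OF this, of 1] have "D (r *\<^sub>R e_theta t) = B" by simp
  then have DB: "D (e_theta t) = B / r"
    using r by (simp add: linear_scale[OF lin] field_simps)
  have sc: "(sin t)\<^sup>2 + (cos t)\<^sup>2 = 1" by simp
  have "axis 1 1 = cos t *\<^sub>R e_r t + (- sin t) *\<^sub>R e_theta t" "axis 2 1 = sin t *\<^sub>R e_r t + cos t *\<^sub>R e_theta t"
    using sc by (auto simp: vec_eq_iff forall_2 axis_def power2_eq_square algebra_simps)
  then have "D (axis 1 1) = A * cos t - B / r * sin t" "D (axis 2 1) = A * sin t + B / r * cos t"
    by (simp_all add: linear_add[OF lin] linear_diff[OF lin] linear_scale[OF lin] DA DB)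
  with partial_deriv_eq[OF D] show "pd 1 q (r *\<^sub>R e_r t) = A * cos t - B / r * sin t"
    "pd 2 q (r *\<^sub>R e_r t) = A * sin t + B / r * cos t" by simp_all
qed

lemma pd_polar_product:
  assumes sm: "smooth g" "smooth h"
    and g: "\<And>r. r \<notin> {ra..rb} \<Longrightarrow> g r = 0" "0 < ra"
    and h: "\<And>t. t \<notin> {t1 - d..t1 + d} \<Longrightarrow> h t = 0" and d: "d < pi / 2"
    and r: "0 < r" and t: "\<bar>t - t1\<bar> < pi"
  shows "pd 1 (polar_product g h t1) (r *\<^sub>R e_r t) = deriv g r * h t * cos t - g r * deriv h t / r * sin t"
    "pd 2 (polar_product g h t1) (r *\<^sub>R e_r t) = deriv g r * h t * sin t + g r * deriv h t / r * cos t"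
proof -
  have q: "polar_product g h t1 differentiable (at (r *\<^sub>R e_r t))"
    by (intro smooth_differentiable smooth_polar_product[OF sm g h d])
  have val: "g r * h s = polar_product g h t1 (r *\<^sub>R e_r s)" if "s \<in> {t1 - pi<..<t1 + pi}" for s
    by (rule polar_product_polar[OF h d r, symmetric]) (use that in auto)
  have "((\<lambda>s. g s * h t) has_real_derivative deriv g r * h t) (at r)"
    by (auto intro!: derivative_eq_intros smooth_real_deriv[OF sm(1)])
  then have A: "((\<lambda>s. polar_product g h t1 (s *\<^sub>R e_r t)) has_real_derivative deriv g r * h t) (at r)"
    by (rule has_field_derivative_transform_within_open[where S="{0<..}"]) (use r polar_product_polar[OF h d _ t, where g=g] in auto)
  have "((\<lambda>s. g r * h s) has_real_derivative g r * deriv h t) (at t)"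
    by (auto intro!: derivative_eq_intros smooth_real_deriv[OF sm(2)])
  then have B: "((\<lambda>s. polar_product g h t1 (r *\<^sub>R e_r s)) has_real_derivative g r * deriv h t) (at t)"
    by (rule has_field_derivative_transform_within_open[where S="{t1 - pi<..<t1 + pi}"]) (use t val in auto)
  show "pd 1 (polar_product g h t1) (r *\<^sub>R e_r t) = deriv g r * h t * cos t - g r * deriv h t / r * sin t"
    "pd 2 (polar_product g h t1) (r *\<^sub>R e_r t) = deriv g r * h t * sin t + g r * deriv h t / r * cos t"
    using pd_polar[OF q r A B] by auto
qed

text \<open>
  With this relation the radial integrals of a separated test function need not be computed: they
  are explicit multiples of one of them, which can be divided out once it is positive.
\<close>

lemma radial_weight:
  assumes sm: "smooth g" and g: "\<And>r. r \<notin> {ra..rb} \<Longrightarrow> g r = 0" "0 < ra"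
  shows "continuous_on UNIV (\<lambda>r. r powr p * g r)"
    and "integrable lebesgue (\<lambda>r. r powr p * g r)"
    and "(LINT r|lebesgue. r powr p * deriv g r) = - p * (LINT r|lebesgue. r powr (p - 1) * g r)"
proof -
  have der: "((\<lambda>r. r powr p * g r) has_real_derivative p * (r powr (p - 1) * g r) + r powr p * deriv g r) (at r)"
    if sm: "smooth g" and g0: "\<And>r. r \<notin> {ra..rb} \<Longrightarrow> g r = 0" for p r g
  proof (cases "r > 0")
    case True
    then show ?thesis
      by (auto intro!: derivative_eq_intros smooth_real_deriv[OF sm])
  next
    case False
    have "deriv g r = 0" "g r = 0"
      using False g(2) by (auto intro!: smooth_deriv_zero_outside[OF sm g0] g0)
    moreover have "((\<lambda>_. 0) has_real_derivative 0) (at r)" by simp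
    then have "((\<lambda>r. r powr p * g r) has_real_derivative 0) (at r)"
      by (rule has_field_derivative_transform_within_open[where S="{..<ra}"]) (use False g(2) g0 in auto)
    ultimately show ?thesis by simp
  qed
  have cont: "continuous_on UNIV (\<lambda>r. r powr p * g r)"
    if "smooth g" "\<And>r. r \<notin> {ra..rb} \<Longrightarrow> g r = 0" for p g
    using der[OF that] by (intro continuous_at_imp_continuous_on ballI DERIV_isCont) auto
  have int: "integrable lebesgue (\<lambda>r. r powr p * g r)"
    if "smooth g" "\<And>r. r \<notin> {ra..rb} \<Longrightarrow> g r = 0" for p g
    by (rule integrable_continuous_compact_support(2)[OF cont[OF that], of ra rb]) (use that in auto)
  show "continuous_on UNIV (\<lambda>r. r powr p * g r)" "integrable lebesgue (\<lambda>r. r powr p * g r)"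
    using cont[OF sm g(1)] int[OF sm g(1)] by auto
  have sm': "smooth (deriv g)" "\<And>r. r \<notin> {ra..rb} \<Longrightarrow> deriv g r = 0"
    using smooth_real_deriv(2)[OF sm] smooth_deriv_zero_outside[OF sm g(1)] by auto
  have "(LINT r|lebesgue. p * (r powr (p - 1) * g r) + r powr p * deriv g r) = 0"
    by (rule integral_derivative_compact_support(2)[OF der[OF sm g(1)]])
      (auto intro!: continuous_intros cont sm g(1) sm')
  then show "(LINT r|lebesgue. r powr p * deriv g r) = - p * (LINT r|lebesgue. r powr (p - 1) * g r)"
    using int[OF sm g(1), of "p - 1"] int[OF sm', of p] by simp
qed

lemma integral_pos_continuous:
  fixes f :: "real \<Rightarrow> real"
  assumes "continuous_on UNIV f" "\<And>t. t \<notin> {a..b} \<Longrightarrow> f t = 0" "\<And>t. 0 \<le> f t"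
    "a < b" "\<And>t. t \<in> {a<..<b} \<Longrightarrow> 0 < f t"
  shows "0 < (LINT t|lebesgue. f t)"
proof -
  note int = integrable_continuous_compact_support[OF assms(1,2)]
  have nn: "0 \<le> (LINT t|lborel. f t)" using assms(3) by (intro integral_nonneg_AE) auto
  moreover have "(LINT t|lborel. f t) \<noteq> 0"
  proof
    assume "(LINT t|lborel. f t) = 0"
    then have ae: "AE t in lborel. f t = 0"
      using integral_nonneg_eq_0_iff_AE[OF int(1)] assms(3) by simp
    have "AE t in lborel. t \<notin> {a<..<b}"
      using ae by eventually_elim (use assms(5) in force)
    then have "emeasure lborel {a<..<b} = 0"
      by (subst (asm) AE_iff_measurable[of "{a<..<b}"]) auto
    with assms(4) show False by simp
  qed
  ultimately show ?thesis using int(3) by simp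
qed

section \<open>Homogeneous flows tested in separated variables\<close>

lemma frame_inner:
  fixes c s :: real
  assumes "c\<^sup>2 + s\<^sup>2 = 1"
  shows "(u * c - v * s) * (a * c - b * s) + (u * s + v * c) * (a * s + b * c) = u * a + v * b"
    "(u * s + v * c) * (a * c - b * s) - (u * c - v * s) * (a * s + b * c) = v * a - u * b"
  using assms by algebra+

text \<open>
  This evaluates \<open>U \<otimes> U : \<nabla>\<phi>\<close> and \<open>div \<phi>\<close> for \<open>\<phi> = q\<^sub>1 x + q\<^sub>2 x\<^sup>\<bottom>\<close> at the point with polar
  coordinates \<open>(r, t)\<close>, where \<open>(c, s) = (cos t, sin t)\<close>: \<open>u\<close> and \<open>v\<close> are the radial and angular
  components of \<open>U\<close>, \<open>A\<^sub>i\<close> and \<open>E\<^sub>i\<close> those of \<open>\<nabla>q\<^sub>i\<close>, and \<open>Q\<^sub>i\<close> is the value of \<open>q\<^sub>i\<close>.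
\<close>

lemma frame_tensor:
  fixes c s :: real
  assumes cs: "c\<^sup>2 + s\<^sup>2 = 1"
    and U: "U1 = u * c - v * s" "U2 = u * s + v * c"
    and q: "q11 = A1 * c - E1 * s" "q12 = A1 * s + E1 * c" "q21 = A2 * c - E2 * s" "q22 = A2 * s + E2 * c"
  shows "U1 * U1 * (q11 * (r * c) + Q1 - q21 * (r * s)) + U1 * U2 * (q12 * (r * c) - (q22 * (r * s) + Q2))
      + (U2 * U1 * (q11 * (r * s) + (q21 * (r * c) + Q2)) + U2 * U2 * (q12 * (r * s) + Q1 + q22 * (r * c)))
    = r * u * (u * A1 + v * E1) + Q1 * (u\<^sup>2 + v\<^sup>2) + r * v * (u * A2 + v * E2)" (is "?L = ?R")
    and "q11 * (r * c) + Q1 - q21 * (r * s) + (q12 * (r * s) + Q1 + q22 * (r * c)) = r * A1 + 2 * Q1 + r * E2"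
proof -
  have 1: "U1 * q11 + U2 * q12 = u * A1 + v * E1" "U1 * q21 + U2 * q22 = u * A2 + v * E2"
    unfolding U q by (rule frame_inner[OF cs])+
  have 2: "U1 * c + U2 * s = u" "U2 * c - U1 * s = v" "U1\<^sup>2 + U2\<^sup>2 = u\<^sup>2 + v\<^sup>2"
    unfolding U using cs by algebra+
  have "?L = (U1 * q11 + U2 * q12) * r * (U1 * c + U2 * s) + Q1 * (U1\<^sup>2 + U2\<^sup>2)
      + (U1 * q21 + U2 * q22) * r * (U2 * c - U1 * s)"
    by algebra
  also have "\<dots> = ?R" unfolding 1 2 by algebra
  finally show "?L = ?R" .
  show "q11 * (r * c) + Q1 - q21 * (r * s) + (q12 * (r * s) + Q1 + q22 * (r * c)) = r * A1 + 2 * Q1 + r * E2"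
    unfolding q using cs by algebra
qed

locale homogeneous_flow =
  fixes l :: real and U :: "real^2 \<Rightarrow> real^2" and \<psi> d\<psi> :: "real \<Rightarrow> real" and p :: "real^2 \<Rightarrow> real"
  assumes l: "1 < l" "l < 2"
    and H1: "H1_circle \<psi> d\<psi>"
    and U_polar: "\<And>r t. 0 < r \<Longrightarrow>
      U (r *\<^sub>R e_r t) = r powr (l - 1) *\<^sub>R (- d\<psi> t *\<^sub>R e_r t + (l * \<psi> t) *\<^sub>R e_theta t)"
    and euler: "weak_steady_euler U p"
begin

lemma cont_psi: "continuous_on S \<psi>"
  using H1 by (auto simp: H1_circle_def intro: continuous_on_subset)

lemma U_components:
  assumes "0 < r"
  shows "U (r *\<^sub>R e_r t) $ 1 = (- (r powr (l - 1) * d\<psi> t)) * cos t - (r powr (l - 1) * (l * \<psi> t)) * sin t"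
    "U (r *\<^sub>R e_r t) $ 2 = (- (r powr (l - 1) * d\<psi> t)) * sin t + (r powr (l - 1) * (l * \<psi> t)) * cos t"
  using assms by (simp_all add: U_polar algebra_simps)

lemma dpsi_periodic: "d\<psi> (t + 2 * pi * of_int n) = d\<psi> t"
proof -
  have per: "d\<psi> (t + 2 * pi) = d\<psi> t" for t using H1 by (simp add: H1_circle_def)
  have nat: "d\<psi> (t + 2 * pi * real k) = d\<psi> t" for k t
  proof (induction k)
    case (Suc k)
    then show ?case using per[of "t + 2 * pi * real k"] by (simp add: algebra_simps)
  qed simp
  show ?thesis
  proof (cases "n \<ge> 0")
    case True
    then show ?thesis using nat[of t "nat n"] by simp
  next
    case False
    then show ?thesis using nat[of "t + 2 * pi * of_int n" "nat (- n)"] by simp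
  qed
qed

text \<open>
  The hypothesis covers one period only, while the angular windows used below are centred at
  arbitrary angles.
\<close>

lemma dpsi_square_integrable: "set_integrable lebesgue {a..b} (\<lambda>t. (d\<psi> t)\<^sup>2)"
proof -
  have base: "set_integrable lebesgue {0..2 * pi} (\<lambda>t. (d\<psi> t)\<^sup>2)"
    using H1 by (simp add: H1_circle_def)
  have piece: "set_integrable lebesgue {2 * pi * of_int n..2 * pi * of_int n + 2 * pi} (\<lambda>t. (d\<psi> t)\<^sup>2)" for n :: int
  proof -
    have "indicator {0..2 * pi} (- (2 * pi * of_int n) + 1 * t) *\<^sub>R (d\<psi> (- (2 * pi * of_int n) + 1 * t))\<^sup>2
        = indicator {2 * pi * of_int n..2 * pi * of_int n + 2 * pi} t *\<^sub>R (d\<psi> t)\<^sup>2" for t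
      using dpsi_periodic[of "- (2 * pi * of_int n) + t" n] by (auto simp: indicator_def)
    then show ?thesis
      using lebesgue_integrable_real_affine[OF base[unfolded set_integrable_def], of 1 "- (2 * pi * of_int n)"]
      by (simp add: set_integrable_def)
  qed
  define N where "N = {\<lfloor>a / (2 * pi)\<rfloor>..\<lfloor>b / (2 * pi)\<rfloor>}"
  have union: "set_integrable lebesgue (\<Union>n\<in>N. {2 * pi * of_int n..2 * pi * of_int n + 2 * pi}) (\<lambda>t. (d\<psi> t)\<^sup>2)"
    by (rule set_integrable_UN) (use piece in \<open>auto simp: N_def\<close>)
  have sub: "{a..b} \<subseteq> (\<Union>n\<in>N. {2 * pi * of_int n..2 * pi * of_int n + 2 * pi})"
  proof
    fix t assume t: "t \<in> {a..b}"
    let ?n = "\<lfloor>t / (2 * pi)\<rfloor>"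
    have "?n \<in> N" using t by (auto simp: N_def intro!: floor_mono divide_right_mono)
    moreover have "of_int ?n * (2 * pi) \<le> t" "t < (of_int ?n + 1) * (2 * pi)"
      by (rule floor_divide_lower floor_divide_upper; simp)+
    then have "t \<in> {2 * pi * of_int ?n..2 * pi * of_int ?n + 2 * pi}" by (simp add: algebra_simps)
    ultimately show "t \<in> (\<Union>n\<in>N. {2 * pi * of_int n..2 * pi * of_int n + 2 * pi})" by blast
  qed
  show ?thesis by (rule set_integrable_subset[OF union _ sub]) auto
qed

lemma dpsi_mult_integrable:
  assumes h: "continuous_on UNIV h" "\<And>t. t \<notin> {a..b} \<Longrightarrow> h t = 0"
  shows "integrable lebesgue (\<lambda>t. d\<psi> t * h t)"
proof -
  have "compact (h ` {a..b})" by (intro compact_continuous_image continuous_on_subset[OF h(1)]) auto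
  then obtain M where M: "\<And>t. t \<in> {a..b} \<Longrightarrow> \<bar>h t\<bar> \<le> M"
    using compact_imp_bounded[THEN bounded_iff[THEN iffD1]] by (metis image_eqI real_norm_def)
  have m: "d\<psi> \<in> borel_measurable lebesgue" "h \<in> borel_measurable lebesgue"
    using H1 borel_measurable_continuous_onI[OF h(1)]
    by (auto simp: H1_circle_def intro: measurable_completion)
  have "set_integrable lebesgue {a..b} (\<lambda>t. M * (1 + (d\<psi> t)\<^sup>2))"
    by (intro set_integrable_mult_right set_integral_add dpsi_square_integrable)
      (auto simp: set_integrable_def emeasure_lborel_Icc_eq intro!: integrable_real_indicator)
  then show ?thesis
    unfolding set_integrable_def
  proof (rule Bochner_Integration.integrable_bound)
    show "(\<lambda>t. d\<psi> t * h t) \<in> borel_measurable lebesgue" using m by (rule borel_measurable_times)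
    show "AE t in lebesgue. norm (d\<psi> t * h t) \<le> norm (indicator {a..b} t *\<^sub>R (M * (1 + (d\<psi> t)\<^sup>2)))"
    proof (rule AE_I2)
      fix t
      show "norm (d\<psi> t * h t) \<le> norm (indicator {a..b} t *\<^sub>R (M * (1 + (d\<psi> t)\<^sup>2)))"
      proof (cases "t \<in> {a..b}")
        case True
        have "2 * \<bar>d\<psi> t\<bar> \<le> 1 + (d\<psi> t)\<^sup>2"
          using sum_squares_bound[of 1 "\<bar>d\<psi> t\<bar>"] by simp
        then have "\<bar>d\<psi> t\<bar> * \<bar>h t\<bar> \<le> (1 + (d\<psi> t)\<^sup>2) * M"
          using M[OF True] by (intro mult_mono) auto
        then show ?thesis using True M[OF True] by (simp add: abs_mult mult.commute)
      qed (simp add: h(2))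
    qed
  qed
qed

text \<open>
  This is the incompressibility condition tested with \<open>g(r) h(\<theta>)\<close>.
\<close>

lemma weak_dpsi:
  assumes h: "smooth h" "\<And>t. t \<notin> {t1 - d..t1 + d} \<Longrightarrow> h t = 0" and d: "d < pi / 2"
  shows "(LINT t|lebesgue. d\<psi> t * h t) = - (LINT t|lebesgue. \<psi> t * deriv h t)"
proof -
  obtain g :: "real \<Rightarrow> real" where g: "smooth g" "\<And>r. r \<notin> {1..2} \<Longrightarrow> g r = 0" "\<And>r. 0 \<le> g r" "\<And>r. r \<in> {1<..<2} \<Longrightarrow> 0 < g r"
    using smooth_bump_exists[of 1 2] by auto
  have h': "smooth (deriv h)" "\<And>t. t \<notin> {t1 - d..t1 + d} \<Longrightarrow> deriv h t = 0"
    using smooth_real_deriv(2)[OF h(1)] smooth_deriv_zero_outside[OF h(1), of "t1 - d" "t1 + d"] h(2) by auto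
  have g': "smooth (deriv g)" "\<And>r. r \<notin> {1..2} \<Longrightarrow> deriv g r = 0"
    using smooth_real_deriv(2)[OF g(1)] smooth_deriv_zero_outside[OF g(1), of 1 2] g(2) by auto
  define I where "I = (LINT r|lebesgue. r powr (l - 1) * g r)"
  have I: "0 < I"
    unfolding I_def by (rule integral_pos_continuous[OF radial_weight(1)[OF g(1,2)], where a=1 and b=2]) (use g in auto)
  have I': "(LINT r|lebesgue. r powr l * deriv g r) = - l * I"
    unfolding I_def by (rule radial_weight(3)[OF g(1,2)]) auto
  let ?q = "polar_product g h t1"
  let ?F = "\<lambda>x. \<Sum>i\<in>UNIV. U x $ i * pd i ?q x"
  let ?ps = "[(\<lambda>r. r powr l * deriv g r, \<lambda>t. - (d\<psi> t * h t)), (\<lambda>r. r powr (l - 1) * g r, \<lambda>t. l * (\<psi> t * deriv h t))]"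
  have "test_function UNIV ?q"
    by (rule test_functionI[OF smooth_polar_product[OF g(1) h(1) g(2) _ h(2) d]
          polar_product_zero_outside[OF g(2) h(2) d] compact_polar_rectangle]) auto
  then have "0 = integral\<^sup>L lebesgue ?F"
    using euler by (simp add: weak_steady_euler_def)
  also have "\<dots> = (\<Sum>(a, b)\<leftarrow>?ps. (LINT r|lebesgue. a r) * (LINT t|lebesgue. b t))"
  proof (rule polar_integral_separable(2)[where ?t1.0 = t1])
    have hz: "h t = 0" "deriv h t = 0" if "pi \<le> \<bar>t - t1\<bar>" for t
    proof -
      have "t \<notin> {t1 - d..t1 + d}" using that d unfolding atLeastAtMost_iff by linarith
      then show "h t = 0" "deriv h t = 0" using h(2) h'(2) by auto
    qed
    show "integrable lebesgue a \<and> integrable lebesgue b" if "(a, b) \<in> set ?ps" for a b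
    proof -
      have "integrable lebesgue (\<lambda>t. \<psi> t * deriv h t)"
        by (rule integrable_continuous_compact_support(2)[of _ "t1 - d" "t1 + d"])
          (auto intro!: continuous_on_mult[OF cont_psi smooth_continuous_on[OF h'(1)]] simp: h'(2))
      with that show ?thesis
        using radial_weight(2)[OF g(1,2)] radial_weight(2)[OF g'] dpsi_mult_integrable[OF smooth_continuous_on[OF h(1)] h(2)]
        by auto
    qed
    show "a r = 0" if "(a, b) \<in> set ?ps" "r \<le> 0" for a b r
      using that g(2)[of r] g'(2)[of r] by auto
    show "b t = 0" if "(a, b) \<in> set ?ps" "pi \<le> \<bar>t - t1\<bar>" for a b t
      using that hz by auto
    show "r * ?F (r *\<^sub>R e_r t) = (\<Sum>(a, b)\<leftarrow>?ps. a r * b t)" if "0 < r" "\<bar>t - t1\<bar> < pi" for r t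
    proof -
      have cs: "(cos t)\<^sup>2 + (sin t)\<^sup>2 = 1" by simp
      have pd: "pd 1 ?q (r *\<^sub>R e_r t) = deriv g r * h t * cos t - g r * deriv h t / r * sin t"
          "pd 2 ?q (r *\<^sub>R e_r t) = deriv g r * h t * sin t + g r * deriv h t / r * cos t"
        using pd_polar_product[of g h 1 2 t1 d r t] g h  d that by auto
      have Feq: "?F (r *\<^sub>R e_r t) = (- (r powr (l - 1) * d\<psi> t)) * (deriv g r * h t)
          + (r powr (l - 1) * (l * \<psi> t)) * (g r * deriv h t / r)"
        unfolding sum_2 U_components[OF that(1)] pd
        by (rule frame_inner(1)[OF cs])
      have "r powr l = r * r powr (l - 1)" using that(1) by (simp add: powr_mult_base)
      then show ?thesis unfolding Feq using that(1) by (simp add: algebra_simps)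
    qed
  qed
  also have "\<dots> = (- l * I) * - (LINT t|lebesgue. d\<psi> t * h t) + I * (l * (LINT t|lebesgue. \<psi> t * deriv h t))"
    by (simp add: I' I_def[symmetric])
  also have "\<dots> = l * I * ((LINT t|lebesgue. d\<psi> t * h t) + (LINT t|lebesgue. \<psi> t * deriv h t))"
    by (simp add: algebra_simps)
  finally show ?thesis using I l by simp
qed

text \<open>
  Testing the curl with \<open>g(r) h(\<theta>)\<close> gives \<open>\<integral> \<psi> h'' + l\<^sup>2 \<integral> \<psi> h = I\<^sup>-\<^sup>1 \<integral> \<omega> g h\<close>, where
  \<open>I = \<integral> r\<^bsup>l-1\<^esup> g(r) dr\<close> is positive, and both the term with \<open>l\<^sup>2\<close> and the right-hand side are
  bounded by multiples of \<open>\<integral> |h|\<close>.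
\<close>

lemma weak_curl_bound:
  assumes \<omega>: "has_weak_curl_on U \<omega> V" and V: "polar_rectangle ra rb t1 d \<subseteq> V"
    and M: "\<And>x. x \<in> polar_rectangle ra rb t1 d \<Longrightarrow> \<bar>\<omega> x\<bar> \<le> M"
    and ra: "0 < ra" "ra < rb" and d: "0 < d" "d < pi / 2"
  obtains C where "0 \<le> C" "\<And>h. smooth h \<Longrightarrow> (\<And>t. t \<notin> {t1 - d..t1 + d} \<Longrightarrow> h t = 0) \<Longrightarrow>
        \<bar>LINT t|lebesgue. \<psi> t * deriv (deriv h) t\<bar> \<le> C * (LINT t|lebesgue. \<bar>h t\<bar>)"
proof -
  obtain g where g: "smooth g" "\<And>r. r \<notin> {ra..rb} \<Longrightarrow> g r = 0" "\<And>r. 0 \<le> g r" "\<And>r. r \<in> {ra<..<rb} \<Longrightarrow> 0 < g r"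
    using smooth_bump_exists[OF ra(2)] by auto
  have g': "smooth (deriv g)" "\<And>r. r \<notin> {ra..rb} \<Longrightarrow> deriv g r = 0"
    using smooth_real_deriv(2)[OF g(1)] smooth_deriv_zero_outside[OF g(1), of ra rb] g(2) by auto
  define I where "I = (LINT r|lebesgue. r powr (l - 1) * g r)"
  define w where "w r = r powr 1 * g r" for r
  define J where "J = (LINT r|lebesgue. w r)"
  have I: "0 < I"
    unfolding I_def by (rule integral_pos_continuous[OF radial_weight(1)[OF g(1,2) ra(1)], where a=ra and b=rb]) (use g ra in auto)
  have J: "0 \<le> J" unfolding J_def w_def by (intro integral_nonneg_AE) (use g in auto)
  have I': "(LINT r|lebesgue. r powr l * deriv g r) = - l * I"
    unfolding I_def by (rule radial_weight(3)[OF g(1,2) ra(1)])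
  have w: "integrable lebesgue w"
    using radial_weight(2)[of g ra rb 1] g ra by (simp add: w_def[abs_def])
  have M0: "0 \<le> M"
  proof -
    have "ra *\<^sub>R e_r t1 \<in> polar_rectangle ra rb t1 d"
      unfolding polar_rectangle_def using ra d by (intro image_eqI[of _ _ "(ra, t1)"]) auto
    from M[OF this] show ?thesis by linarith
  qed
  have "compact (\<psi> ` {t1 - d..t1 + d})" by (intro compact_continuous_image cont_psi) auto
  then obtain B where B: "\<And>t. t \<in> {t1 - d..t1 + d} \<Longrightarrow> \<bar>\<psi> t\<bar> \<le> B"
    using compact_imp_bounded[THEN bounded_iff[THEN iffD1]] by (metis image_eqI real_norm_def)
  have B0: "0 \<le> B" using B[of t1] d by auto
  have main: "\<bar>LINT t|lebesgue. \<psi> t * deriv (deriv h) t\<bar> \<le> (l\<^sup>2 * B + M * J / I) * (LINT t|lebesgue. \<bar>h t\<bar>)"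
    if h: "smooth h" "\<And>t. t \<notin> {t1 - d..t1 + d} \<Longrightarrow> h t = 0" for h
  proof -
    have h': "smooth (deriv h)" "\<And>t. t \<notin> {t1 - d..t1 + d} \<Longrightarrow> deriv h t = 0"
      using smooth_real_deriv(2)[OF h(1)] smooth_deriv_zero_outside[OF h(1), of "t1 - d" "t1 + d"] h(2) by auto
    let ?q = "polar_product g h t1"
    let ?F = "\<lambda>x. U x $ 2 * pd 1 ?q x - U x $ 1 * pd 2 ?q x"
    let ?ps = "[(\<lambda>r. r powr l * deriv g r, \<lambda>t. l * (\<psi> t * h t)), (\<lambda>r. r powr (l - 1) * g r, \<lambda>t. d\<psi> t * deriv h t)]"
    have hz: "h t = 0" "deriv h t = 0" if "pi \<le> \<bar>t - t1\<bar>" for t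
    proof -
      have "t \<notin> {t1 - d..t1 + d}" using that d unfolding atLeastAtMost_iff by linarith
      then show "h t = 0" "deriv h t = 0" using h(2) h'(2) by auto
    qed
    have int_psi: "integrable lebesgue (\<lambda>t. \<psi> t * h t)"
      by (rule integrable_continuous_compact_support(2)[of _ "t1 - d" "t1 + d"])
        (auto intro!: continuous_on_mult[OF cont_psi smooth_continuous_on[OF h(1)]] simp: h(2))
    have int_h: "integrable lebesgue (\<lambda>t. \<bar>h t\<bar>)"
      by (rule integrable_continuous_compact_support(2)[of _ "t1 - d" "t1 + d"])
        (auto intro!: continuous_on_rabs[OF smooth_continuous_on[OF h(1)]] simp: h(2))
    have curl: "integral\<^sup>L lebesgue ?F = (\<Sum>(a, b)\<leftarrow>?ps. (LINT r|lebesgue. a r) * (LINT t|lebesgue. b t))"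
    proof (rule polar_integral_separable(2)[where ?t1.0 = t1])
      show "integrable lebesgue a \<and> integrable lebesgue b" if "(a, b) \<in> set ?ps" for a b
        using that int_psi
          radial_weight(2)[OF g(1,2) ra(1)] radial_weight(2)[OF g' ra(1)]
          dpsi_mult_integrable[OF smooth_continuous_on[OF h'(1)] h'(2)]
        by auto
      show "a r = 0" if "(a, b) \<in> set ?ps" "r \<le> 0" for a b r
        using that g(2)[of r] g'(2)[of r] ra by auto
      show "b t = 0" if "(a, b) \<in> set ?ps" "pi \<le> \<bar>t - t1\<bar>" for a b t
        using that hz by auto
      show "r * ?F (r *\<^sub>R e_r t) = (\<Sum>(a, b)\<leftarrow>?ps. a r * b t)" if "0 < r" "\<bar>t - t1\<bar> < pi" for r t
      proof -
        have cs: "(cos t)\<^sup>2 + (sin t)\<^sup>2 = 1" by simp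
        have pd: "pd 1 ?q (r *\<^sub>R e_r t) = deriv g r * h t * cos t - g r * deriv h t / r * sin t"
            "pd 2 ?q (r *\<^sub>R e_r t) = deriv g r * h t * sin t + g r * deriv h t / r * cos t"
          using pd_polar_product[of g h ra rb t1 d r t] g h ra d that by auto
        have Feq: "?F (r *\<^sub>R e_r t) = (r powr (l - 1) * (l * \<psi> t)) * (deriv g r * h t)
            - (- (r powr (l - 1) * d\<psi> t)) * (g r * deriv h t / r)"
          unfolding U_components[OF that(1)] pd
          by (rule frame_inner(2)[OF cs])
        have "r powr l = r * r powr (l - 1)" using that(1) by (simp add: powr_mult_base)
        then show ?thesis unfolding Feq using that(1) by (simp add: algebra_simps)
      qed
    qed
    have weak2: "(LINT t|lebesgue. d\<psi> t * deriv h t) = - (LINT t|lebesgue. \<psi> t * deriv (deriv h) t)"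
      by (rule weak_dpsi[OF h' d(2)])
    have absq: "integrable lebesgue (\<lambda>x. \<bar>?q x\<bar>)" "(LINT x|lebesgue. \<bar>?q x\<bar>) = J * (LINT t|lebesgue. \<bar>h t\<bar>)"
    proof -
      have *: "integrable lebesgue a \<and> integrable lebesgue b" if "(a, b) \<in> set [(w, \<lambda>t. \<bar>h t\<bar>)]" for a b
        using that int_h w by auto
      have **: "r * \<bar>?q (r *\<^sub>R e_r t)\<bar> = (\<Sum>(a, b)\<leftarrow>[(w, \<lambda>t. \<bar>h t\<bar>)]. a r * b t)"
        if "0 < r" "\<bar>t - t1\<bar> < pi" for r t
        using that g(3)[of r] polar_product_polar[of t1 d h r t g] h(2) d by (simp add: abs_mult w_def)
      show "integrable lebesgue (\<lambda>x. \<bar>?q x\<bar>)" 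
        by (rule polar_integral_separable(1)[OF * _ _ **]) (use g ra hz in \<open>auto simp: w_def\<close>)
      have "(LINT x|lebesgue. \<bar>?q x\<bar>)
          = (\<Sum>(a, b)\<leftarrow>[(w, \<lambda>t. \<bar>h t\<bar>)]. (LINT r|lebesgue. a r) * (LINT t|lebesgue. b t))"
        by (rule polar_integral_separable(2)[OF * _ _ **]) (use g ra hz in \<open>auto simp: w_def\<close>)
      then show "(LINT x|lebesgue. \<bar>?q x\<bar>) = J * (LINT t|lebesgue. \<bar>h t\<bar>)" by (simp add: J_def)
    qed
    have "test_function V ?q"
      by (rule test_functionI[OF smooth_polar_product[OF g(1) h(1) g(2) ra(1) h(2) d(2)]
            polar_product_zero_outside[OF g(2) h(2) d(2)] compact_polar_rectangle V]) auto
    then have "- integral\<^sup>L lebesgue ?F = (LINT x|lebesgue. \<omega> x * ?q x)"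
      using \<omega> by (simp add: has_weak_curl_on_def)
    moreover have "integral\<^sup>L lebesgue ?F = - l * I * (l * (LINT t|lebesgue. \<psi> t * h t))
        + I * - (LINT t|lebesgue. \<psi> t * deriv (deriv h) t)"
      unfolding curl by (simp add: I' I_def[symmetric] weak2)
    ultimately have eq: "I * (LINT t|lebesgue. \<psi> t * deriv (deriv h) t)
        = (LINT x|lebesgue. \<omega> x * ?q x) - l\<^sup>2 * I * (LINT t|lebesgue. \<psi> t * h t)"
      by (simp add: algebra_simps power2_eq_square)
    have "\<bar>LINT x|lebesgue. \<omega> x * ?q x\<bar> \<le> (LINT x|lebesgue. M * \<bar>?q x\<bar>)"
    proof (cases "integrable lebesgue (\<lambda>x. \<omega> x * ?q x)")
      case True
      have "\<bar>LINT x|lebesgue. \<omega> x * ?q x\<bar> \<le> (LINT x|lebesgue. \<bar>\<omega> x * ?q x\<bar>)"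
        by (rule integral_abs_bound)
      also have "\<dots> \<le> (LINT x|lebesgue. M * \<bar>?q x\<bar>)"
      proof (rule integral_mono)
        show "\<bar>\<omega> x * ?q x\<bar> \<le> M * \<bar>?q x\<bar>" for x
          using M[of x] polar_product_zero_outside[of ra rb g t1 d h x] g(2) h(2) d(2)
          by (cases "x \<in> polar_rectangle ra rb t1 d") (auto simp: abs_mult intro: mult_right_mono)
      qed (use True absq in auto)
      finally show ?thesis .
    qed (use M0 in \<open>auto simp: not_integrable_integral_eq\<close>)
    then have b1: "\<bar>LINT x|lebesgue. \<omega> x * ?q x\<bar> \<le> M * J * (LINT t|lebesgue. \<bar>h t\<bar>)"
      using absq by simp
    have "\<bar>LINT t|lebesgue. \<psi> t * h t\<bar> \<le> (LINT t|lebesgue. \<bar>\<psi> t * h t\<bar>)"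
      by (rule integral_abs_bound)
    also have "\<dots> \<le> (LINT t|lebesgue. B * \<bar>h t\<bar>)"
    proof (rule integral_mono)
      show "\<bar>\<psi> t * h t\<bar> \<le> B * \<bar>h t\<bar>" for t
        using B[of t] h(2)[of t] by (cases "t \<in> {t1 - d..t1 + d}") (auto simp: abs_mult intro: mult_right_mono)
    qed (use int_psi int_h in auto)
    finally have b2: "\<bar>LINT t|lebesgue. \<psi> t * h t\<bar> \<le> B * (LINT t|lebesgue. \<bar>h t\<bar>)" by simp
    have "I * \<bar>LINT t|lebesgue. \<psi> t * deriv (deriv h) t\<bar>
        = \<bar>(LINT x|lebesgue. \<omega> x * ?q x) - l\<^sup>2 * I * (LINT t|lebesgue. \<psi> t * h t)\<bar>"
      using eq I by (metis abs_mult abs_of_pos)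
    also have "\<dots> \<le> \<bar>LINT x|lebesgue. \<omega> x * ?q x\<bar> + l\<^sup>2 * I * \<bar>LINT t|lebesgue. \<psi> t * h t\<bar>"
      using I by (intro order.trans[OF abs_triangle_ineq4]) (simp add: abs_mult)
    also have "\<dots> \<le> M * J * (LINT t|lebesgue. \<bar>h t\<bar>) + l\<^sup>2 * I * (B * (LINT t|lebesgue. \<bar>h t\<bar>))"
      using I by (intro add_mono b1 mult_left_mono b2) auto
    also have "\<dots> = I * ((l\<^sup>2 * B + M * J / I) * (LINT t|lebesgue. \<bar>h t\<bar>))"
      using I by (simp add: field_simps)
    finally show ?thesis using I by simp
  qed
  show ?thesis
    by (rule that[of "l\<^sup>2 * B + M * J / I"]) (use main I J M0 B0 in auto)
qed

text \<open>
  A representative that is continuous at a single point is bounded near it, hence on a small polar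
  rectangle around it. The derivative found there agrees with \<open>d\<psi>\<close> because \<^const>\<open>H1_circle\<close> fixes
  \<open>d\<psi>\<close> wherever \<open>\<psi>\<close> is differentiable.
\<close>

lemma curl_continuous_imp_local_C11:
  assumes cc: "curl_continuous_at U (r1 *\<^sub>R e_r t1)" and r1: "0 < r1"
  shows "\<exists>\<delta>>0. \<exists>L. (\<forall>t\<in>{t1 - \<delta><..<t1 + \<delta>}. (\<psi> has_real_derivative d\<psi> t) (at t)) \<and>
      (\<forall>s\<in>{t1 - \<delta><..<t1 + \<delta>}. \<forall>t\<in>{t1 - \<delta><..<t1 + \<delta>}. \<bar>d\<psi> s - d\<psi> t\<bar> \<le> L * \<bar>s - t\<bar>)"
proof -
  let ?\<xi> = "r1 *\<^sub>R e_r t1"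
  obtain V \<omega> where V: "open V" "?\<xi> \<in> V" "has_weak_curl_on U \<omega> V" "isCont \<omega> ?\<xi>"
    using cc by (auto simp: curl_continuous_at_def)
  have "(\<omega> \<longlongrightarrow> \<omega> ?\<xi>) (nhds ?\<xi>)"
    using V(4) by (simp add: isCont_def tendsto_at_iff_tendsto_nhds)
  then have "eventually (\<lambda>x. \<omega> x \<in> ball (\<omega> ?\<xi>) 1) (nhds ?\<xi>)"
    by (rule topological_tendstoD) auto
  moreover have "eventually (\<lambda>x. x \<in> V) (nhds ?\<xi>)"
    using V(1,2) by (rule eventually_nhds_in_open)
  ultimately have ev: "eventually (\<lambda>x. \<omega> x \<in> ball (\<omega> ?\<xi>) 1 \<and> x \<in> V) (nhds ?\<xi>)"
    by (rule eventually_conj)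
  have "continuous_on UNIV (\<lambda>z. fst z *\<^sub>R e_r (snd z))"
    by (intro continuous_intros continuous_on_compose2[OF continuous_on_e_r[of UNIV]]) auto
  then have "isCont (\<lambda>z. fst z *\<^sub>R e_r (snd z)) (r1, t1)"
    by (simp add: continuous_on_eq_continuous_at)
  then have "((\<lambda>z. fst z *\<^sub>R e_r (snd z)) \<longlongrightarrow> ?\<xi>) (nhds (r1, t1))"
    using tendsto_at_iff_tendsto_nhds[of "\<lambda>z. fst z *\<^sub>R e_r (snd z)" "(r1, t1)"] by (simp add: isCont_def)
  with ev have "eventually (\<lambda>z. \<omega> (fst z *\<^sub>R e_r (snd z)) \<in> ball (\<omega> ?\<xi>) 1 \<and> fst z *\<^sub>R e_r (snd z) \<in> V) (nhds (r1, t1))"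
    by (rule eventually_compose_filterlim)
  then obtain \<epsilon> where \<epsilon>: "0 < \<epsilon>" "\<And>z. dist z (r1, t1) < \<epsilon> \<Longrightarrow>
      \<omega> (fst z *\<^sub>R e_r (snd z)) \<in> ball (\<omega> ?\<xi>) 1 \<and> fst z *\<^sub>R e_r (snd z) \<in> V"
    unfolding eventually_nhds_metric by blast
  \<comment> \<open>small enough for the rectangle to stay near \<open>\<xi>\<close>, away from the origin, and within a right angle (\<open>1 < \<pi>/2\<close>)\<close>
  define d where "d = min (\<epsilon> / 3) (min (r1 / 2) 1)"
  have d: "0 < d" "d \<le> \<epsilon> / 3" "d \<le> r1 / 2" "d \<le> 1"
    using \<epsilon>(1) r1 by (auto simp: d_def)
  have "1 < pi / 2" using pi_gt3 by simp
  with d have d2: "d < pi / 2" by linarith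
  have rect: "x \<in> V \<and> \<omega> x \<in> ball (\<omega> ?\<xi>) 1" if "x \<in> polar_rectangle (r1 - d) (r1 + d) t1 d" for x
  proof -
    from that obtain r t where rt: "r \<in> {r1 - d..r1 + d}" "t \<in> {t1 - d..t1 + d}" "x = r *\<^sub>R e_r t"
      by (auto simp: polar_rectangle_def)
    have "dist (r, t) (r1, t1) \<le> \<bar>r - r1\<bar> + \<bar>t - t1\<bar>"
      by (simp add: dist_Pair_Pair dist_real_def sqrt_sum_squares_le_sum_abs)
    also have "\<dots> < \<epsilon>" using rt d \<epsilon>(1) by (auto simp: abs_if)
    finally show ?thesis using \<epsilon>(2)[of "(r, t)"] rt(3) by simp
  qed
  obtain C where C: "0 \<le> C" "\<And>h. smooth h \<Longrightarrow> (\<And>t. t \<notin> {t1 - d..t1 + d} \<Longrightarrow> h t = 0) \<Longrightarrow>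
        \<bar>LINT t|lebesgue. \<psi> t * deriv (deriv h) t\<bar> \<le> C * (LINT t|lebesgue. \<bar>h t\<bar>)"
  proof (rule weak_curl_bound[OF V(3), of "r1 - d" "r1 + d" t1 d "\<bar>\<omega> ?\<xi>\<bar> + 1"])
    show "\<bar>\<omega> x\<bar> \<le> \<bar>\<omega> ?\<xi>\<bar> + 1" if "x \<in> polar_rectangle (r1 - d) (r1 + d) t1 d" for x
      using rect[OF that] by (auto simp: dist_real_def)
  qed (use rect d d2 r1 in auto)
  obtain D K where D: "\<And>x. x \<in> {t1 - d<..<t1 + d} \<Longrightarrow> (\<psi> has_real_derivative D x) (at x)"
    "\<And>x y. x \<in> {t1 - d<..<t1 + d} \<Longrightarrow> y \<in> {t1 - d<..<t1 + d} \<Longrightarrow> \<bar>D x - D y\<bar> \<le> K * C * \<bar>x - y\<bar>"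
    using weak_second_derivative_bound_imp_C11[OF cont_psi C] by blast
  have "d\<psi> t = D t" if "t \<in> {t1 - d<..<t1 + d}" for t
    using H1 D(1)[OF that] by (auto simp: H1_circle_def)
  with D d(1) show ?thesis by (intro exI[of _ d] exI[of _ "K * C"] conjI ballI) auto
qed

text \<open>
  The test field is \<open>\<phi> = g(r) k'(\<theta>) x + f(r) k(\<theta>) x\<^sup>\<bottom>\<close>, which is a rotated gradient of a function of
  the form \<open>G(r) k(\<theta>)\<close>. Its divergence is \<open>(r g' + 2 g + f) k'\<close>, so \<open>f = - (r g' + 2 g)\<close> makes it
  vanish identically, and the pressure drops out pointwise. The
  terms with \<open>f\<close> then combine to a multiple of \<open>\<integral> (\<psi>\<^sup>2 k)' = 0\<close>.
\<close>

lemma weak_momentum: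
  assumes C1: "\<And>t. (\<psi> has_real_derivative d\<psi> t) (at t)" "continuous_on UNIV d\<psi>"
    and k: "smooth k" "\<And>t. t \<notin> {t1 - d..t1 + d} \<Longrightarrow> k t = 0" and d: "d < pi / 2"
  shows "(LINT t|lebesgue. ((1 - 2 * l) * (d\<psi> t)\<^sup>2 + l\<^sup>2 * (\<psi> t)\<^sup>2) * deriv k t
      - l * \<psi> t * d\<psi> t * deriv (deriv k) t) = 0"
proof -
  obtain g :: "real \<Rightarrow> real" where g: "smooth g" "\<And>r. r \<notin> {1..2} \<Longrightarrow> g r = 0" "\<And>r. 0 \<le> g r" "\<And>r. r \<in> {1<..<2} \<Longrightarrow> 0 < g r"
    using smooth_bump_exists[of 1 2] by auto
  have k1: "smooth (deriv k)" "\<And>r. r \<notin> {t1 - d..t1 + d} \<Longrightarrow> deriv k r = 0"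
    using smooth_real_deriv(2)[OF k(1)] smooth_deriv_zero_outside[OF k(1), of "t1 - d" "t1 + d"] k(2) by auto
  have k2: "smooth (deriv (deriv k))" "\<And>r. r \<notin> {t1 - d..t1 + d} \<Longrightarrow> deriv (deriv k) r = 0"
    using smooth_real_deriv(2)[OF k1(1)] smooth_deriv_zero_outside[OF k1(1), of "t1 - d" "t1 + d"] k1(2) by auto
  have g1: "smooth (deriv g)" "\<And>r. r \<notin> {1..2} \<Longrightarrow> deriv g r = 0"
    using smooth_real_deriv(2)[OF g(1)] smooth_deriv_zero_outside[OF g(1), of 1 2] g(2) by auto
  define f where "f r = (-1) * (r * deriv g r + 2 * g r)" for r
  have f: "smooth f" "\<And>r. r \<notin> {1..2} \<Longrightarrow> f r = 0"
  proof -
    show "smooth f"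
      unfolding f_def by (intro smooth_mult smooth_add smooth_const smooth_real_id g g1)
    show "f r = 0" if "r \<notin> {1..2}" for r
      using g(2)[OF that] g1(2)[OF that] by (simp add: f_def)
  qed
  have f1: "smooth (deriv f)" "\<And>r. r \<notin> {1..2} \<Longrightarrow> deriv f r = 0"
    using smooth_real_deriv(2)[OF f(1)] smooth_deriv_zero_outside[OF f(1), of 1 2] f(2) by auto
  define I where "I = (LINT r|lebesgue. r powr (2 * l - 1) * g r)"
  define J where "J = (LINT r|lebesgue. r powr (2 * l - 1) * f r)"
  have I: "0 < I"
    unfolding I_def by (rule integral_pos_continuous[OF radial_weight(1)[OF g(1,2)], where a=1 and b=2]) (use g in auto)
  have I': "(LINT r|lebesgue. r powr (2 * l) * deriv g r) = - (2 * l) * I"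
    unfolding I_def by (rule radial_weight(3)[OF g(1,2)]) auto
  have J': "(LINT r|lebesgue. r powr (2 * l) * deriv f r) = - (2 * l) * J"
    unfolding J_def by (rule radial_weight(3)[OF f]) auto
  define q1 where "q1 = polar_product g (deriv k) t1"
  define q2 where "q2 = polar_product f k t1"
  have sq: "smooth q1" "smooth q2"
    unfolding q1_def q2_def
    using smooth_polar_product[of g "deriv k" 1 2 t1 d] smooth_polar_product[of f k 1 2 t1 d] g f k k1 d by auto
  have zq: "q1 x = 0" "q2 x = 0" if "x \<notin> polar_rectangle 1 2 t1 d" for x
    unfolding q1_def q2_def
    using polar_product_zero_outside[of 1 2 g t1 d "deriv k" x] polar_product_zero_outside[of 1 2 f t1 d k x]
      g f k k1 d that by auto
  define \<phi> :: "real^2 \<Rightarrow> real^2" where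
    "\<phi> x = vector [q1 x * x$1 - q2 x * x$2, q1 x * x$2 + q2 x * x$1]" for x
  have \<phi>_nth: "\<phi> x $ 1 = q1 x * x$1 - q2 x * x$2" "\<phi> x $ 2 = q1 x * x$2 + q2 x * x$1" for x
    by (simp_all add: \<phi>_def)
  have nth_smooth: "smooth (\<lambda>x::real^2. x $ i)" for i
    using smooth_inner[of "axis i 1 :: real^2"] by (simp add: inner_axis)
  have tf: "test_function UNIV (\<lambda>x. \<phi> x $ i)" for i
  proof (rule test_functionI[OF _ _ compact_polar_rectangle])
    have i: "i = 1 \<or> i = 2" using exhaust_2 by blast
    then show "smooth (\<lambda>x. \<phi> x $ i)"
      by (auto simp: \<phi>_nth intro!: smooth_add smooth_diff smooth_mult sq nth_smooth)
    show "\<phi> x $ i = 0" if "x \<notin> polar_rectangle 1 2 t1 d" for x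
      using i zq[OF that] by (auto simp: \<phi>_nth)
  qed auto
  have pd_\<phi>: "pd j (\<lambda>y. \<phi> y $ 1) x = pd j q1 x * x$1 + q1 x * (axis j 1 $ 1) - (pd j q2 x * x$2 + q2 x * (axis j 1 $ 2))"
    "pd j (\<lambda>y. \<phi> y $ 2) x = pd j q1 x * x$2 + q1 x * (axis j 1 $ 2) + (pd j q2 x * x$1 + q2 x * (axis j 1 $ 1))" for j x
  proof -
    obtain D1 D2 where D: "(q1 has_derivative D1) (at x)" "(q2 has_derivative D2) (at x)"
      using smooth_differentiable[OF sq(1), of x] smooth_differentiable[OF sq(2), of x]
      by (auto simp: differentiable_def)
    have nth: "((\<lambda>y::real^2. y $ i) has_derivative (\<lambda>h. h $ i)) (at x)" for i
      by (rule bounded_linear_imp_has_derivative[OF bounded_linear_vec_nth])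
    have "((\<lambda>y. \<phi> y $ 1) has_derivative (\<lambda>h. q1 x * h$1 + D1 h * x$1 - (q2 x * h$2 + D2 h * x$2))) (at x)"
      unfolding \<phi>_nth by (intro has_derivative_diff has_derivative_mult D nth)
    moreover have "((\<lambda>y. \<phi> y $ 2) has_derivative (\<lambda>h. q1 x * h$2 + D1 h * x$2 + (q2 x * h$1 + D2 h * x$1))) (at x)"
      unfolding \<phi>_nth by (intro has_derivative_add has_derivative_mult D nth)
    ultimately show "pd j (\<lambda>y. \<phi> y $ 1) x = pd j q1 x * x$1 + q1 x * (axis j 1 $ 1) - (pd j q2 x * x$2 + q2 x * (axis j 1 $ 2))"
      "pd j (\<lambda>y. \<phi> y $ 2) x = pd j q1 x * x$2 + q1 x * (axis j 1 $ 2) + (pd j q2 x * x$1 + q2 x * (axis j 1 $ 1))"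
      by (simp_all add: partial_deriv_eq D[THEN partial_deriv_eq])
  qed
  let ?F = "\<lambda>x. (\<Sum>i\<in>UNIV. \<Sum>j\<in>UNIV. U x $ i * U x $ j * pd j (\<lambda>y. \<phi> y $ i) x)
           + p x * (\<Sum>i\<in>UNIV. pd i (\<lambda>y. \<phi> y $ i) x)"
  define b1 where "b1 t = (d\<psi> t)\<^sup>2 * deriv k t" for t
  define b2 where "b2 t = ((d\<psi> t)\<^sup>2 + l\<^sup>2 * (\<psi> t)\<^sup>2) * deriv k t - l * \<psi> t * d\<psi> t * deriv (deriv k) t" for t
  define b3 where "b3 t = l * \<psi> t * d\<psi> t * k t" for t
  define b4 where "b4 t = l\<^sup>2 * (\<psi> t)\<^sup>2 * deriv k t" for t
  let ?ps = "[(\<lambda>r. r powr (2 * l) * deriv g r, b1), (\<lambda>r. r powr (2 * l - 1) * g r, b2),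
      (\<lambda>r. r powr (2 * l) * deriv f r, \<lambda>t. - b3 t), (\<lambda>r. r powr (2 * l - 1) * f r, b4)]"
  have bz: "b1 t = 0" "b2 t = 0" "b3 t = 0" "b4 t = 0" if "t \<notin> {t1 - d..t1 + d}" for t
    using k(2)[OF that] k1(2)[OF that] k2(2)[OF that] by (auto simp: b1_def b2_def b3_def b4_def)
  note kc = smooth_continuous_on[OF k(1), of UNIV] smooth_continuous_on[OF k1(1), of UNIV] smooth_continuous_on[OF k2(1), of UNIV]
  have bc: "continuous_on UNIV b1" "continuous_on UNIV b2" "continuous_on UNIV b3" "continuous_on UNIV b4"
    unfolding b1_def b2_def b3_def b4_def
    by (intro continuous_intros cont_psi C1(2) kc)+
  note bi = integrable_continuous_compact_support(2)[OF bc(1) bz(1)]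
    integrable_continuous_compact_support(2)[OF bc(2) bz(2)]
    integrable_continuous_compact_support(2)[OF bc(3) bz(3)]
    integrable_continuous_compact_support(2)[OF bc(4) bz(4)]
  have "0 = integral\<^sup>L lebesgue ?F"
    using euler tf by (simp add: weak_steady_euler_def)
  also have "\<dots> = (\<Sum>(a, b)\<leftarrow>?ps. (LINT r|lebesgue. a r) * (LINT t|lebesgue. b t))"
  proof (rule polar_integral_separable(2)[where ?t1.0 = t1])
    show "integrable lebesgue a \<and> integrable lebesgue b" if "(a, b) \<in> set ?ps" for a b
      using that bi radial_weight(2)[OF g(1,2)] radial_weight(2)[OF g1] radial_weight(2)[OF f] radial_weight(2)[OF f1]
      by auto
    show "a r = 0" if "(a, b) \<in> set ?ps" "r \<le> 0" for a b r
      using that g(2)[of r] g1(2)[of r] f(2)[of r] f1(2)[of r] by auto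
    show "b t = 0" if "(a, b) \<in> set ?ps" "pi \<le> \<bar>t - t1\<bar>" for a b t
    proof -
      have "t \<notin> {t1 - d..t1 + d}" using that d unfolding atLeastAtMost_iff by linarith
      from bz[OF this] that show ?thesis by auto
    qed
    show "r * ?F (r *\<^sub>R e_r t) = (\<Sum>(a, b)\<leftarrow>?ps. a r * b t)" if rt: "0 < r" "\<bar>t - t1\<bar> < pi" for r t
    proof -
      have cs: "(cos t)\<^sup>2 + (sin t)\<^sup>2 = 1" by simp
      have q1v: "q1 (r *\<^sub>R e_r t) = g r * deriv k t"
        unfolding q1_def using polar_product_polar[of t1 d "deriv k" r t g] k1 d rt by auto
      have q2v: "q2 (r *\<^sub>R e_r t) = f r * k t"
        unfolding q2_def using polar_product_polar[of t1 d k r t f] k d rt by auto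
      have q1d: "pd 1 q1 (r *\<^sub>R e_r t) = deriv g r * deriv k t * cos t - g r * deriv (deriv k) t / r * sin t"
          "pd 2 q1 (r *\<^sub>R e_r t) = deriv g r * deriv k t * sin t + g r * deriv (deriv k) t / r * cos t"
        using pd_polar_product[of g "deriv k" 1 2 t1 d r t] g k1  d rt by (auto simp: q1_def)
      have q2d: "pd 1 q2 (r *\<^sub>R e_r t) = deriv f r * k t * cos t - f r * deriv k t / r * sin t"
          "pd 2 q2 (r *\<^sub>R e_r t) = deriv f r * k t * sin t + f r * deriv k t / r * cos t"
        using pd_polar_product[of f k 1 2 t1 d r t] f k  d rt by (auto simp: q2_def)
      note T1 = frame_tensor(1)[OF cs U_components[OF rt(1)] q1d q2d, where r = r
          and ?Q1.0 = "g r * deriv k t" and ?Q2.0 = "f r * k t"]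
      note T2 = frame_tensor(2)[OF cs U_components[OF rt(1)] q1d q2d, where r = r and ?Q1.0 = "g r * deriv k t"]
      let ?P = "r powr (l - 1)"
      let ?u = "- (?P * d\<psi> t)" and ?v = "?P * (l * \<psi> t)"
      have div: "r * (deriv g r * deriv k t) + 2 * (g r * deriv k t) + r * (f r * deriv k t / r) = 0"
      proof -
        have "r * (f r * deriv k t / r) = f r * deriv k t" using rt(1) by simp
        then show ?thesis by (simp only: f_def) (simp add: algebra_simps)
      qed
      have Feq: "?F (r *\<^sub>R e_r t) = r * ?u * (?u * (deriv g r * deriv k t) + ?v * (g r * deriv (deriv k) t / r))
          + g r * deriv k t * (?u\<^sup>2 + ?v\<^sup>2) + r * ?v * (?u * (deriv f r * k t) + ?v * (f r * deriv k t / r))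
          + p (r *\<^sub>R e_r t) * 0"
        unfolding sum_2 pd_\<phi> q1v q2v T1[symmetric] div[symmetric] T2[symmetric]
        by (simp add: axis_def)
      have P1: "r powr (2 * l - 1) = ?P\<^sup>2 * r"
      proof -
        have "?P\<^sup>2 * r = r powr (l - 1) * r powr (l - 1) * r powr 1"
          using rt(1) by (simp add: power2_eq_square)
        also have "\<dots> = r powr (2 * l - 1)" by (simp only: powr_add[symmetric]) simp
        finally show ?thesis ..
      qed
      have P2: "r powr (2 * l) = ?P\<^sup>2 * r * r"
      proof -
        have "r powr (2 * l) = r powr (2 * l - 1) * r powr 1" by (simp only: powr_add[symmetric]) simp
        then show ?thesis unfolding P1 using rt(1) by simp
      qed
      have expand: "r * (r * - (P * x) * (- (P * x) * (g' * k1) + P * (l * y) * (g0 * k2 / r))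
            + g0 * k1 * ((- (P * x))\<^sup>2 + (P * (l * y))\<^sup>2)
            + r * (P * (l * y)) * (- (P * x) * (f' * k0) + P * (l * y) * (f0 * k1 / r)) + z * 0)
          = P\<^sup>2 * r * r * g' * (x\<^sup>2 * k1) + (P\<^sup>2 * r * g0 * ((x\<^sup>2 + l\<^sup>2 * y\<^sup>2) * k1 - l * y * x * k2)
            + (P\<^sup>2 * r * r * f' * - (l * y * x * k0) + P\<^sup>2 * r * f0 * (l\<^sup>2 * y\<^sup>2 * k1)))"
        for P x y g' g0 f' f0 k0 k1 k2 z :: real
        using rt(1) by (simp add: field_simps power2_eq_square)
      show ?thesis
        unfolding Feq by (simp only: list.map sum_list.Cons sum_list.Nil prod.case add_0_right P1 P2 b1_def b2_def b3_def b4_def expand)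
    qed
  qed
  also have "\<dots> = - (2 * l) * I * integral\<^sup>L lebesgue b1 + (I * integral\<^sup>L lebesgue b2
      + (- (2 * l) * J * - integral\<^sup>L lebesgue b3 + J * integral\<^sup>L lebesgue b4))"
    by (simp add: I' J' I_def[symmetric] J_def[symmetric])
  also have "\<dots> = - 2 * l * I * integral\<^sup>L lebesgue b1 + I * integral\<^sup>L lebesgue b2
      + J * (2 * l * integral\<^sup>L lebesgue b3 + integral\<^sup>L lebesgue b4)"
    by (simp add: algebra_simps)
  also have "2 * l * integral\<^sup>L lebesgue b3 + integral\<^sup>L lebesgue b4 = 0"
  proof -
    have "2 * l * integral\<^sup>L lebesgue b3 + integral\<^sup>L lebesgue b4 = (LINT t|lebesgue. 2 * l * b3 t + b4 t)"
      using bi by simp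
    also have "\<dots> = 0"
    proof (rule integral_derivative_compact_support(2))
      show "((\<lambda>t. l\<^sup>2 * (\<psi> t)\<^sup>2 * k t) has_real_derivative 2 * l * b3 t + b4 t) (at t)" for t
        unfolding b3_def b4_def
        by (auto intro!: derivative_eq_intros C1(1) smooth_real_deriv(1)[OF k(1)] simp: power2_eq_square algebra_simps)
      show "continuous_on UNIV (\<lambda>t. 2 * l * b3 t + b4 t)" by (intro continuous_intros bc)
      show "l\<^sup>2 * (\<psi> t)\<^sup>2 * k t = 0" if "t \<notin> {t1 - d..t1 + d}" for t using k(2)[OF that] by simp
    qed
    finally show ?thesis .
  qed
  finally have "integral\<^sup>L lebesgue b2 - 2 * l * integral\<^sup>L lebesgue b1 = 0"
    using I by (simp add: algebra_simps)
  moreover have "integral\<^sup>L lebesgue b2 - 2 * l * integral\<^sup>L lebesgue b1 = (LINT t|lebesgue. b2 t - 2 * l * b1 t)"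
    using bi by simp
  moreover have "b2 t - 2 * l * b1 t = ((1 - 2 * l) * (d\<psi> t)\<^sup>2 + l\<^sup>2 * (\<psi> t)\<^sup>2) * deriv k t
      - l * \<psi> t * d\<psi> t * deriv (deriv k) t" for t
    by (simp add: b1_def b2_def algebra_simps)
  ultimately show ?thesis by simp
qed

end

text \<open>
  With \<open>w = l \<psi> \<psi>'\<close> and an antiderivative \<open>F\<close> of the continuous function \<open>E\<close>, the weak momentum
  equation says \<open>\<integral> (F + w) k'' = 0\<close> for all \<open>k\<close> with small support. So \<open>F + w\<close> is affine near each
  angle, hence everywhere with a single slope \<open>c\<close>.
\<close>

lemma (in homogeneous_flow) first_integral:
  assumes C1: "\<And>t. (\<psi> has_real_derivative d\<psi> t) (at t)" "continuous_on UNIV d\<psi>"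
  obtains c where "\<And>t. ((\<lambda>t. l * \<psi> t * d\<psi> t) has_real_derivative
      c + (2 * l - 1) * (d\<psi> t)\<^sup>2 - l\<^sup>2 * (\<psi> t)\<^sup>2) (at t)"
proof -
  define E where "E t = (1 - 2 * l) * (d\<psi> t)\<^sup>2 + l\<^sup>2 * (\<psi> t)\<^sup>2" for t
  have cE: "continuous_on UNIV E"
    unfolding E_def by (intro continuous_intros C1(2) cont_psi)
  have "\<exists>F. \<forall>x::real. -\<infinity> < ereal x \<longrightarrow> ereal x < \<infinity> \<longrightarrow> (F has_vector_derivative E x) (at x)"
    by (rule einterval_antiderivative) (use cE in \<open>auto simp: continuous_on_eq_continuous_at\<close>)
  then obtain F where F: "\<And>t. (F has_real_derivative E t) (at t)"
    by (auto simp: has_real_derivative_iff_has_vector_derivative)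
  have cF: "continuous_on UNIV F"
    using F by (intro continuous_at_imp_continuous_on ballI DERIV_isCont) auto
  define f where "f t = F t + l * \<psi> t * d\<psi> t" for t
  have cf: "continuous_on UNIV f"
    unfolding f_def by (intro continuous_intros C1(2) cont_psi cF)
  have loc: "\<exists>D. \<forall>t\<in>{t1 - 1<..<t1 + 1}. (f has_real_derivative D) (at t)" for t1
  proof -
    have weak: "\<bar>LINT t|lebesgue. f t * deriv (deriv k) t\<bar> \<le> 0 * (LINT t|lebesgue. \<bar>k t\<bar>)"
      if k: "smooth k" "\<And>t. t \<notin> {t1 - 1..t1 + 1} \<Longrightarrow> k t = 0" for k
    proof -
      have k1: "smooth (deriv k)" "\<And>r. r \<notin> {t1 - 1..t1 + 1} \<Longrightarrow> deriv k r = 0"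
        using smooth_real_deriv(2)[OF k(1)] smooth_deriv_zero_outside[OF k(1), of "t1 - 1" "t1 + 1"] k(2) by auto
      have k2: "smooth (deriv (deriv k))" "\<And>r. r \<notin> {t1 - 1..t1 + 1} \<Longrightarrow> deriv (deriv k) r = 0"
        using smooth_real_deriv(2)[OF k1(1)] smooth_deriv_zero_outside[OF k1(1), of "t1 - 1" "t1 + 1"] k1(2) by auto
      note kc = smooth_continuous_on[OF k1(1), of UNIV] smooth_continuous_on[OF k2(1), of UNIV]
      define A where "A t = E t * deriv k t + F t * deriv (deriv k) t" for t
      define B where "B t = E t * deriv k t - l * \<psi> t * d\<psi> t * deriv (deriv k) t" for t
      have cA: "continuous_on UNIV A" "continuous_on UNIV B"
        unfolding A_def B_def by (intro continuous_intros kc cE cF C1(2) cont_psi)+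
      have zA: "A t = 0" "B t = 0" if "t \<notin> {t1 - 1..t1 + 1}" for t
        using k1(2)[OF that] k2(2)[OF that] by (auto simp: A_def B_def)
      have iA: "integrable lebesgue A" "integrable lebesgue B"
        using integrable_continuous_compact_support(2)[OF cA(1), of "t1 - 1" "t1 + 1"]
          integrable_continuous_compact_support(2)[OF cA(2), of "t1 - 1" "t1 + 1"] zA by auto
      have "1 < pi / 2" using pi_gt3 by simp
      then have B0: "integral\<^sup>L lebesgue B = 0"
        using weak_momentum[OF C1 k, of t1 1] k by (simp add: B_def[abs_def] E_def)
      have A0: "integral\<^sup>L lebesgue A = 0"
      proof (rule integral_derivative_compact_support(2)[OF _ cA(1)])
        show "((\<lambda>t. F t * deriv k t) has_real_derivative A t) (at t)" for t
          unfolding A_def by (auto intro!: derivative_eq_intros F smooth_real_deriv(1)[OF k1(1)])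
        show "F t * deriv k t = 0" if "t \<notin> {t1 - 1..t1 + 1}" for t using k1(2)[OF that] by simp
      qed
      have "(LINT t|lebesgue. f t * deriv (deriv k) t) = (LINT t|lebesgue. A t - B t)"
        by (intro Bochner_Integration.integral_cong) (auto simp: f_def A_def B_def algebra_simps)
      then show ?thesis using iA A0 B0 by simp
    qed
    obtain D K where D: "\<And>x. x \<in> {t1 - 1<..<t1 + 1} \<Longrightarrow> (f has_real_derivative D x) (at x)"
      "\<And>x y. x \<in> {t1 - 1<..<t1 + 1} \<Longrightarrow> y \<in> {t1 - 1<..<t1 + 1} \<Longrightarrow> \<bar>D x - D y\<bar> \<le> K * 0 * \<bar>x - y\<bar>"
      using weak_second_derivative_bound_imp_C11[OF cf order_refl weak] by blast
    have "D x = D t1" if "x \<in> {t1 - 1<..<t1 + 1}" for x using D(2)[OF that, of t1] by simp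
    with D(1) show ?thesis by metis
  qed
  have der_f: "(f has_real_derivative deriv f t) (at t)" for t
    using loc[of t] by (metis DERIV_imp_deriv add.commute diff_add_cancel greaterThanLessThan_iff less_add_one less_diff_eq)
  have "(deriv f has_real_derivative 0) (at t)" for t
  proof -
    obtain D where D: "\<And>s. s \<in> {t - 1<..<t + 1} \<Longrightarrow> (f has_real_derivative D) (at s)" using loc by blast
    have "((\<lambda>_. D) has_real_derivative 0) (at t)" by simp
    then show ?thesis
      by (rule has_field_derivative_transform_within_open[where S="{t - 1<..<t + 1}"])
        (use D in \<open>auto intro: DERIV_imp_deriv[symmetric]\<close>)
  qed
  then have "deriv f t = deriv f 0" for t by (intro DERIV_isconst_all) auto
  with der_f have df: "(f has_real_derivative deriv f 0) (at t)" for t by metis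
  show ?thesis
  proof (rule that[of "deriv f 0"])
    fix t
    have "((\<lambda>t. f t - F t) has_real_derivative deriv f 0 - E t) (at t)"
      by (intro DERIV_diff df F)
    then show "((\<lambda>t. l * \<psi> t * d\<psi> t) has_real_derivative deriv f 0 + (2 * l - 1) * (d\<psi> t)\<^sup>2 - l\<^sup>2 * (\<psi> t)\<^sup>2) (at t)"
      by (simp add: f_def E_def algebra_simps)
  qed
qed

section \<open>Rigidity of the angular profile\<close>

text \<open>
  On a nodal interval \<open>H' = 2 \<gamma> (y'/y) H\<close> with \<open>\<gamma> = (l - 1)/l\<close>, so \<open>G = H (y\<^sup>2)\<^bsup>-\<gamma>\<^esup>\<close> is constant there.
  At its left end point \<open>z\<close>, where \<open>y\<close> has a simple zero, \<open>H\<close> vanishes at least linearly because \<open>y'\<close>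
  is Lipschitz, while \<open>(y\<^sup>2)\<^bsup>-\<gamma>\<^esup>\<close> grows like \<open>|t - z|\<^bsup>-2\<gamma>\<^esup>\<close> with \<open>2 \<gamma> < 1\<close>; the last inequality is
  equivalent to \<open>l < 2\<close>. So \<open>G\<close> tends to \<open>0\<close> at \<open>z\<close> and is identically \<open>0\<close>.
\<close>

lemma nodal_integral_vanishes:
  fixes y y' :: "real \<Rightarrow> real"
  assumes l: "1 < l" "l < 2"
    and der: "\<And>t. (y has_real_derivative y' t) (at t)"
    and lip: "\<And>t. \<exists>\<delta>>0. \<exists>L. \<forall>r\<in>{t - \<delta><..<t + \<delta>}. \<forall>s\<in>{t - \<delta><..<t + \<delta>}. \<bar>y' r - y' s\<bar> \<le> L * \<bar>r - s\<bar>"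
    and W: "\<And>t. ((\<lambda>t. l * y t * y' t) has_real_derivative c + (2 * l - 1) * (y' t)\<^sup>2 - l\<^sup>2 * (y t)\<^sup>2) (at t)"
    and cy': "\<And>t. isCont y' t"
    and zero: "\<And>z. y z = 0 \<Longrightarrow> c = - (l - 1) * (y' z)\<^sup>2" and c: "c \<noteq> 0"
    and left: "\<exists>z0\<le>t. y z0 = 0"
    and dy': "\<And>t. y t \<noteq> 0 \<Longrightarrow> (y' has_real_derivative (c + (l - 1) * (y' t)\<^sup>2 - l\<^sup>2 * (y t)\<^sup>2) / (l * y t)) (at t)"
  shows "(y' t)\<^sup>2 + l\<^sup>2 * (y t)\<^sup>2 + c / (l - 1) = 0"
proof -
  define H where "H t = (y' t)\<^sup>2 + l\<^sup>2 * (y t)\<^sup>2 + c / (l - 1)" for t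
  define \<gamma> where "\<gamma> = (l - 1) / l"
  have \<gamma>: "0 < \<gamma>" "\<gamma> < 1 / 2" using l by (auto simp: \<gamma>_def field_simps)
  have Hz: "H z = 0" if "y z = 0" for z
  proof -
    have "c / (l - 1) = - (y' z)\<^sup>2" using zero[OF that] l by (simp add: field_simps)
    then show ?thesis using that by (simp add: H_def)
  qed
  have cy: "continuous_on S y" for S
    using der by (intro continuous_at_imp_continuous_on ballI DERIV_isCont) auto
  define G where "G t = H t * (y t)\<^sup>2 powr (- \<gamma>)" for t
  have dG: "(G has_real_derivative 0) (at s)" if ys: "y s \<noteq> 0" for s
  proof -
    let ?y2 = "(c + (l - 1) * (y' s)\<^sup>2 - l\<^sup>2 * (y s)\<^sup>2) / (l * y s)"
    have pos: "0 < (y s)\<^sup>2" using ys by simp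
    have dH: "(H has_real_derivative 2 * y' s * (?y2 + l\<^sup>2 * y s)) (at s)"
      unfolding H_def by (auto intro!: derivative_eq_intros der dy'[OF ys] simp: power2_eq_square algebra_simps)
    have "((\<lambda>t. (y t)\<^sup>2) has_real_derivative 2 * y s * y' s) (at s)"
      by (auto intro!: derivative_eq_intros der)
    then have "((\<lambda>t. (y t)\<^sup>2 powr (- \<gamma>)) has_real_derivative (- \<gamma>) * (y s)\<^sup>2 powr (- \<gamma> - 1) * (2 * y s * y' s)) (at s)"
      using DERIV_fun_powr[of "\<lambda>t. (y t)\<^sup>2" _ s "- \<gamma>"] pos by (simp add: powr_diff)
    from DERIV_mult[OF dH this]
    have dG: "(G has_real_derivative 2 * y' s * (?y2 + l\<^sup>2 * y s) * (y s)\<^sup>2 powr (- \<gamma>)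
        + (- \<gamma>) * (y s)\<^sup>2 powr (- \<gamma> - 1) * (2 * y s * y' s) * H s) (at s)"
      by (simp add: G_def[abs_def])
    have "(y s)\<^sup>2 powr (- \<gamma> - 1) = (y s)\<^sup>2 powr (- \<gamma>) / (y s)\<^sup>2"
      using pos by (simp add: powr_diff)
    moreover have "?y2 + l\<^sup>2 * y s = \<gamma> * H s / y s"
      using ys l by (simp add: H_def \<gamma>_def field_simps power2_eq_square)
    moreover have "2 * p * (\<gamma> * h / Y) * q + (- \<gamma>) * (q / Y\<^sup>2) * (2 * Y * p) * h = 0" if "Y \<noteq> 0" for p h q Y :: real
      using that by (simp add: field_simps power2_eq_square)
    ultimately show ?thesis using dG ys by simp
  qed
  have "H t = 0"
  proof (cases "y t = 0")
    case False
    obtain z0 where z0: "z0 \<le> t" "y z0 = 0" using left by blast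
    let ?Z = "{s \<in> {z0..t}. y s = 0}"
    have "closed ?Z"
      using continuous_closed_preimage_constant[OF cy[of "{z0..t}"], of 0] by simp
    then have cZ: "compact ?Z"
      by (auto simp: compact_eq_bounded_closed intro: bounded_subset[of "{z0..t}"])
    have "?Z \<noteq> {}" using z0 by auto
    with compact_attains_sup[OF cZ] obtain z where z: "z \<in> ?Z" "\<And>s. s \<in> ?Z \<Longrightarrow> s \<le> z"
      by blast
    have zt: "z < t" using z(1) False by (cases "z = t") auto
    have nz: "y s \<noteq> 0" if "s \<in> {z<..t}" for s
      using z(1) z(2)[of s] that by auto
    have Gc: "G s = G t" if "s \<in> {z<..t}" for s
    proof -
      have "\<exists>k. \<forall>x\<in>{z<..t}. G x = k"
        by (rule has_field_derivative_zero_constant)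
          (auto intro!: has_field_derivative_at_within dG nz)
      with that zt show ?thesis by auto
    qed
    obtain \<delta> L where \<delta>: "0 < \<delta>" and L: "\<And>r s. r \<in> {z - \<delta><..<z + \<delta>} \<Longrightarrow> s \<in> {z - \<delta><..<z + \<delta>} \<Longrightarrow> \<bar>y' r - y' s\<bar> \<le> L * \<bar>r - s\<bar>"
      using lip[of z] by blast
    have yz: "y z = 0" using z(1) by simp
    have y'z: "y' z \<noteq> 0" using zero[OF yz] c by auto
    have lim_q: "((\<lambda>s. y s / (s - z)) \<longlongrightarrow> y' z) (at_right z)"
      using der[of z] yz by (auto simp: has_field_derivative_iff intro: tendsto_within_subset)
    have lim_y': "(y' \<longlongrightarrow> y' z) (at_right z)"
      using cy'[of z] unfolding isCont_def by (rule tendsto_within_subset) simp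
    have lim_y: "(y \<longlongrightarrow> 0) (at_right z)"
      using DERIV_isCont[OF der[of z]] yz unfolding isCont_def by (metis tendsto_within_subset subset_UNIV)
    \<comment> \<open>an upper bound for \<open>|G|\<close>, from \<open>G = (H / (s - z)) ((y / (s - z))\<^sup>2)\<^bsup>-\<gamma>\<^esup> (s - z)\<^bsup>1-2\<gamma>\<^esup>\<close>, where the first factor is
      only bounded, the second converges, and the third tends to \<open>0\<close>\<close>
    define R where "R s = (L * \<bar>y' s + y' z\<bar> + l\<^sup>2 * \<bar>y s * (y s / (s - z))\<bar>)
        * ((y s / (s - z))\<^sup>2 powr (- \<gamma>) * (s - z) powr (1 - 2 * \<gamma>))" for s
    have "(R \<longlongrightarrow> (L * \<bar>y' z + y' z\<bar> + l\<^sup>2 * \<bar>0 * y' z\<bar>) * ((y' z)\<^sup>2 powr (- \<gamma>) * 0)) (at_right z)"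
      unfolding R_def
    proof (intro tendsto_intros lim_q lim_y' lim_y)
      have "((\<lambda>s. (s - z) powr (1 - 2 * \<gamma>)) \<longlongrightarrow> 0 powr (1 - 2 * \<gamma>)) (at_right z)"
      proof (rule tendsto_powr')
        show "((\<lambda>s. s - z) \<longlongrightarrow> 0) (at_right z)"
          using tendsto_diff[OF tendsto_ident_at[of z "{z<..}"] tendsto_const[of z]] by simp
        show "0 \<noteq> (0::real) \<or> 0 < 1 - 2 * \<gamma> \<and> (\<forall>\<^sub>F s in at_right z. 0 \<le> s - z)"
          using \<gamma> by (auto simp: eventually_at_right_field intro!: exI[of _ "z + 1"])
      qed simp
      then show "((\<lambda>s. (s - z) powr (1 - 2 * \<gamma>)) \<longlongrightarrow> 0) (at_right z)" by simp
    qed (use y'z in auto)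
    then have limR: "(R \<longlongrightarrow> 0) (at_right z)" by simp
    have "eventually (\<lambda>s. s \<in> {z<..<min t (z + \<delta>)}) (at_right z)"
      by (rule eventually_at_right_real) (use zt \<delta> in auto)
    then have "eventually (\<lambda>s. \<bar>G t\<bar> \<le> R s) (at_right z)"
    proof eventually_elim
      case (elim s)
      then have s: "z < s" "s < t" "s < z + \<delta>" by auto
      define h where "h = s - z"
      have h: "0 < h" using s by (simp add: h_def)
      have "H s = (y' s - y' z) * (y' s + y' z) + l\<^sup>2 * (y s)\<^sup>2"
        using Hz[OF yz] yz by (simp add: H_def algebra_simps power2_eq_square)
      then have "\<bar>H s\<bar> \<le> \<bar>y' s - y' z\<bar> * \<bar>y' s + y' z\<bar> + l\<^sup>2 * (y s)\<^sup>2"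
        by (metis abs_mult abs_of_nonneg abs_triangle_ineq mult_nonneg_nonneg zero_le_power2)
      also have "\<dots> \<le> (L * h) * \<bar>y' s + y' z\<bar> + l\<^sup>2 * (y s)\<^sup>2"
        using L[of s z] s \<delta> by (intro add_right_mono mult_right_mono) (auto simp: h_def)
      also have "\<dots> = (L * \<bar>y' s + y' z\<bar> + l\<^sup>2 * \<bar>y s * (y s / h)\<bar>) * h"
        using h by (simp add: field_simps abs_mult power2_eq_square)
      finally have Hb: "\<bar>H s\<bar> \<le> (L * \<bar>y' s + y' z\<bar> + l\<^sup>2 * \<bar>y s * (y s / h)\<bar>) * h" .
      have pw: "h * (y s)\<^sup>2 powr (- \<gamma>) = (y s / h)\<^sup>2 powr (- \<gamma>) * h powr (1 - 2 * \<gamma>)"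
      proof -
        have "(y s)\<^sup>2 = (y s / h)\<^sup>2 * h powr 2" using h by (simp add: power_divide)
        then have "(y s)\<^sup>2 powr (- \<gamma>) = (y s / h)\<^sup>2 powr (- \<gamma>) * h powr (- 2 * \<gamma>)"
          by (simp add: powr_mult powr_powr del: powr_numeral)
        moreover have "h powr (1 - 2 * \<gamma>) = h powr 1 * h powr (- 2 * \<gamma>)"
          by (simp only: powr_add[symmetric]) simp
        ultimately show ?thesis using h by simp
      qed
      have "G t = G s" using Gc[of s] s by simp
      then have "\<bar>G t\<bar> = \<bar>H s\<bar> * (y s)\<^sup>2 powr (- \<gamma>)"
        by (simp add: G_def[of s] abs_mult)
      also have "\<dots> \<le> (L * \<bar>y' s + y' z\<bar> + l\<^sup>2 * \<bar>y s * (y s / h)\<bar>) * h * (y s)\<^sup>2 powr (- \<gamma>)"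
        by (intro mult_right_mono Hb) auto
      also have "\<dots> = R s" unfolding R_def h_def[symmetric] by (simp only: mult.assoc pw)
      finally show ?case .
    qed
    then have "\<bar>G t\<bar> \<le> 0"
      by (intro tendsto_lowerbound[OF limR]) auto
    then show ?thesis using False by (simp add: G_def)
  qed (rule Hz)
  then show ?thesis by (simp add: H_def)
qed

text \<open>
  The equation \<open>y'' = - l\<^sup>2 y\<close> has to be established also at the zeros of \<open>y\<close>, where the profile
  equation is degenerate. This is what transports the sine from one nodal interval to the
  next; the conserved form for \<open>y\<^sup>2\<close> alone would not exclude \<open>l = 3/2\<close>, for which \<open>|sin (l t)|\<close> is
  \<open>2\<pi>\<close>-periodic.
\<close>

lemma no_C11_profile:
  fixes y y' :: "real \<Rightarrow> real"
  assumes l: "1 < l" "l < 2"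
    and der: "\<And>t. (y has_real_derivative y' t) (at t)"
    and lip: "\<And>t. \<exists>\<delta>>0. \<exists>L. \<forall>r\<in>{t - \<delta><..<t + \<delta>}. \<forall>s\<in>{t - \<delta><..<t + \<delta>}. \<bar>y' r - y' s\<bar> \<le> L * \<bar>r - s\<bar>"
    and cy': "\<And>t. isCont y' t"
    and W: "\<And>t. ((\<lambda>t. l * y t * y' t) has_real_derivative c + (2 * l - 1) * (y' t)\<^sup>2 - l\<^sup>2 * (y t)\<^sup>2) (at t)"
    and per: "\<And>t. y (t + 2 * pi) = y t" "\<And>t. y' (t + 2 * pi) = y' t"
    and t0: "y t0 = 0" "y' t0 \<noteq> 0"
  shows False
proof -
  \<comment> \<open>at a zero of \<open>y\<close> the derivative of \<open>y y'\<close> is \<open>y'\<^sup>2\<close>, since \<open>y'\<close> is continuous, although \<open>y'\<close> need not be differentiable\<close>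
  have zero: "c = - (l - 1) * (y' z)\<^sup>2" if z: "y z = 0" for z
  proof -
    have "((\<lambda>s. l * (y s / (s - z)) * y' s) \<longlongrightarrow> l * y' z * y' z) (at z)"
      using der[of z] cy'[of z] z by (intro tendsto_intros) (auto simp: has_field_derivative_iff isCont_def)
    then have "((\<lambda>t. l * y t * y' t) has_real_derivative l * y' z * y' z) (at z)"
      using z by (simp add: has_field_derivative_iff)
    from DERIV_unique[OF this W[of z]] show ?thesis using z by (simp add: algebra_simps power2_eq_square)
  qed
  have c: "c \<noteq> 0" using zero[OF t0(1)] t0(2) l by simp
  have dy': "(y' has_real_derivative (c + (l - 1) * (y' t)\<^sup>2 - l\<^sup>2 * (y t)\<^sup>2) / (l * y t)) (at t)" if yt: "y t \<noteq> 0" for t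
  proof -
    have "((\<lambda>s. (l * y s * y' s) / (l * y s)) has_real_derivative
        ((c + (2 * l - 1) * (y' t)\<^sup>2 - l\<^sup>2 * (y t)\<^sup>2) * (l * y t) - (l * y t * y' t) * (l * y' t)) / ((l * y t) * (l * y t))) (at t)"
      using yt l by (intro DERIV_divide W DERIV_cmult der) auto
    moreover have "open {s. y s \<noteq> 0}"
      using der by (intro open_Collect_neq continuous_at_imp_continuous_on ballI DERIV_isCont[OF der]) auto
    ultimately have "(y' has_real_derivative
        ((c + (2 * l - 1) * (y' t)\<^sup>2 - l\<^sup>2 * (y t)\<^sup>2) * (l * y t) - (l * y t * y' t) * (l * y' t)) / ((l * y t) * (l * y t))) (at t)"
      by (rule has_field_derivative_transform_within_open) (use yt l in auto)
    moreover have "((c + (2 * l - 1) * (y' t)\<^sup>2 - l\<^sup>2 * (y t)\<^sup>2) * (l * y t) - (l * y t * y' t) * (l * y' t)) / ((l * y t) * (l * y t))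
        = (c + (l - 1) * (y' t)\<^sup>2 - l\<^sup>2 * (y t)\<^sup>2) / (l * y t)"
      using yt l by (simp add: divide_simps) (simp add: algebra_simps power2_eq_square)
    ultimately show ?thesis by simp
  qed
  have left: "\<exists>z0\<le>t. y z0 = 0" for t
  proof -
    have "y (t0 - 2 * pi * real n) = 0" for n
    proof (induction n)
      case (Suc n)
      then show ?case using per(1)[of "t0 - 2 * pi * real (Suc n)"] by (simp add: algebra_simps)
    qed (use t0 in simp)
    moreover obtain n where "(t0 - t) / (2 * pi) \<le> real n" using real_arch_simple by blast
    then have "t0 - 2 * pi * real n \<le> t" by (simp add: field_simps)
    ultimately show ?thesis by blast
  qed
  have H0: "(y' t)\<^sup>2 + l\<^sup>2 * (y t)\<^sup>2 + c / (l - 1) = 0" for t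
    by (rule nodal_integral_vanishes[OF l der lip W cy' zero c left dy'])
  have y'': "(y' has_real_derivative - l\<^sup>2 * y t) (at t)" for t
  proof (cases "y t = 0")
    case False
    have "c = - (l - 1) * ((y' t)\<^sup>2 + l\<^sup>2 * (y t)\<^sup>2)"
      using H0[of t] l by (simp add: field_simps)
    then have "(c + (l - 1) * (y' t)\<^sup>2 - l\<^sup>2 * (y t)\<^sup>2) / (l * y t) = - l\<^sup>2 * y t"
      using False l by (simp add: field_simps power2_eq_square)
    with dy'[OF False] show ?thesis by simp
  next
    case True
    have nz: "y' t \<noteq> 0" using zero[OF True] c by auto
    have ly': "(y' \<longlongrightarrow> y' t) (at t)" using cy'[of t] by (simp add: isCont_def)
    have ly: "(y \<longlongrightarrow> 0) (at t)" using DERIV_isCont[OF der[of t]] True by (simp add: isCont_def)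
    have lq: "((\<lambda>s. y s / (s - t)) \<longlongrightarrow> y' t) (at t)"
      using der[of t] True by (simp add: has_field_derivative_iff)
    \<comment> \<open>by \<open>H = 0\<close>, \<open>(y' s)\<^sup>2 - (y' t)\<^sup>2 = - l\<^sup>2 (y s)\<^sup>2\<close>, so the difference quotient of \<open>y'\<close> is the following expression\<close>
    have "((\<lambda>s. - l\<^sup>2 * y s * (y s / (s - t)) / (y' s + y' t)) \<longlongrightarrow> - l\<^sup>2 * 0 * y' t / (y' t + y' t)) (at t)"
      using nz by (intro tendsto_intros ly' ly lq) auto
    moreover have "eventually (\<lambda>s. - l\<^sup>2 * y s * (y s / (s - t)) / (y' s + y' t) = (y' s - y' t) / (s - t)) (at t)"
    proof -
      have "((\<lambda>s. y' s + y' t) \<longlongrightarrow> y' t + y' t) (at t)" by (intro tendsto_intros ly')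
      then have "eventually (\<lambda>s. y' s + y' t \<noteq> 0) (at t)"
        by (rule tendsto_imp_eventually_ne) (use nz in auto)
      then show ?thesis
      proof eventually_elim
        case (elim s)
        have "(y' s - y' t) * (y' s + y' t) = - l\<^sup>2 * y s * y s"
          using H0[of s] H0[of t] True by (simp add: algebra_simps power2_eq_square)
        then have "y' s - y' t = - l\<^sup>2 * y s * y s / (y' s + y' t)"
          using elim by (simp add: field_simps)
        then show ?case by simp
      qed
    qed
    ultimately have "((\<lambda>s. (y' s - y' t) / (s - t)) \<longlongrightarrow> - l\<^sup>2 * 0 * y' t / (y' t + y' t)) (at t)"
      by (rule Lim_transform_eventually)
    then show ?thesis using True by (simp add: has_field_derivative_iff)
  qed
  \<comment> \<open>constant along solutions; comparing its values at \<open>t0\<close> and \<open>t0 + 2\<pi>\<close> gives \<open>cos (2\<pi>l) = 1\<close>\<close>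
  define f where "f t = y' t * cos (l * (t - t0)) + l * y t * sin (l * (t - t0))" for t
  have "(f has_real_derivative 0) (at t)" for t
    unfolding f_def by (auto intro!: derivative_eq_intros y'' der simp: algebra_simps power2_eq_square)
  then have "f (t0 + 2 * pi) = f t0" by (intro DERIV_isconst_all) auto
  then have "y' t0 * cos (l * (2 * pi)) = y' t0"
    using per t0(1) by (simp add: f_def)
  then have "cos (l * (2 * pi)) = 1" using t0(2) by simp
  then obtain n :: int where "l * (2 * pi) = of_int n * 2 * pi"
    using cos_one_2pi_int by blast
  then have "l = of_int n" by simp
  with l have "1 < n" "n < 2" by linarith+
  then show False by simp
qed

theorem proposition3p6:
  fixes \<alpha> :: real and U :: "real^2 \<Rightarrow> real^2"
  assumes "0 < \<alpha>" and "\<alpha> < 1"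
    and "homogeneous_steady_solution \<alpha> U"
    and "\<exists>\<xi>. \<xi> \<noteq> 0 \<and> stagnation_point (pseudo_velocity \<alpha> U) \<xi>"
  shows "\<exists>\<theta>. \<forall>r>0. \<not> curl_continuous_at U (r *\<^sub>R e_r \<theta>)"
proof (rule ccontr)
  assume "\<not> ?thesis"
  then have cont: "\<exists>r>0. curl_continuous_at U (r *\<^sub>R e_r \<theta>)" for \<theta> by blast
  define l where "l = 2 - \<alpha>"
  obtain \<psi> d\<psi> p where sol: "H1_circle \<psi> d\<psi>"
      "\<forall>r>0. \<forall>\<theta>. U (r *\<^sub>R e_r \<theta>) =
            r powr (l - 1) *\<^sub>R (- d\<psi> \<theta> *\<^sub>R e_r \<theta> + (l * \<psi> \<theta>) *\<^sub>R e_theta \<theta>)"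
      "weak_steady_euler U p"
    using assms(3) unfolding homogeneous_steady_solution_def Let_def l_def by blast
  interpret homogeneous_flow l U \<psi> d\<psi> p
    by unfold_locales (use assms(1,2) sol in \<open>auto simp: l_def\<close>)
  have loc: "\<exists>\<delta>>0. \<exists>L. (\<forall>t\<in>{t1 - \<delta><..<t1 + \<delta>}. (\<psi> has_real_derivative d\<psi> t) (at t)) \<and>
      (\<forall>s\<in>{t1 - \<delta><..<t1 + \<delta>}. \<forall>t\<in>{t1 - \<delta><..<t1 + \<delta>}. \<bar>d\<psi> s - d\<psi> t\<bar> \<le> L * \<bar>s - t\<bar>)" for t1
  proof -
    obtain r where r: "0 < r" "curl_continuous_at U (r *\<^sub>R e_r t1)" using cont by blast
    show ?thesis by (rule curl_continuous_imp_local_C11[OF r(2,1)])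
  qed
  have der: "(\<psi> has_real_derivative d\<psi> t) (at t)" for t
  proof -
    obtain \<delta> where "0 < \<delta>" "\<forall>s\<in>{t - \<delta><..<t + \<delta>}. (\<psi> has_real_derivative d\<psi> s) (at s)"
      using loc[of t] by (elim exE conjE) (rule that)
    then show ?thesis by auto
  qed
  have cd: "isCont d\<psi> t" for t
  proof -
    obtain \<delta> L where \<delta>: "0 < \<delta>"
      and L': "\<forall>r\<in>{t - \<delta><..<t + \<delta>}. \<forall>s\<in>{t - \<delta><..<t + \<delta>}. \<bar>d\<psi> r - d\<psi> s\<bar> \<le> L * \<bar>r - s\<bar>"
      using loc[of t] by (elim exE conjE) (rule that)
    have L: "\<bar>d\<psi> s - d\<psi> t\<bar> \<le> L * \<bar>s - t\<bar>" if "s \<in> {t - \<delta><..<t + \<delta>}" for s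
      using L' that \<delta> by auto
    have "eventually (\<lambda>s. s \<in> {t - \<delta><..<t + \<delta>}) (at t)"
      using \<delta> by (intro eventually_at_in_open') auto
    then have ev: "eventually (\<lambda>s. norm (d\<psi> s - d\<psi> t) \<le> L * \<bar>s - t\<bar>) (at t)"
      by eventually_elim (use L in auto)
    have "((\<lambda>s. L * \<bar>s - t\<bar>) \<longlongrightarrow> L * \<bar>t - t\<bar>) (at t)" by (intro tendsto_intros)
    then have "((\<lambda>s. d\<psi> s - d\<psi> t) \<longlongrightarrow> 0) (at t)"
      by (intro Lim_null_comparison[OF ev]) simp
    then show ?thesis by (simp add: isCont_def LIM_zero_iff)
  qed
  then have "continuous_on UNIV d\<psi>" by (simp add: continuous_on_eq_continuous_at)
  then obtain c where W: "\<And>t. ((\<lambda>t. l * \<psi> t * d\<psi> t) has_real_derivative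
      c + (2 * l - 1) * (d\<psi> t)\<^sup>2 - l\<^sup>2 * (\<psi> t)\<^sup>2) (at t)"
    using first_integral[OF der] by blast
  obtain \<xi> where \<xi>: "\<xi> \<noteq> 0" "U \<xi> = (1 / \<alpha>) *\<^sub>R \<xi>"
    using assms(4) by (auto simp: stagnation_point_def pseudo_velocity_def)
  obtain r t0 where rt: "r \<ge> 0" "\<bar>t0 - 0\<bar> \<le> pi" "\<xi> = r *\<^sub>R e_r t0" by (rule polar_coordinates)
  have r: "0 < r" using rt \<xi>(1) by (cases "r = 0") auto
  have cs: "(cos t0)\<^sup>2 + (sin t0)\<^sup>2 = 1" by simp
  have eqs: "(- (r powr (l - 1) * d\<psi> t0)) * cos t0 - (r powr (l - 1) * (l * \<psi> t0)) * sin t0 = (r / \<alpha>) * cos t0 - 0 * sin t0"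
    "(- (r powr (l - 1) * d\<psi> t0)) * sin t0 + (r powr (l - 1) * (l * \<psi> t0)) * cos t0 = (r / \<alpha>) * sin t0 + 0 * cos t0"
    using U_components[OF r, of t0] \<xi>(2) rt(3) by auto
  have "- (r powr (l - 1) * d\<psi> t0) = r / \<alpha>" "r powr (l - 1) * (l * \<psi> t0) = 0"
    using eqs cs by algebra+
  then have "\<psi> t0 = 0" "d\<psi> t0 \<noteq> 0" using r l assms(1) by auto
  moreover have "\<psi> (t + 2 * pi) = \<psi> t" "d\<psi> (t + 2 * pi) = d\<psi> t" for t
    using H1 by (auto simp: H1_circle_def)
  moreover have "\<exists>\<delta>>0. \<exists>L. \<forall>r\<in>{t - \<delta><..<t + \<delta>}. \<forall>s\<in>{t - \<delta><..<t + \<delta>}. \<bar>d\<psi> r - d\<psi> s\<bar> \<le> L * \<bar>r - s\<bar>" for t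
  proof -
    obtain \<delta> L where "0 < \<delta>"
      "\<forall>r\<in>{t - \<delta><..<t + \<delta>}. \<forall>s\<in>{t - \<delta><..<t + \<delta>}. \<bar>d\<psi> r - d\<psi> s\<bar> \<le> L * \<bar>r - s\<bar>"
      using loc[of t] by (elim exE conjE) (rule that)
    then show ?thesis by (intro exI[of _ \<delta>] exI[of _ L] conjI)
  qed
  ultimately show False
    using no_C11_profile[OF l der _ cd W] by blast
qed

end
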